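(* Let $\gamma,\gamma'\in(0,1)$ with $\gamma+\gamma'<1$. There exists a constant $C_0=C_0(\gamma,\gamma')>0$ such that for every Borel set $A\subseteq[0,1]^2$ with $\lambda(A)=\gamma$ there exists a bijection $\phi_0:[0,1]^2\to[0,1]^2$ such that (1) $\phi_0$ is $C_0$-bi-Lipschitz, i.e. $\frac{1}{C_0}|x-y|\le|\phi_0(x)-\phi_0(y)|\le C_0|x-y|$ for all $x,y\in[0,1]^2$; (2) $\phi_0(x)=x$ for all $x\in\partial[0,1]^2$; (3) $\lambda(\phi_0(A))\ge 1-\gamma'$.
   Context: $\lambda$ denotes two-dimensional Lebesgue measure; $|\cdot|$ is the Euclidean norm on $\mathbb{R}^2$. *)

theory Defs
  imports "HOL-Analysis.Analysis"
begin

definition unit_square :: "(real^2) set" where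
  "unit_square = cbox 0 1"

end

theory Submission
  imports Defs "HOL-Probability.Probability_Measure"
begin

text \<open>
  It suffices to gain a fixed amount of area with a 2-bi-Lipschitz map, because finitely many such
  maps can be composed. The map is a shear \<open>(x, y) \<mapsto> (x + t u(x, y), y)\<close> (or its mirror image), with
  \<open>u\<close> Lipschitz and zero outside the open square; it changes the area of \<open>A\<close> by exactly
  \<open>t \<integral>\<^sub>A \<partial>\<^sub>xu\<close>. So a function \<open>u\<close> with universally bounded gradient is wanted for which this integral is
  at least a constant multiple of \<open>\<lambda>(A) (1 - \<lambda>(A))\<close>.

  Take \<open>u\<close> to be a sum over dyadic rectangles \<open>R\<close> of \<open>a\<^sub>R T\<^sub>R(x) P\<^sub>R(y)\<close>, where \<open>T\<^sub>R\<close> is a tent whose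
  derivative is a Haar function, \<open>P\<^sub>R\<close> a trapezoid equal to 1 off two thin strips, and \<open>a\<^sub>R\<close> the Haar
  coefficient of the centred indicator \<open>f\<close> of \<open>A\<close>. If only scales in one residue class mod 9 are used,
  the terms of \<open>\<partial>\<^sub>xu\<close> are orthogonal to each other, and so are those of \<open>\<partial>\<^sub>yu\<close>. Hence \<open>\<integral> f \<partial>\<^sub>xu\<close> is
  comparable to the energy \<open>\<Sum> |R| a\<^sub>R\<^sup>2\<close>, up to the small error from the strips, and \<open>\<nabla>u\<close> is bounded in
  mean square. To bound it pointwise, rectangles on which the gradient accumulated at larger scales is
  already large are dropped. By Chebyshev these cover little area, and by Bessel they carry little energy.
\<close>

section \<open>Uniform measure on the unit square\<close>

text \<open>The trapezoids are forced: neighbouring rectangles carry unrelated coefficients, so each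
  term must vanish on the horizontal edges for \<open>u\<close> to be continuous in y. Strips of
  relative width \<open>2^-m\<close> give slopes \<open>2^m\<close>, and the derivative of a
  trapezoid is constant only on cells \<open>2^m\<close> times finer than its rectangle.
  Orthogonality in y therefore asks for active scales that are \<open>m\<close> apart. Keeping one
  residue class costs a factor \<open>1/m\<close> of the energy, while the strips cost only a power
  of \<open>2^-m\<close>, so a large \<open>m\<close> wins. If half of what remains survives the
  stopping, the kept energy \<open>Y\<close> satisfies \<open>E \<le> 6 m Y\<close>, where
  \<open>E\<close> is the squared norm of \<open>f\<close>. The strip error is at most the root of
  \<open>E Y 2 / 2^m\<close>, which is below \<open>Y / 2\<close> once
  \<open>48 m \<le> 2^m\<close>; 9 is the least positive such \<open>m\<close>. The mirrored shear
  is needed because \<open>f\<close> may depend on y alone, and then all its Haar differences in x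
  vanish.\<close>

definition unif :: "real measure" where
  "unif = density lborel (indicator {0..<1})"

lemma sets_unif [simp, measurable_cong]: "sets unif = sets borel"
  by (simp add: unif_def)

lemma space_unif [simp]: "space unif = UNIV"
  by (simp add: unif_def)

interpretation unif: prob_space unif
  by standard (simp add: unif_def emeasure_density)

interpretation unif2: pair_prob_space unif unif ..

lemma integral_unif:
  fixes f :: "real \<Rightarrow> real"
  assumes [measurable]: "f \<in> borel_measurable borel"
  shows "(\<integral>x. f x \<partial>unif) = (\<integral>x. indicator {0..<1} x * f x \<partial>lborel)"
proof -
  have "unif = density lborel (\<lambda>x. ennreal (indicator {0..<1} x))"
    unfolding unif_def by (intro arg_cong2[where f=density]) (auto simp: indicator_def)
  then show ?thesis
    using integral_density[of f lborel "indicator {0..<1}"] by simp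
qed

text \<open>For \<open>x\<close> in the half-open unit interval exactly one summand survives, the
  one with \<open>i = \<lfloor>real L * x\<rfloor>\<close>; for other \<open>x\<close> all vanish.
  Half-open cells make this true at every point.\<close>

lemma indicator_Ico_shift:
  fixes L :: nat and x :: real and C :: "int \<Rightarrow> real" and h :: "real \<Rightarrow> real"
  assumes "L > 0"
  shows "(\<Sum>i<L. C (int i) * (indicator {0..<1} (real L * x - real i) * h (real L * x - real i)))
        = indicator {0..<1} x * (C \<lfloor>real L * x\<rfloor> * h (real L * x - of_int \<lfloor>real L * x\<rfloor>))"
proof (cases "x \<in> {0..<1}")
  case True
  define k where "k = nat \<lfloor>real L * x\<rfloor>"
  have k: "int k = \<lfloor>real L * x\<rfloor>" using True by (simp add: k_def)
  have "real L * x < real L" using True assms by simp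
  then have kL: "k < L" using k by (metis floor_less_iff of_int_of_nat_eq of_nat_less_iff)
  have *: "indicator {0..<1} (real L * x - real i) = (if i = k then 1 else 0::real)" for i
  proof -
    have "real L * x - real i \<in> {0..<1} \<longleftrightarrow> \<lfloor>real L * x\<rfloor> = int i"
      by (auto simp: floor_eq_iff)
    then show ?thesis using k by (auto simp: indicator_def)
  qed
  have "(\<Sum>i<L. C (int i) * (indicator {0..<1} (real L * x - real i) * h (real L * x - real i)))
     = (\<Sum>i<L. if i = k then C (int k) * h (real L * x - real k) else 0)"
    by (intro sum.cong) (auto simp: *)
  also have "\<dots> = C (int k) * h (real L * x - real k)" using kL by simp
  finally show ?thesis using True k by (metis indicator_simps(1) mult_1 of_int_of_nat_eq)
next
  case False
  have "real L * x - real i \<notin> {0..<1}" if "i < L" for i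
  proof
    assume a: "real L * x - real i \<in> {0..<1}"
    then have "0 \<le> real L * x" "real L * x < real i + 1" by auto
    moreover have "real i + 1 \<le> real L" using that by linarith
    ultimately have *: "real L * x < real L * 1" by linarith
    have "0 \<le> x" using \<open>0 \<le> real L * x\<close> assms by (simp add: zero_le_mult_iff)
    from * have "x < 1" using assms by (simp only: mult_less_cancel_left_pos of_nat_0_less_iff)
    then show False using False \<open>0 \<le> x\<close> by auto
  qed
  then show ?thesis using False by simp
qed

text \<open>On the cell where \<open>\<lfloor>real L * x\<rfloor> = i\<close>, periodicity turns
  \<open>q (real L * x)\<close> into a rescaled copy of \<open>q\<close> on the unit interval. Both
  orthogonality relations below come from here: a \<open>q\<close> with mean zero kills whatever is
  constant on the cells.\<close>

lemma integral_unif_cells: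
  fixes L :: nat and C :: "int \<Rightarrow> real" and q :: "real \<Rightarrow> real"
  assumes L: "L > 0" and q[measurable]: "q \<in> borel_measurable borel"
    and bd: "\<And>s. \<bar>q s\<bar> \<le> K" and per: "\<And>s i. q (s - of_int i) = q s"
  shows "(\<integral>x. C \<lfloor>real L * x\<rfloor> * q (real L * x) \<partial>unif) = (\<Sum>i<L. C (int i)) / real L * (\<integral>x. q x \<partial>unif)"
proof -
  let ?h = "\<lambda>x. indicator {0..<1} x * q x"
  have int_h: "integrable lborel ?h"
    using integrableI_bounded_set_indicator[of "{0..<1}" lborel q K] bd by simp
  have aff: "(\<integral>x. ?h (real L * x - real i) \<partial>lborel) = (\<integral>x. ?h x \<partial>lborel) / real L" for i :: nat
    using lborel_integral_real_affine[of "real L" ?h "- real i"] L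
    by (simp add: field_simps)
  have int_aff: "integrable lborel (\<lambda>x. ?h (real L * x - real i))" for i :: nat
    using lborel_integrable_real_affine[OF int_h, of "real L" "- real i"] L by simp
  have "(\<integral>x. C \<lfloor>real L * x\<rfloor> * q (real L * x) \<partial>unif)
      = (\<integral>x. indicator {0..<1} x * (C \<lfloor>real L * x\<rfloor> * q (real L * x)) \<partial>lborel)"
    by (subst integral_unif) (simp_all)
  also have "\<dots> = (\<integral>x. (\<Sum>i<L. C (int i) * ?h (real L * x - real i)) \<partial>lborel)"
    by (simp only: indicator_Ico_shift[OF L, of C _ q] per)
  also have "\<dots> = (\<Sum>i<L. C (int i) * (\<integral>x. ?h (real L * x - real i) \<partial>lborel))"
    using int_aff by (subst Bochner_Integration.integral_sum) auto
  also have "\<dots> = (\<Sum>i<L. C (int i)) / real L * (\<integral>x. q x \<partial>unif)"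
    unfolding aff by (simp add: integral_unif sum_distrib_right sum_divide_distrib mult.commute)
  finally show ?thesis .
qed

lemma integral_unif_floor:
  fixes L :: nat and C :: "int \<Rightarrow> real"
  assumes "L > 0"
  shows "(\<integral>x. C \<lfloor>real L * x\<rfloor> \<partial>unif) = (\<Sum>i<L. C (int i)) / real L"
  using integral_unif_cells[OF assms, of "\<lambda>_. 1" 1 C] unif.prob_space by simp

lemma integral_unif_orthogonal:
  fixes L :: nat and c q :: "real \<Rightarrow> real"
  assumes "L > 0" "q \<in> borel_measurable borel"
    and "\<And>s. \<bar>q s\<bar> \<le> K" "\<And>s i. q (s - of_int i) = q s" "(\<integral>x. q x \<partial>unif) = 0"
    and c: "\<And>x x'. \<lfloor>real L * x\<rfloor> = \<lfloor>real L * x'\<rfloor> \<Longrightarrow> c x = c x'"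
  shows "(\<integral>x. c x * q (real L * x) \<partial>unif) = 0"
proof -
  \<comment> \<open>The left endpoint represents its cell, which turns \<open>c\<close> into a
    function of the cell index.\<close>
  have "c (of_int \<lfloor>real L * x\<rfloor> / real L) = c x" for x
    using assms(1) by (auto intro!: c)
  then show ?thesis
    using integral_unif_cells[OF assms(1-4), of "\<lambda>i. c (of_int i / real L)"] assms(5) by simp
qed

section \<open>The product measure as Lebesgue measure on the half-open square\<close>

lemma measurable_fst_snd [measurable]: 
  "fst \<in> borel_measurable (borel :: (real \<times> real) measure)"
  "snd \<in> borel_measurable (borel :: (real \<times> real) measure)"
  by (intro borel_measurable_continuous_onI continuous_intros)+

lemma Ico2_borel [measurable]: "{0..<1::real} \<times> {0..<1::real} \<in> sets borel"
  by (simp add: pair_measureI flip: borel_prod)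

lemma space_unif2 [simp]: "space (unif \<Otimes>\<^sub>M unif) = UNIV"
  by (simp add: space_pair_measure)

lemma unif2_eq: "unif \<Otimes>\<^sub>M unif = density lborel (indicator ({0..<1} \<times> {0..<1}))"
proof -
  have sf: "sigma_finite_measure (density lborel (indicator {0..<1::real}))"
    using unif.sigma_finite_measure_axioms by (simp add: unif_def)
  have "unif \<Otimes>\<^sub>M unif = density (lborel \<Otimes>\<^sub>M lborel) (\<lambda>(x,y). indicator {0..<1} x * indicator {0..<1} y)"
    unfolding unif_def
    by (rule pair_measure_density) (auto intro: sf lborel.sigma_finite_measure_axioms)
  also have "\<dots> = density lborel (indicator ({0..<1} \<times> {0..<1}))"
    unfolding lborel_prod
    by (intro arg_cong2[where f=density]) (auto simp: indicator_def fun_eq_iff)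
  finally show ?thesis .
qed

lemma AE_unif2: "AE z in unif \<Otimes>\<^sub>M unif. fst z \<in> {0..<1} \<and> snd z \<in> {0..<1}"
proof -
  show ?thesis
    unfolding unif2_eq by (subst AE_density) (auto simp: indicator_def split: if_splits)
qed

lemma sets_unif2 [simp, measurable_cong]: "sets (unif \<Otimes>\<^sub>M unif) = sets (borel :: (real \<times> real) measure)"
  unfolding unif2_eq by simp

lemma integrable_unif2:
  fixes f :: "real \<times> real \<Rightarrow> real"
  assumes "f \<in> borel_measurable borel" "\<And>z. \<bar>f z\<bar> \<le> K"
  shows "integrable (unif \<Otimes>\<^sub>M unif) f"
proof (rule unif2.P.integrable_const_bound[where B=K])
  show "f \<in> borel_measurable (unif \<Otimes>\<^sub>M unif)"
    using assms(1) by (subst measurable_cong_sets[OF sets_unif2 refl])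
qed (use assms(2) in simp)

lemma integral_unif2_snd:
  fixes f :: "real \<times> real \<Rightarrow> real"
  assumes "integrable (unif \<Otimes>\<^sub>M unif) f"
  shows "(\<integral>z. f z \<partial>(unif \<Otimes>\<^sub>M unif)) = (\<integral>y. \<integral>x. f (x, y) \<partial>unif \<partial>unif)"
  using unif2.integral_snd[of "\<lambda>x y. f (x,y)"] assms by simp

lemma integral_unif2_fst:
  fixes f :: "real \<times> real \<Rightarrow> real"
  assumes "integrable (unif \<Otimes>\<^sub>M unif) f"
  shows "(\<integral>z. f z \<partial>(unif \<Otimes>\<^sub>M unif)) = (\<integral>x. \<integral>y. f (x, y) \<partial>unif \<partial>unif)"
  using unif2.integral_fst[of "\<lambda>x y. f (x,y)"] assms by simp

section \<open>Dyadic averages and their energy\<close>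

text \<open>The Rademacher function of period 1: one Haar oscillation on every unit interval. It is
  the derivative of \<open>tent\<close> off the multiples of 1/2.\<close>

definition rad :: "real \<Rightarrow> real" where
  "rad s = (if even \<lfloor>2 * s\<rfloor> then 1 else - 1)"

text \<open>The mean of \<open>F\<close> over a dyadic rectangle, the prefactor being its reciprocal
  area. Integer indices let floors be inserted directly; rectangles outside the square get the value
  0.\<close>

definition avg :: "nat \<Rightarrow> nat \<Rightarrow> (real \<times> real \<Rightarrow> real) \<Rightarrow> int \<Rightarrow> int \<Rightarrow> real" where
  "avg n k F i j = 2^n * 2^k *
     (\<integral>z. (if \<lfloor>2^n * fst z\<rfloor> = i \<and> \<lfloor>2^k * snd z\<rfloor> = j then F z else 0) \<partial>(unif \<Otimes>\<^sub>M unif))"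

text \<open>The squared L2 norm of the conditional expectation of \<open>F\<close> on the dyadic
  grid.\<close>

definition energy :: "nat \<Rightarrow> nat \<Rightarrow> (real \<times> real \<Rightarrow> real) \<Rightarrow> real" where
  "energy n k F = (\<Sum>i<2^n. \<Sum>j<2^k. (avg n k F (int i) (int j))\<^sup>2) / (2^n * 2^k)"

lemma rad_measurable [measurable]: "rad \<in> borel_measurable borel"
  unfolding rad_def by measurable

lemma abs_rad [simp]: "\<bar>rad s\<bar> = 1"
  by (simp add: rad_def)

lemma rad_sq [simp]: "(rad s)\<^sup>2 = 1" "rad s * rad s = 1"
  by (simp_all add: rad_def power2_eq_square)

lemma rad_periodic: "rad (s - of_int i) = rad s"
proof -
  have "2 * (s - of_int i) = 2 * s - of_int (2 * i)" by simp
  then show ?thesis unfolding rad_def by (simp only: floor_diff_of_int) simp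
qed

lemma integral_rad: "(\<integral>x. rad x \<partial>unif) = 0"
  using integral_unif_floor[of 2 "\<lambda>i. if even i then 1 else - 1"]
  by (simp add: rad_def numeral_2_eq_2 lessThan_Suc)

lemma measurable_floor2 [measurable]:
  fixes c :: "int \<Rightarrow> int \<Rightarrow> real" and f g :: "'a \<Rightarrow> real"
  assumes [measurable]: "f \<in> borel_measurable M" "g \<in> borel_measurable M"
  shows "(\<lambda>z. c \<lfloor>f z\<rfloor> \<lfloor>g z\<rfloor>) \<in> borel_measurable M"
proof -
  have "(\<lambda>z. (\<lambda>i z. c i \<lfloor>g z\<rfloor>) (\<lfloor>f z\<rfloor>) z) \<in> borel_measurable M"
    by (rule measurable_compose_countable) measurable
  then show ?thesis by simp
qed

lemma nat_floor_pow2: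
  fixes x :: real
  assumes "x \<in> {0..<1}"
  obtains i where "i < 2^n" "\<lfloor>2^n * x\<rfloor> = int i"
proof
  have "0 \<le> \<lfloor>2^n * x\<rfloor>" using assms by simp
  then show "\<lfloor>2^n * x\<rfloor> = int (nat \<lfloor>2^n * x\<rfloor>)" by simp
  have "\<lfloor>2^n * x\<rfloor> < 2^n"
    using assms by (simp add: floor_less_iff)
  then show "nat \<lfloor>2^n * x\<rfloor> < 2^n"
    using \<open>0 \<le> \<lfloor>2^n * x\<rfloor>\<close> by (simp add: nat_less_iff)
qed

lemma integral_step:
  fixes c :: "int \<Rightarrow> int \<Rightarrow> real"
  assumes "\<And>i j. \<bar>c i j\<bar> \<le> B"
  shows "(\<integral>z. c \<lfloor>2^n * fst z\<rfloor> \<lfloor>2^k * snd z\<rfloor> \<partial>(unif \<Otimes>\<^sub>M unif))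
    = (\<Sum>i<2^n. \<Sum>j<2^k. c (int i) (int j)) / (2^n * 2^k)"
proof -
  have "(\<integral>z. c \<lfloor>2^n * fst z\<rfloor> \<lfloor>2^k * snd z\<rfloor> \<partial>(unif \<Otimes>\<^sub>M unif))
     = (\<integral>x. \<integral>y. c \<lfloor>2^n * x\<rfloor> \<lfloor>2^k * y\<rfloor> \<partial>unif \<partial>unif)"
    using assms by (subst integral_unif2_fst) (auto intro!: integrable_unif2[where K=B])
  also have "\<dots> = (\<integral>x. (\<Sum>j<2^k. c \<lfloor>2^n * x\<rfloor> (int j)) / 2^k \<partial>unif)"
    using integral_unif_floor[of "2^k" "c _"] by simp
  also have "\<dots> = (\<Sum>i<2^n. \<Sum>j<2^k. c (int i) (int j)) / (2^n * 2^k)"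
    using integral_unif_floor[of "2^n" "\<lambda>i. (\<Sum>j<2^k. c i (int j)) / 2^k"]
    by (simp add: sum_divide_distrib mult.commute)
  finally show ?thesis .
qed

text \<open>Almost every point lies in exactly one grid rectangle, so a step function paired with
  \<open>F\<close> sees only the averages of \<open>F\<close>.\<close>

lemma integral_cells:
  fixes c :: "int \<Rightarrow> int \<Rightarrow> real"
  assumes [measurable]: "F \<in> borel_measurable borel" and F: "\<And>z. \<bar>F z\<bar> \<le> B"
  shows "(\<integral>z. c \<lfloor>2^n * fst z\<rfloor> \<lfloor>2^k * snd z\<rfloor> * F z \<partial>(unif \<Otimes>\<^sub>M unif))
    = (\<Sum>i<2^n. \<Sum>j<2^k. c (int i) (int j) * avg n k F (int i) (int j)) / (2^n * 2^k)"
proof -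
  let ?M = "unif \<Otimes>\<^sub>M unif"
  let ?G = "\<lambda>i j z. if \<lfloor>2^n * fst z\<rfloor> = int i \<and> \<lfloor>2^k * snd z\<rfloor> = int j then F z else 0"
  have B: "0 \<le> B" using F[of undefined] by linarith
  have int: "integrable ?M (?G i j)" for i j
    using F B by (intro integrable_unif2[where K=B]) auto
  have "AE z in ?M. c \<lfloor>2^n * fst z\<rfloor> \<lfloor>2^k * snd z\<rfloor> * F z
     = (\<Sum>i<2^n. \<Sum>j<2^k. c (int i) (int j) * ?G i j z)"
    using AE_unif2
  proof eventually_elim
    case (elim z)
    obtain i0 where i0: "i0 < 2^n" "\<lfloor>2^n * fst z\<rfloor> = int i0" using elim nat_floor_pow2 by blast
    obtain j0 where j0: "j0 < 2^k" "\<lfloor>2^k * snd z\<rfloor> = int j0" using elim nat_floor_pow2 by blast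
    have "(\<Sum>i<2^n. \<Sum>j<2^k. c (int i) (int j) * ?G i j z)
        = (\<Sum>i<2^n. \<Sum>j<2^k. if j = j0 then (if i = i0 then c (int i0) (int j0) * F z else 0) else 0)"
      using i0 j0 by (intro sum.cong) auto
    also have "\<dots> = c (int i0) (int j0) * F z"
      using i0 j0 by simp
    finally show ?case using i0 j0 by simp
  qed
  then have "(\<integral>z. c \<lfloor>2^n * fst z\<rfloor> \<lfloor>2^k * snd z\<rfloor> * F z \<partial>?M)
      = (\<integral>z. (\<Sum>i<2^n. \<Sum>j<2^k. c (int i) (int j) * ?G i j z) \<partial>?M)"
    by (intro integral_cong_AE) measurable
  also have "\<dots> = (\<Sum>i<2^n. \<Sum>j<2^k. c (int i) (int j) * (\<integral>z. ?G i j z \<partial>?M))"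
    using int by (subst Bochner_Integration.integral_sum; (intro sum.cong refl Bochner_Integration.integrable_sum)?)
      (auto simp: Bochner_Integration.integral_sum)
  also have "\<dots> = (\<Sum>i<2^n. \<Sum>j<2^k. c (int i) (int j) * avg n k F (int i) (int j)) / (2^n * 2^k)"
    by (simp add: avg_def sum_divide_distrib)
  finally show ?thesis .
qed

lemma abs_avg_le_1:
  assumes [measurable]: "F \<in> borel_measurable borel" and F: "\<And>z. \<bar>F z\<bar> \<le> 1"
  shows "\<bar>avg n k F i j\<bar> \<le> 1"
proof -
  let ?M = "unif \<Otimes>\<^sub>M unif"
  let ?d = "\<lambda>i' j'. if i' = i \<and> j' = j then 1 else 0 :: real"
  \<comment> \<open>At most one index pair equals \<open>(i, j)\<close>, and none does if the
    rectangle lies outside the square.\<close>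
  have "(\<Sum>i<2^n. \<Sum>j<2^k. ?d (int i) (int j)) \<le> 1"
  proof -
    have "(\<Sum>i<2^n. \<Sum>j<2^k. ?d (int i) (int j)) = (\<Sum>i'<2^n. if i' = nat i then (\<Sum>j'<2^k. if j' = nat j then ?d (int (nat i)) (int (nat j)) else 0) else 0)"
    proof (intro sum.cong refl)
      fix i' :: nat
      show "(\<Sum>j<2^k. ?d (int i') (int j)) = (if i' = nat i then (\<Sum>j'<2^k. if j' = nat j then ?d (int (nat i)) (int (nat j)) else 0) else 0)"
        by (cases "i' = nat i") (auto simp del: sum.delta intro!: sum.neutral sum.cong)
    qed
    also have "\<dots> \<le> 1" by simp
    finally show ?thesis .
  qed
  then have *: "(\<integral>z. ?d \<lfloor>2^n * fst z\<rfloor> \<lfloor>2^k * snd z\<rfloor> \<partial>?M) \<le> 1 / (2^n * 2^k)"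
    by (subst integral_step[where B=1]) (auto intro: divide_right_mono)
  have "\<bar>\<integral>z. (if \<lfloor>2^n * fst z\<rfloor> = i \<and> \<lfloor>2^k * snd z\<rfloor> = j then F z else 0) \<partial>?M\<bar>
     \<le> (\<integral>z. ?d \<lfloor>2^n * fst z\<rfloor> \<lfloor>2^k * snd z\<rfloor> \<partial>?M)"
    using F by (intro integral_abs_bound[THEN order_trans] integral_mono)
      (auto intro!: integrable_unif2[where K=1])
  also note *
  finally show ?thesis by (simp add: avg_def abs_mult field_simps)
qed

lemma floor_double_eq:
  fixes s :: real
  shows "\<lfloor>2 * s\<rfloor> = 2 * i \<longleftrightarrow> \<lfloor>s\<rfloor> = i \<and> rad s = 1"
    and "\<lfloor>2 * s\<rfloor> = 2 * i + 1 \<longleftrightarrow> \<lfloor>s\<rfloor> = i \<and> rad s = - 1"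
proof -
  have "\<lfloor>s\<rfloor> = \<lfloor>2 * s\<rfloor> div 2"
    using floor_divide_of_int_eq[of ] by linarith
  then show "\<lfloor>2 * s\<rfloor> = 2 * i \<longleftrightarrow> \<lfloor>s\<rfloor> = i \<and> rad s = 1"
    and "\<lfloor>2 * s\<rfloor> = 2 * i + 1 \<longleftrightarrow> \<lfloor>s\<rfloor> = i \<and> rad s = - 1"
    by (auto simp: rad_def)
qed

text \<open>\<open>rad (2^n * fst z)\<close> is 1 on the left half of a rectangle and -1 on the
  right half. Half the sum of the two averages is the average over the whole; half their difference
  is the Haar coefficient.\<close>

lemma avg_split_x:
  assumes [measurable]: "F \<in> borel_measurable borel" and F: "\<And>z. \<bar>F z\<bar> \<le> B"
  shows "avg n k F i j = (avg (Suc n) k F (2 * i) j + avg (Suc n) k F (2 * i + 1) j) / 2"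
    and "avg n k (\<lambda>z. F z * rad (2^n * fst z)) i j
       = (avg (Suc n) k F (2 * i) j - avg (Suc n) k F (2 * i + 1) j) / 2"
proof -
  let ?M = "unif \<Otimes>\<^sub>M unif"
  let ?G = "\<lambda>i z. if \<lfloor>2^(Suc n) * fst z\<rfloor> = i \<and> \<lfloor>2^k * snd z\<rfloor> = j then F z else 0"
  have B: "0 \<le> B" using F[of undefined] by linarith
  have int: "integrable ?M (?G i)" for i
    using F B by (intro integrable_unif2[where K=B]) auto
  have a: "2^(Suc n) * x = 2 * (2^n * x)" for x :: real by simp
  have G: "?G (2 * i) z = (if \<lfloor>2^n * fst z\<rfloor> = i \<and> \<lfloor>2^k * snd z\<rfloor> = j \<and> rad (2^n * fst z) = 1 then F z else 0)"
    "?G (2 * i + 1) z = (if \<lfloor>2^n * fst z\<rfloor> = i \<and> \<lfloor>2^k * snd z\<rfloor> = j \<and> rad (2^n * fst z) = -1 then F z else 0)" for z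
    unfolding a floor_double_eq by auto
  have r: "rad s = 1 \<or> rad s = - 1" for s by (simp add: rad_def)
  have "(\<integral>z. (if \<lfloor>2^n * fst z\<rfloor> = i \<and> \<lfloor>2^k * snd z\<rfloor> = j then F z else 0) \<partial>?M)
      = (\<integral>z. ?G (2 * i) z + ?G (2 * i + 1) z \<partial>?M)"
  proof (intro Bochner_Integration.integral_cong refl)
    fix z :: "real \<times> real"
    show "(if \<lfloor>2^n * fst z\<rfloor> = i \<and> \<lfloor>2^k * snd z\<rfloor> = j then F z else 0) = ?G (2 * i) z + ?G (2 * i + 1) z"
      unfolding G using r[of "2^n * fst z"] by auto
  qed
  also have "\<dots> = (\<integral>z. ?G (2 * i) z \<partial>?M) + (\<integral>z. ?G (2 * i + 1) z \<partial>?M)"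
    using int by simp
  finally show "avg n k F i j = (avg (Suc n) k F (2 * i) j + avg (Suc n) k F (2 * i + 1) j) / 2"
    by (simp add: avg_def field_simps)
  have "(\<integral>z. (if \<lfloor>2^n * fst z\<rfloor> = i \<and> \<lfloor>2^k * snd z\<rfloor> = j then F z * rad (2^n * fst z) else 0) \<partial>?M)
      = (\<integral>z. ?G (2 * i) z - ?G (2 * i + 1) z \<partial>?M)"
  proof (intro Bochner_Integration.integral_cong refl)
    fix z :: "real \<times> real"
    show "(if \<lfloor>2^n * fst z\<rfloor> = i \<and> \<lfloor>2^k * snd z\<rfloor> = j then F z * rad (2^n * fst z) else 0) = ?G (2 * i) z - ?G (2 * i + 1) z"
      unfolding G using r[of "2^n * fst z"] by auto
  qed
  also have "\<dots> = (\<integral>z. ?G (2 * i) z \<partial>?M) - (\<integral>z. ?G (2 * i + 1) z \<partial>?M)"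
    using int by simp
  finally have eq: "(\<integral>z. (if \<lfloor>2^n * fst z\<rfloor> = i \<and> \<lfloor>2^k * snd z\<rfloor> = j then F z * rad (2^n * fst z) else 0) \<partial>?M)
      = (\<integral>z. ?G (2 * i) z \<partial>?M) - (\<integral>z. ?G (2 * i + 1) z \<partial>?M)" .
  show "avg n k (\<lambda>z. F z * rad (2^n * fst z)) i j
       = (avg (Suc n) k F (2 * i) j - avg (Suc n) k F (2 * i + 1) j) / 2"
    unfolding avg_def eq by (simp add: right_diff_distrib diff_divide_distrib)
qed

lemma sum_lessThan_double:
  "(\<Sum>i<2 * n. g i) = (\<Sum>i<n. g (2 * i) + g (2 * i + 1))" for g :: "nat \<Rightarrow> real"
  by (induction n) auto

text \<open>The parallelogram identity on each pair of halves: what refinement in x adds is exactly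
  the energy of the Haar coefficients.\<close>

lemma energy_split_x:
  assumes "F \<in> borel_measurable borel" "\<And>z. \<bar>F z\<bar> \<le> B"
  shows "energy (Suc n) k F = energy n k F + energy n k (\<lambda>z. F z * rad (2^n * fst z))"
proof -
  let ?A = "\<lambda>i j. avg (Suc n) k F i (int j)"
  have sq: "(((p + q) / 2)\<^sup>2 + ((p - q) / 2)\<^sup>2) = (p\<^sup>2 + q\<^sup>2) / 2" for p q :: real
    by (simp add: power2_eq_square field_simps)
  have "energy n k F + energy n k (\<lambda>z. F z * rad (2^n * fst z))
      = (\<Sum>i<2^n. \<Sum>j<2^k. ((?A (2 * int i) j + ?A (2 * int i + 1) j) / 2)\<^sup>2 + ((?A (2 * int i) j - ?A (2 * int i + 1) j) / 2)\<^sup>2) / (2^n * 2^k)"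
    unfolding energy_def avg_split_x[OF assms, of n k]
    by (simp add: sum.distrib add_divide_distrib)
  also have "\<dots> = (\<Sum>i<2^n. (\<Sum>j<2^k. (?A (2 * int i) j)\<^sup>2) + (\<Sum>j<2^k. (?A (2 * int i + 1) j)\<^sup>2)) / (2^Suc n * 2^k)"
    unfolding sq by (simp add: sum.distrib flip: sum_divide_distrib) 
  also have "\<dots> = energy (Suc n) k F"
    unfolding energy_def power_Suc sum_lessThan_double by (simp add: algebra_simps)
  finally show ?thesis by simp
qed

lemma energy_nonneg: "0 \<le> energy n k F"
  unfolding energy_def by (intro divide_nonneg_pos sum_nonneg) auto

lemma avg_swap:
  assumes [measurable]: "F \<in> borel_measurable borel"
  shows "avg n k (\<lambda>z. F (prod.swap z)) i j = avg k n F j i"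
proof -
  let ?f = "\<lambda>z. if \<lfloor>2^k * fst z\<rfloor> = j \<and> \<lfloor>2^n * snd z\<rfloor> = i then F z else 0"
  have [measurable]: "?f \<in> borel_measurable (unif \<Otimes>\<^sub>M unif)"
    by measurable
  have "(\<integral>z. ?f z \<partial>(unif \<Otimes>\<^sub>M unif)) = (\<integral>(x,y). ?f (y,x) \<partial>(unif \<Otimes>\<^sub>M unif))"
    by (rule unif2.integral_product_swap[symmetric]) measurable
  also have "\<dots> = (\<integral>z. (if \<lfloor>2^n * fst z\<rfloor> = i \<and> \<lfloor>2^k * snd z\<rfloor> = j then F (prod.swap z) else 0) \<partial>(unif \<Otimes>\<^sub>M unif))"
    by (intro Bochner_Integration.integral_cong) auto
  finally show ?thesis by (simp add: avg_def)
qed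

lemma energy_swap:
  assumes "F \<in> borel_measurable borel"
  shows "energy n k (\<lambda>z. F (prod.swap z)) = energy k n F"
  unfolding energy_def avg_swap[OF assms] by (subst sum.swap) (simp add: mult.commute)

lemma measurable_swap_real [measurable]: "prod.swap \<in> borel_measurable (borel :: (real \<times> real) measure)"
  by (intro borel_measurable_continuous_onI continuous_intros)

text \<open>After exchanging coordinates this is a refinement in x, where the extra term is
  nonnegative.\<close>

lemma energy_mono_y:
  assumes [measurable]: "F \<in> borel_measurable borel" and F: "\<And>z. \<bar>F z\<bar> \<le> B"
  shows "energy n k F \<le> energy n (Suc k) F"
  using energy_split_x[of "\<lambda>z. F (prod.swap z)" B k n] energy_nonneg[of k n] assms
    energy_swap[of F n k] energy_swap[of F] by simp

text \<open>Haar differences in x on rectangles twice as wide as high, the shape that carries the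
  bumps of the potential.\<close>

definition haar_energy :: "nat \<Rightarrow> (real \<times> real \<Rightarrow> real) \<Rightarrow> real" where
  "haar_energy n F = energy n (Suc n) (\<lambda>z. F z * rad (2^n * fst z))"

text \<open>Each square is halved first in y, then in x. The y-differences live on whole squares;
  one more refinement in the other direction, which can only raise their energy, gives them the same
  rectangle shape after the coordinates are exchanged.\<close>

lemma energy_Suc_le:
  assumes [measurable]: "F \<in> borel_measurable borel" and F: "\<And>z. \<bar>F z\<bar> \<le> B"
  shows "energy (Suc n) (Suc n) F \<le> energy n n F + haar_energy n F + haar_energy n (\<lambda>z. F (prod.swap z))"
proof -
  let ?S = "\<lambda>z. F (prod.swap z)"
  let ?R = "\<lambda>z. ?S z * rad (2^n * fst z)"
  have B: "0 \<le> B" using F[of undefined] by linarith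
  have R: "\<bar>?R z\<bar> \<le> B" for z using F by (simp add: abs_mult)
  have "energy n (Suc n) F = energy (Suc n) n ?S"
    by (simp add: energy_swap)
  also have "\<dots> = energy n n F + energy n n ?R"
    using energy_split_x[of ?S B n n] F by (simp add: energy_swap)
  also have "energy n n ?R \<le> haar_energy n ?S"
    unfolding haar_energy_def by (rule energy_mono_y[OF _ R]) measurable
  finally show ?thesis
    using energy_split_x[OF assms, of n "Suc n"] by (simp add: haar_energy_def)
qed

lemma energy_le_sum_haar_energy:
  assumes [measurable]: "F \<in> borel_measurable borel" and F: "\<And>z. \<bar>F z\<bar> \<le> B"
  shows "energy N N F \<le> energy 0 0 F + (\<Sum>n<N. haar_energy n F) + (\<Sum>n<N. haar_energy n (\<lambda>z. F (prod.swap z)))"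
proof (induction N)
  case (Suc N)
  then show ?case using energy_Suc_le[OF assms, of N] by simp
qed simp

section \<open>Tents, trapezoids and orthogonality\<close>

text \<open>The distance to the nearest integer.\<close>

definition tent :: "real \<Rightarrow> real" where
  "tent s = min (frac s) (1 - frac s)"

definition trap :: "nat \<Rightarrow> real \<Rightarrow> real" where
  "trap m s = min 1 (2^m * tent s)"

text \<open>The derivative of \<open>trap m\<close>, for \<open>m > 0\<close>, off the multiples of
  \<open>2^-m\<close>. Written through a floor it is constant on each half-open cell of length
  \<open>2^-m\<close>, on which orthogonality in y rests.\<close>

definition dtrap :: "nat \<Rightarrow> real \<Rightarrow> real" where
  "dtrap m s = (if \<lfloor>2^m * s\<rfloor> mod 2^m = 0 then 2^m else if \<lfloor>2^m * s\<rfloor> mod 2^m = 2^m - 1 then - (2^m) else 0)"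

lemma tent_le: "tent s \<le> \<bar>s - of_int i\<bar>"
proof (cases "i \<le> \<lfloor>s\<rfloor>")
  case True
  then have "of_int i \<le> (of_int \<lfloor>s\<rfloor> :: real)" by simp
  then have "frac s \<le> \<bar>s - of_int i\<bar>" unfolding frac_def by linarith
  then show ?thesis unfolding tent_def by linarith
next
  case False
  then have "of_int \<lfloor>s\<rfloor> + 1 \<le> (of_int i :: real)" by linarith
  then have "1 - frac s \<le> \<bar>s - of_int i\<bar>" unfolding frac_def by linarith
  then show ?thesis unfolding tent_def by linarith
qed

lemma tent_attained: obtains i :: int where "tent s = \<bar>s - of_int i\<bar>"
proof (cases "frac s \<le> 1 - frac s")
  case True
  then show ?thesis using that[of "\<lfloor>s\<rfloor>"] frac_ge_0[of s] by (simp add: tent_def frac_def)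
next
  case False
  then show ?thesis using that[of "\<lfloor>s\<rfloor> + 1"] frac_lt_1[of s] by (simp add: tent_def frac_def)
qed

lemma tent_bounds: "0 \<le> tent s" "2 * tent s \<le> 1"
  using frac_ge_0[of s] frac_lt_1[of s] by (auto simp: tent_def min_def)

lemma tent_Lipschitz: "\<bar>tent s - tent t\<bar> \<le> \<bar>s - t\<bar>"
proof -
  have "tent s \<le> tent t + \<bar>s - t\<bar>" for s t
  proof -
    obtain i where "tent t = \<bar>t - of_int i\<bar>" by (rule tent_attained)
    then show ?thesis using tent_le[of s i] by linarith
  qed
  from this[of s t] this[of t s] show ?thesis by linarith
qed

lemma tent_measurable [measurable]: "tent \<in> borel_measurable borel"
  unfolding tent_def frac_def by measurable

lemma tent_periodic: "tent (s - of_int i) = tent s"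
  by (simp add: tent_def frac_def)

lemma trap_bounds: "0 \<le> trap m s" "trap m s \<le> 1"
  using tent_bounds[of s] by (auto simp: trap_def)

lemma trap_Lipschitz: "\<bar>trap m s - trap m t\<bar> \<le> 2^m * \<bar>s - t\<bar>"
proof -
  have "\<bar>trap m s - trap m t\<bar> \<le> \<bar>2^m * tent s - 2^m * tent t\<bar>"
    unfolding trap_def by linarith
  also have "\<dots> = 2^m * \<bar>tent s - tent t\<bar>"
    by (simp add: abs_mult flip: right_diff_distrib)
  finally show ?thesis using tent_Lipschitz[of s t]
    by (smt (verit) mult_left_mono zero_le_power)
qed

lemma trap_measurable [measurable]: "trap m \<in> borel_measurable borel"
  unfolding trap_def by measurable

lemma trap_periodic: "trap m (s - of_int i) = trap m s"
  by (simp add: trap_def tent_periodic)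

lemma dtrap_measurable [measurable]: "dtrap m \<in> borel_measurable borel"
  unfolding dtrap_def by measurable

lemma dtrap_periodic: "dtrap m (s - of_int i) = dtrap m s"
proof -
  have "2^m * (s - of_int i) = 2^m * s - of_int (2^m * i)" by (simp add: algebra_simps)
  moreover have "(\<lfloor>2^m * s\<rfloor> - 2^m * i) mod 2^m = \<lfloor>2^m * s\<rfloor> mod 2^m"
    by (metis mod_mult_self4 diff_add_cancel add.commute)
  ultimately show ?thesis unfolding dtrap_def by (simp only: floor_diff_of_int)
qed

lemma abs_dtrap: "\<bar>dtrap m s\<bar> \<le> 2^m"
  by (simp add: dtrap_def)

text \<open>As \<open>m > 0\<close>, the first and the last cell are distinct, so each value is
  counted once. For \<open>dtrap\<close> the two slopes then cancel.\<close>

lemma two_strips_sum: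
  fixes u v :: real
  assumes "m > 0"
  shows "(\<Sum>i<(2::nat)^m. if int i mod 2^m = 0 then u else if int i mod 2^m = 2^m - 1 then v else 0) = u + v"
proof -
  obtain n where n: "m = Suc n" using assms gr0_conv_Suc by auto
  define M where "M = (2::nat)^m - 2"
  have M: "(2::nat)^m = Suc (Suc M)"
  proof -
    have "(2::nat) \<le> 2^m" by (simp add: n)
    then show ?thesis unfolding M_def by linarith
  qed
  have "(2::int)^m = int (2^m)" by simp
  also have "\<dots> = int M + 2" unfolding M by simp
  finally have M': "(2::int)^m = int M + 2" .
  have "(\<Sum>i<Suc (Suc M). if int i mod (int M + 2) = 0 then u else if int i mod (int M + 2) = (int M + 2) - 1 then v else 0)
    = (\<Sum>i<Suc (Suc M). if i = 0 then u else if i = Suc M then v else 0)"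
    by (intro sum.cong refl) (auto simp: mod_pos_pos_trivial)
  also have "\<dots> = (\<Sum>i<Suc M. if i = 0 then u else if i = Suc M then v else 0) + v"
    by (subst sum.lessThan_Suc) simp
  also have "(\<Sum>i<Suc M. if i = 0 then u else if i = Suc M then v else 0) = (\<Sum>i<Suc M. if i = 0 then u else 0)"
    by (intro sum.cong) auto
  also have "\<dots> = u"
    by (subst sum.delta) auto
  finally show ?thesis by (simp only: M M')
qed

lemma integral_dtrap:
  assumes "m > 0"
  shows "(\<integral>s. dtrap m s \<partial>unif) = 0"
proof -
  let ?C = "\<lambda>k::int. if k mod 2^m = 0 then 2^m else if k mod 2^m = 2^m - 1 then - (2^m) else 0 :: real"
  have "(\<integral>s. ?C \<lfloor>real (2^m) * s\<rfloor> \<partial>unif) = (\<Sum>i<2^m. ?C (int i)) / real (2^m)"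
    by (rule integral_unif_floor) simp
  then show ?thesis
    unfolding two_strips_sum[OF assms] of_nat_power of_nat_numeral by (simp add: dtrap_def)
qed

lemma trap_eq_1:
  assumes "\<lfloor>2^m * s\<rfloor> mod 2^m \<noteq> 0" "\<lfloor>2^m * s\<rfloor> mod 2^m \<noteq> 2^m - 1"
  shows "trap m s = 1"
proof -
  define t where "t = frac s"
  have t: "0 \<le> t" "t < 1" using frac_ge_0 frac_lt_1 by (auto simp: t_def)
  have s: "2^m * s = 2^m * t + of_int (2^m * \<lfloor>s\<rfloor>)" by (simp add: t_def frac_def algebra_simps)
  have "\<lfloor>2^m * s\<rfloor> = \<lfloor>2^m * t\<rfloor> + 2^m * \<lfloor>s\<rfloor>"
    unfolding s by (rule floor_add_int[symmetric])
  moreover have "0 \<le> \<lfloor>2^m * t\<rfloor>" "\<lfloor>2^m * t\<rfloor> < 2^m"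
    using t by (auto simp: floor_less_iff)
  ultimately have "\<lfloor>2^m * s\<rfloor> mod 2^m = \<lfloor>2^m * t\<rfloor>" by simp
  with assms \<open>0 \<le> \<lfloor>2^m * t\<rfloor>\<close> \<open>\<lfloor>2^m * t\<rfloor> < 2^m\<close>
  have "1 \<le> \<lfloor>2^m * t\<rfloor>" "\<lfloor>2^m * t\<rfloor> \<le> 2^m - 2" by linarith+
  then have a: "1 \<le> 2^m * t" "2^m * t < 2^m - 1"
    by (simp add: le_floor_iff, simp add: floor_le_iff)
  then have "1 \<le> 2^m * tent s"
    by (simp add: tent_def min_def algebra_simps flip: t_def)
  then show ?thesis by (simp add: trap_def)
qed

text \<open>The defect is at most 1 and vanishes off the first and the last of the
  \<open>2^m\<close> subintervals.\<close>

lemma integral_trap_defect: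
  assumes "m > 0"
  shows "(\<integral>s. (1 - trap m s)\<^sup>2 \<partial>unif) \<le> 2 / 2^m"
proof -
  let ?C = "\<lambda>k::int. if k mod 2^m = 0 then 1 else if k mod 2^m = 2^m - 1 then 1 else 0 :: real"
  have b: "(1 - trap m s)\<^sup>2 \<le> 1" for s
    using trap_bounds[of m s] by (simp add: power_le_one)
  have "(\<integral>s. (1 - trap m s)\<^sup>2 \<partial>unif) \<le> (\<integral>s. ?C \<lfloor>real (2^m) * s\<rfloor> \<partial>unif)"
  proof (rule integral_mono)
    show "integrable unif (\<lambda>s. (1 - trap m s)\<^sup>2)"
      using b by (intro unif.integrable_const_bound[where B=1]) auto
    show "integrable unif (\<lambda>s. ?C \<lfloor>real (2^m) * s\<rfloor>)"
      by (intro unif.integrable_const_bound[where B=1]) auto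
    show "(1 - trap m s)\<^sup>2 \<le> ?C \<lfloor>real (2^m) * s\<rfloor>" for s
      using trap_eq_1[of m s] b[of s] by auto
  qed
  also have "\<dots> = 2 / 2^m"
    by (subst integral_unif_floor) (use two_strips_sum[OF assms, of 1 1] in simp_all)
  finally show ?thesis .
qed

text \<open>Dyadic intervals are nested: the coarse index is the fine one divided by a power of 2
  and rounded down.\<close>

lemma floor_pow2_cong:
  fixes x x' :: real
  assumes "\<lfloor>2^N * x\<rfloor> = \<lfloor>2^N * x'\<rfloor>" "n \<le> N"
  shows "\<lfloor>2^n * x\<rfloor> = \<lfloor>2^n * x'\<rfloor>"
proof -
  have "\<lfloor>2^n * x\<rfloor> = \<lfloor>2^N * x\<rfloor> div 2^(N - n)" for x :: real
  proof -
    obtain d where "N = n + d" using assms(2) le_Suc_ex by blast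
    then have "2^n * x = 2^N * x / real_of_int (2^(N - n))"
      by (simp add: power_add)
    then show ?thesis using floor_divide_real_eq_div[of "2^(N - n)" "2^N * x"] by simp
  qed
  then show ?thesis using assms(1) by simp
qed

lemma rad_pow2_cong:
  assumes "\<lfloor>2^N * x\<rfloor> = \<lfloor>2^N * x'\<rfloor>" "n < N"
  shows "rad (2^n * x) = rad (2^n * x')"
  using floor_pow2_cong[OF assms(1), of "Suc n"] assms(2) by (simp add: rad_def mult.assoc)

lemma dtrap_pow2_cong:
  assumes "\<lfloor>2^N * y\<rfloor> = \<lfloor>2^N * y'\<rfloor>" "n + m \<le> N"
  shows "dtrap m (2^n * y) = dtrap m (2^n * y')"
  using floor_pow2_cong[OF assms] by (simp add: dtrap_def power_add ac_simps)

text \<open>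
  Level \<open>k\<close> uses rectangles of width \<open>2\<^sup>-\<^sup>k\<close> and height \<open>2\<^sup>-\<^sup>k\<^sup>-\<^sup>1\<close>: splitting them vertically in half
  produces the squares of level \<open>k + 1\<close>. The sums \<open>haar_sum (trap m)\<close> and \<open>grad_y m\<close> are the partial
  derivatives of the potential \<open>pot m\<close> defined below.
\<close>

definition coef :: "(nat \<Rightarrow> int \<Rightarrow> int \<Rightarrow> real) \<Rightarrow> nat \<Rightarrow> real \<times> real \<Rightarrow> real" where
  "coef a k z = a k \<lfloor>2^k * fst z\<rfloor> \<lfloor>2^Suc k * snd z\<rfloor>"

definition haar_sum :: "(real \<Rightarrow> real) \<Rightarrow> (nat \<Rightarrow> int \<Rightarrow> int \<Rightarrow> real) \<Rightarrow> nat \<Rightarrow> real \<times> real \<Rightarrow> real" where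
  "haar_sum q a n z = (\<Sum>k<n. coef a k z * (rad (2^k * fst z) * q (2^Suc k * snd z)))"

definition grad_y :: "nat \<Rightarrow> (nat \<Rightarrow> int \<Rightarrow> int \<Rightarrow> real) \<Rightarrow> nat \<Rightarrow> real \<times> real \<Rightarrow> real" where
  "grad_y m a n z = (\<Sum>k<n. coef a k z * (2 * tent (2^k * fst z) * dtrap m (2^Suc k * snd z)))"

text \<open>\<open>dtrap m (2^Suc k * y)\<close> is constant on dyadic intervals of length
  \<open>2^-(k+1+m)\<close>; a gap of \<open>m\<close> makes the rectangles of every later active
  level fit into such intervals. Levels are compared globally, not only where rectangles
  overlap.\<close>

definition sparse :: "nat \<Rightarrow> (nat \<Rightarrow> int \<Rightarrow> int \<Rightarrow> real) \<Rightarrow> bool" where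
  "sparse m a \<longleftrightarrow> (\<forall>k l i j i' j'. k < l \<longrightarrow> a k i j \<noteq> 0 \<longrightarrow> a l i' j' \<noteq> 0 \<longrightarrow> k + m \<le> l)"

lemma haar_sum_Suc:
  "haar_sum q a (Suc n) z = haar_sum q a n z + coef a n z * (rad (2^n * fst z) * q (2^Suc n * snd z))"
  by (simp add: haar_sum_def)

lemma grad_y_Suc:
  "grad_y m a (Suc n) z = grad_y m a n z + coef a n z * (2 * tent (2^n * fst z) * dtrap m (2^Suc n * snd z))"
  by (simp add: grad_y_def)

lemma integral_sum_sq:
  fixes g t :: "'a \<Rightarrow> real"
  assumes "integrable M (\<lambda>z. (g z)\<^sup>2)" "integrable M (\<lambda>z. g z * t z)" "integrable M (\<lambda>z. (t z)\<^sup>2)"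
  shows "(\<integral>z. (g z + t z)\<^sup>2 \<partial>M) = (\<integral>z. (g z)\<^sup>2 \<partial>M) + 2 * (\<integral>z. g z * t z \<partial>M) + (\<integral>z. (t z)\<^sup>2 \<partial>M)"
proof -
  have "(g z + t z)\<^sup>2 = ((g z)\<^sup>2 + 2 * (g z * t z)) + (t z)\<^sup>2" for z
    by (simp add: power2_sum)
  then show ?thesis using assms by simp
qed

lemma measurable_coef [measurable]: "coef a k \<in> borel_measurable borel"
  unfolding coef_def by measurable

lemma measurable_haar_sum [measurable]:
  assumes [measurable]: "q \<in> borel_measurable borel"
  shows "haar_sum q a n \<in> borel_measurable borel"
  unfolding haar_sum_def by measurable

lemma measurable_grad_y [measurable]: "grad_y m a n \<in> borel_measurable borel"
  unfolding grad_y_def by measurable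

lemma coef_cong:
  assumes "\<lfloor>2^N * fst z\<rfloor> = \<lfloor>2^N * fst z'\<rfloor>" "\<lfloor>2^Suc N * snd z\<rfloor> = \<lfloor>2^Suc N * snd z'\<rfloor>" "k \<le> N"
  shows "coef a k z = coef a k z'"
  unfolding coef_def using floor_pow2_cong[OF assms(1,3)] floor_pow2_cong[OF assms(2), of "Suc k"] assms(3)
  by simp

lemma abs_mult_le_mult: "\<bar>a\<bar> \<le> p \<Longrightarrow> \<bar>b\<bar> \<le> q \<Longrightarrow> \<bar>a * b\<bar> \<le> p * q" for a b p q :: real
  by (simp add: abs_mult mult_mono')

text \<open>A crude bound growing with \<open>n\<close>; it serves integrability only. The uniform
  bound comes from the stopping.\<close>

lemma abs_haar_sum_le:
  assumes "\<And>k i j. \<bar>a k i j\<bar> \<le> 1" "\<And>s. \<bar>q s\<bar> \<le> 1"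
  shows "\<bar>haar_sum q a n z\<bar> \<le> real n"
proof -
  have "\<bar>coef a k z * (rad (2^k * fst z) * q (2^Suc k * snd z))\<bar> \<le> 1 * (1 * 1)" for k
    using assms by (intro abs_mult_le_mult) (auto simp: coef_def)
  then show ?thesis
    unfolding haar_sum_def using sum_abs_ge_zero sum_bounded_above[of "{..<n}" _ "1::real"]
    by (intro order_trans[OF sum_abs]) auto
qed

lemma abs_grad_y_le:
  assumes "\<And>k i j. \<bar>a k i j\<bar> \<le> 1"
  shows "\<bar>grad_y m a n z\<bar> \<le> real n * 2^m"
proof -
  have "\<bar>coef a k z * (2 * tent (2^k * fst z) * dtrap m (2^Suc k * snd z))\<bar> \<le> 1 * (1 * 2^m)" for k
    using assms tent_bounds by (intro abs_mult_le_mult) (auto simp: coef_def abs_dtrap)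
  then show ?thesis
    unfolding grad_y_def using sum_bounded_above[of "{..<n}" _ "2^m::real"]
    by (intro order_trans[OF sum_abs]) auto
qed

text \<open>On every cell \<open>q\<close> averages to its mean whatever the value of
  \<open>c\<close>, so the factors are independent.\<close>

lemma integral_step_mult:
  fixes c :: "int \<Rightarrow> int \<Rightarrow> real"
  assumes c: "\<And>i j. \<bar>c i j\<bar> \<le> B" and [measurable]: "q \<in> borel_measurable borel"
    and q: "\<And>s. \<bar>q s\<bar> \<le> K" "\<And>s i. q (s - of_int i) = q s"
  shows "(\<integral>z. c \<lfloor>2^n * fst z\<rfloor> \<lfloor>2^k * snd z\<rfloor> * q (2^k * snd z) \<partial>(unif \<Otimes>\<^sub>M unif))
    = (\<integral>z. c \<lfloor>2^n * fst z\<rfloor> \<lfloor>2^k * snd z\<rfloor> \<partial>(unif \<Otimes>\<^sub>M unif)) * (\<integral>s. q s \<partial>unif)"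
proof -
  have "(\<integral>z. c \<lfloor>2^n * fst z\<rfloor> \<lfloor>2^k * snd z\<rfloor> * q (2^k * snd z) \<partial>(unif \<Otimes>\<^sub>M unif))
    = (\<integral>x. \<integral>y. c \<lfloor>2^n * x\<rfloor> \<lfloor>2^k * y\<rfloor> * q (2^k * y) \<partial>unif \<partial>unif)"
    using abs_mult_le_mult[OF c q(1)]
    by (subst integral_unif2_fst) (auto intro!: integrable_unif2[where K="B * K"])
  also have "\<dots> = (\<integral>x. (\<integral>y. c \<lfloor>2^n * x\<rfloor> \<lfloor>2^k * y\<rfloor> \<partial>unif) * (\<integral>s. q s \<partial>unif) \<partial>unif)"
    using integral_unif_cells[of "2^k" q K "c _"] integral_unif_floor[of "2^k" "c _"] q by simp
  also have "\<dots> = (\<integral>x. (\<integral>y. c \<lfloor>2^n * x\<rfloor> \<lfloor>2^k * y\<rfloor> \<partial>unif) \<partial>unif) * (\<integral>s. q s \<partial>unif)"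
    by simp
  also have "(\<integral>x. (\<integral>y. c \<lfloor>2^n * x\<rfloor> \<lfloor>2^k * y\<rfloor> \<partial>unif) \<partial>unif)
     = (\<integral>z. c \<lfloor>2^n * fst z\<rfloor> \<lfloor>2^k * snd z\<rfloor> \<partial>(unif \<Otimes>\<^sub>M unif))"
    using c by (subst integral_unif2_fst) (auto intro!: integrable_unif2[where K=B])
  finally show ?thesis .
qed

text \<open>Integrate in x first. The earlier terms and the coefficient of level \<open>N\<close>
  are constant on x-intervals of length \<open>2^-N\<close>, over which \<open>rad (2^N * x)\<close>
  has mean zero, so cross terms vanish. As \<open>rad\<close> squares to 1, the square of a term
  leaves only the mean of \<open>(q s)\<^sup>2\<close>.\<close>

lemma integral_haar_sum_sq:
  assumes a: "\<And>k i j. \<bar>a k i j\<bar> \<le> 1" and [measurable]: "q \<in> borel_measurable borel"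
    and q: "\<And>s. \<bar>q s\<bar> \<le> 1" "\<And>s i. q (s - of_int i) = q s"
  shows "(\<integral>z. (haar_sum q a N z)\<^sup>2 \<partial>(unif \<Otimes>\<^sub>M unif))
    = (\<Sum>k<N. \<integral>z. (coef a k z)\<^sup>2 \<partial>(unif \<Otimes>\<^sub>M unif)) * (\<integral>s. (q s)\<^sup>2 \<partial>unif)"
proof (induction N)
  case (Suc N)
  let ?M = "unif \<Otimes>\<^sub>M unif"
  let ?t = "\<lambda>z. coef a N z * (rad (2^N * fst z) * q (2^Suc N * snd z))"
  have t: "\<bar>?t z\<bar> \<le> 1 * (1 * 1)" for z
    using a q by (intro abs_mult_le_mult) (auto simp: coef_def)
  have h: "\<bar>haar_sum q a N z\<bar> \<le> real N" for z
    by (rule abs_haar_sum_le) (use a q in auto)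
  have ht: "\<bar>haar_sum q a N z * ?t z\<bar> \<le> real N * 1" for z
    using h t by (intro abs_mult_le_mult) auto
  have int1: "integrable ?M (\<lambda>z. (haar_sum q a N z)\<^sup>2)"
    by (intro integrable_unif2[where K="real N * real N"])
      (measurable, simp only: power2_eq_square abs_mult_le_mult[OF h h])
  have int2: "integrable ?M (\<lambda>z. haar_sum q a N z * ?t z)"
    using ht by (intro integrable_unif2[where K="real N * 1"]) measurable
  have int3: "integrable ?M (\<lambda>z. (?t z)\<^sup>2)"
    by (intro integrable_unif2[where K="1 * (1 * 1) * (1 * (1 * 1))"])
      (measurable, simp only: power2_eq_square abs_mult_le_mult[OF t t])
  have inner: "(\<integral>x. haar_sum q a N (x, y) * ?t (x, y) \<partial>unif) = 0" for y
  proof -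
    let ?c = "\<lambda>x. haar_sum q a N (x, y) * coef a N (x, y) * q (2^Suc N * y)"
    have c: "?c x = ?c x'" if "\<lfloor>real (2^N) * x\<rfloor> = \<lfloor>real (2^N) * x'\<rfloor>" for x x'
    proof -
      have e: "\<lfloor>2^N * x\<rfloor> = \<lfloor>2^N * x'\<rfloor>" using that by simp
      have "coef a k (x, y) = coef a k (x', y)" if "k \<le> N" for k
        using coef_cong[of N "(x,y)" "(x',y)" k a] e that by simp
      then show ?thesis
        unfolding haar_sum_def using rad_pow2_cong[OF e] by simp
    qed
    have "(\<integral>x. ?c x * rad (real (2^N) * x) \<partial>unif) = 0"
      by (rule integral_unif_orthogonal[where K=1])
        (use c in \<open>auto simp: rad_periodic integral_rad\<close>)
    then show ?thesis by (simp add: ac_simps)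
  qed
  have ortho: "(\<integral>z. haar_sum q a N z * ?t z \<partial>?M) = 0"
    unfolding integral_unif2_snd[OF int2] inner by simp
  have "(\<integral>z. (?t z)\<^sup>2 \<partial>?M) = (\<integral>z. (coef a N z)\<^sup>2 * (q (2^Suc N * snd z))\<^sup>2 \<partial>?M)"
    by (simp add: power_mult_distrib)
  also have "\<dots> = (\<integral>z. (coef a N z)\<^sup>2 \<partial>?M) * (\<integral>s. (q s)\<^sup>2 \<partial>unif)"
    unfolding coef_def
    using integral_step_mult[of "\<lambda>i j. (a N i j)\<^sup>2" 1 "\<lambda>s. (q s)\<^sup>2" 1 N "Suc N"] a q
    by (simp add: abs_square_le_1)
  finally have sq: "(\<integral>z. (?t z)\<^sup>2 \<partial>?M) = (\<integral>z. (coef a N z)\<^sup>2 \<partial>?M) * (\<integral>s. (q s)\<^sup>2 \<partial>unif)" .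
  have "(\<integral>z. (haar_sum q a (Suc N) z)\<^sup>2 \<partial>?M)
      = (\<integral>z. (haar_sum q a N z)\<^sup>2 \<partial>?M) + 2 * (\<integral>z. haar_sum q a N z * ?t z \<partial>?M) + (\<integral>z. (?t z)\<^sup>2 \<partial>?M)"
    unfolding haar_sum_Suc by (rule integral_sum_sq[OF int1 int2 int3])
  then show ?case using Suc ortho sq by (simp add: algebra_simps)
qed (simp add: haar_sum_def)

text \<open>Here the integration in y comes first, with \<open>dtrap\<close> as the oscillating
  factor; the gap in \<open>sparse\<close> makes the earlier terms constant on its cells. The factor
  \<open>4^m\<close> is the squared slope, and \<open>2 * tent\<close> is at most 1.\<close>

lemma integral_grad_y_sq:
  assumes a: "\<And>k i j. \<bar>a k i j\<bar> \<le> 1" and m: "m > 0" and sp: "sparse m a"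
  shows "(\<integral>z. (grad_y m a N z)\<^sup>2 \<partial>(unif \<Otimes>\<^sub>M unif))
    \<le> (\<Sum>k<N. \<integral>z. (coef a k z)\<^sup>2 \<partial>(unif \<Otimes>\<^sub>M unif)) * 4^m"
proof (induction N)
  case (Suc N)
  let ?M = "unif \<Otimes>\<^sub>M unif"
  let ?t = "\<lambda>z. coef a N z * (2 * tent (2^N * fst z) * dtrap m (2^Suc N * snd z))"
  have d: "\<bar>2 * tent x * dtrap m y\<bar> \<le> 1 * 2^m" for x y
    using tent_bounds abs_dtrap by (intro abs_mult_le_mult) auto
  have t: "\<bar>?t z\<bar> \<le> 1 * (1 * 2^m)" for z
    by (rule abs_mult_le_mult) (use a d in \<open>auto simp: coef_def\<close>)
  have h: "\<bar>grad_y m a N z\<bar> \<le> real N * 2^m" for z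
    by (rule abs_grad_y_le) (use a in auto)
  have ht: "\<bar>grad_y m a N z * ?t z\<bar> \<le> real N * 2^m * (1 * (1 * 2^m))" for z
    by (rule abs_mult_le_mult[OF h t])
  have int1: "integrable ?M (\<lambda>z. (grad_y m a N z)\<^sup>2)"
    by (intro integrable_unif2[where K="real N * 2^m * (real N * 2^m)"])
      (measurable, simp only: power2_eq_square abs_mult_le_mult[OF h h])
  have int2: "integrable ?M (\<lambda>z. grad_y m a N z * ?t z)"
    using ht by (intro integrable_unif2[where K="real N * 2^m * (1 * (1 * 2^m))"]) measurable
  have int3: "integrable ?M (\<lambda>z. (?t z)\<^sup>2)"
    by (intro integrable_unif2[where K="1 * (1 * 2^m) * (1 * (1 * 2^m))"])
      (measurable, simp only: power2_eq_square abs_mult_le_mult[OF t t])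
  have int4: "integrable ?M (\<lambda>z. (coef a N z)\<^sup>2)"
    by (intro integrable_unif2[where K="1"]) (use a in \<open>auto simp: coef_def abs_square_le_1\<close>)
  have inner: "(\<integral>y. grad_y m a N (x, y) * ?t (x, y) \<partial>unif) = 0" for x
  proof -
    let ?c = "\<lambda>y. grad_y m a N (x, y) * coef a N (x, y) * (2 * tent (2^N * x))"
    have c: "?c y = ?c y'" if "\<lfloor>real (2^Suc N) * y\<rfloor> = \<lfloor>real (2^Suc N) * y'\<rfloor>" for y y'
    \<comment> \<open>\<open>sparse\<close> constrains earlier levels only where level
      \<open>N\<close> is active; where its coefficient vanishes, both sides are zero.\<close>
    proof (cases "coef a N (x, y) = 0")
      case True
      then show ?thesis using coef_cong[of N "(x,y)" "(x,y')" N a] that by simp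
    next
      case False
      have e: "\<lfloor>2^Suc N * y\<rfloor> = \<lfloor>2^Suc N * y'\<rfloor>" using that by simp
      have cc: "coef a k (x, y) = coef a k (x, y')" if "k \<le> N" for k
        using coef_cong[of N "(x,y)" "(x,y')" k a] e that by simp
      have "coef a k (x, y) * dtrap m (2^Suc k * y) = coef a k (x, y') * dtrap m (2^Suc k * y')" if "k < N" for k
      proof (cases "coef a k (x, y) = 0")
        case True
        then show ?thesis using cc that by simp
      next
        case nz: False
        then have "k + m \<le> N"
          using sp False that unfolding sparse_def coef_def by blast
        then show ?thesis using cc that dtrap_pow2_cong[OF e, of "Suc k" m] by simp
      qed
      then have "coef a k (x, y) * (2 * tent (2^k * x) * dtrap m (2^Suc k * y))
         = coef a k (x, y') * (2 * tent (2^k * x) * dtrap m (2^Suc k * y'))" if "k < N" for k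
        using that by (simp add: mult.left_commute[of "coef a k _"])
      then have "grad_y m a N (x, y) = grad_y m a N (x, y')"
        unfolding grad_y_def by (intro sum.cong) auto
      then show ?thesis using cc[of N] by simp
    qed
    have "(\<integral>y. ?c y * dtrap m (real (2^Suc N) * y) \<partial>unif) = 0"
      by (rule integral_unif_orthogonal[where K="2^m"])
        (use c m in \<open>auto simp: dtrap_periodic integral_dtrap abs_dtrap\<close>)
    then show ?thesis by (simp add: ac_simps)
  qed
  have ortho: "(\<integral>z. grad_y m a N z * ?t z \<partial>?M) = 0"
    unfolding integral_unif2_fst[OF int2] inner by simp
  have "(\<integral>z. (?t z)\<^sup>2 \<partial>?M) \<le> (\<integral>z. (coef a N z)\<^sup>2 * 4^m \<partial>?M)"
  proof (rule integral_mono[OF int3])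
    show "integrable ?M (\<lambda>z. (coef a N z)\<^sup>2 * 4^m)" using int4 by simp
    fix z
    have "(2 * tent (2^N * fst z) * dtrap m (2^Suc N * snd z))\<^sup>2 \<le> (2^m)\<^sup>2"
      using d[of "2^N * fst z" "2^Suc N * snd z"] by (simp add: abs_le_square_iff[symmetric])
    also have "(2^m)\<^sup>2 = (4^m :: real)" by (simp add: power2_eq_square flip: power_mult_distrib)
    finally show "(?t z)\<^sup>2 \<le> (coef a N z)\<^sup>2 * 4^m"
      unfolding power_mult_distrib[of "coef a N z"] by (rule mult_left_mono) simp
  qed
  then have sq: "(\<integral>z. (?t z)\<^sup>2 \<partial>?M) \<le> (\<integral>z. (coef a N z)\<^sup>2 \<partial>?M) * 4^m" by simp
  have "(\<integral>z. (grad_y m a (Suc N) z)\<^sup>2 \<partial>?M)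
      = (\<integral>z. (grad_y m a N z)\<^sup>2 \<partial>?M) + 2 * (\<integral>z. grad_y m a N z * ?t z \<partial>?M) + (\<integral>z. (?t z)\<^sup>2 \<partial>?M)"
    unfolding grad_y_Suc by (rule integral_sum_sq[OF int1 int2 int3])
  then show ?case using Suc ortho sq by (simp add: algebra_simps)
qed (simp add: grad_y_def)

section \<open>Stopped coefficients\<close>

lemma abs_diff_of_floor_eq:
  fixes x x' :: real
  assumes "\<lfloor>2^N * x\<rfloor> = \<lfloor>2^N * x'\<rfloor>"
  shows "\<bar>x - x'\<bar> \<le> 1 / 2^N"
proof -
  have "\<bar>2^N * x - 2^N * x'\<bar> < 1" using assms by linarith
  then have "2^N * \<bar>x - x'\<bar> < 1" by (simp add: abs_mult flip: right_diff_distrib)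
  then show ?thesis by (simp add: field_simps)
qed

lemma sum_pow2_div: "(\<Sum>k<N. 2^k / 2^N :: real) \<le> 1"
proof -
  have "(\<Sum>k<N. 2^k :: real) = 2^N - 1" by (induction N) auto
  then have "(\<Sum>k<N. 2^k / 2^N :: real) = (2^N - 1) / 2^N" by (simp flip: sum_divide_distrib)
  also have "\<dots> \<le> 1" by simp
  finally show ?thesis .
qed

text \<open>Within a rectangle of level \<open>N\<close> the coefficients and signs of earlier
  levels do not change, and only the trapezoids vary. Level \<open>k\<close> contributes at most
  \<open>2^m * (2^k / 2^N)\<close>, a geometric sum bounded independently of
  \<open>N\<close>.\<close>

lemma haar_sum_oscillation:
  assumes a: "\<And>k i j. \<bar>a k i j\<bar> \<le> 1"
    and x: "\<lfloor>2^N * fst z\<rfloor> = \<lfloor>2^N * fst z'\<rfloor>" and y: "\<lfloor>2^Suc N * snd z\<rfloor> = \<lfloor>2^Suc N * snd z'\<rfloor>"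
  shows "\<bar>haar_sum (trap m) a N z - haar_sum (trap m) a N z'\<bar> \<le> 2^m"
proof -
  let ?t = "\<lambda>k z. coef a k z * (rad (2^k * fst z) * trap m (2^Suc k * snd z))"
  have "\<bar>?t k z - ?t k z'\<bar> \<le> 2^m * (2^k / 2^N)" if "k < N" for k
  proof -
    have c: "coef a k z' = coef a k z" "rad (2^k * fst z') = rad (2^k * fst z)"
      using coef_cong[OF x y, of k a] rad_pow2_cong[OF x] that by auto
    have "?t k z - ?t k z' = coef a k z * (rad (2^k * fst z) * (trap m (2^Suc k * snd z) - trap m (2^Suc k * snd z')))"
      unfolding c by (simp add: algebra_simps)
    also have "\<bar>\<dots>\<bar> \<le> 1 * (1 * (2^m * \<bar>2^Suc k * snd z - 2^Suc k * snd z'\<bar>))"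
      using a by (intro abs_mult_le_mult trap_Lipschitz) (auto simp: coef_def)
    also have "\<bar>2^Suc k * snd z - 2^Suc k * snd z'\<bar> = 2^Suc k * \<bar>snd z - snd z'\<bar>"
      by (simp add: abs_mult flip: right_diff_distrib)
    also have "1 * (1 * (2^m * (2^Suc k * \<bar>snd z - snd z'\<bar>))) \<le> 1 * (1 * (2^m * (2^Suc k * (1 / 2^Suc N))))"
      using abs_diff_of_floor_eq[OF y] by (intro mult_left_mono) auto
    finally show ?thesis by simp
  qed
  then have "(\<Sum>k<N. \<bar>?t k z - ?t k z'\<bar>) \<le> (\<Sum>k<N. 2^m * (2^k / 2^N))"
    by (intro sum_mono) auto
  also have "\<dots> \<le> 2^m"
    unfolding sum_distrib_left[symmetric] using sum_pow2_div[of N] by (simp add: mult_left_le)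
  finally show ?thesis
    unfolding haar_sum_def sum_subtractf[symmetric] by (rule order_trans[OF sum_abs])
qed

text \<open>The roles are exchanged: the gap freezes \<open>dtrap\<close>, and only the tents
  vary.\<close>

lemma grad_y_oscillation:
  assumes a: "\<And>k i j. \<bar>a k i j\<bar> \<le> 1"
    and sp: "\<And>k. k < N \<Longrightarrow> coef a k z \<noteq> 0 \<Longrightarrow> k + m \<le> N"
    and x: "\<lfloor>2^N * fst z\<rfloor> = \<lfloor>2^N * fst z'\<rfloor>" and y: "\<lfloor>2^Suc N * snd z\<rfloor> = \<lfloor>2^Suc N * snd z'\<rfloor>"
  shows "\<bar>grad_y m a N z - grad_y m a N z'\<bar> \<le> 2 * 2^m"
proof -
  let ?t = "\<lambda>k z. coef a k z * (2 * tent (2^k * fst z) * dtrap m (2^Suc k * snd z))"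
  have "\<bar>?t k z - ?t k z'\<bar> \<le> 2 * 2^m * (2^k / 2^N)" if "k < N" for k
  proof (cases "coef a k z = 0")
    case True
    then show ?thesis using coef_cong[OF x y, of k a] that by simp
  next
    case False
    have c: "coef a k z' = coef a k z" "dtrap m (2^Suc k * snd z') = dtrap m (2^Suc k * snd z)"
      using coef_cong[OF x y, of k a] dtrap_pow2_cong[OF y, of "Suc k" m] that sp[OF that False] by auto
    have "?t k z - ?t k z' = coef a k z * (2 * ((tent (2^k * fst z) - tent (2^k * fst z')) * dtrap m (2^Suc k * snd z)))"
      unfolding c by (simp add: algebra_simps)
    also have "\<bar>\<dots>\<bar> \<le> 1 * (2 * (\<bar>2^k * fst z - 2^k * fst z'\<bar> * 2^m))"
      using a by (intro abs_mult_le_mult tent_Lipschitz abs_dtrap) (auto simp: coef_def)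
    also have "\<bar>2^k * fst z - 2^k * fst z'\<bar> = 2^k * \<bar>fst z - fst z'\<bar>"
      by (simp add: abs_mult flip: right_diff_distrib)
    also have "1 * (2 * (2^k * \<bar>fst z - fst z'\<bar> * 2^m)) \<le> 1 * (2 * (2^k * (1 / 2^N) * 2^m))"
      using abs_diff_of_floor_eq[OF x] by (intro mult_left_mono mult_right_mono) auto
    finally show ?thesis by (simp add: ac_simps)
  qed
  then have "(\<Sum>k<N. \<bar>?t k z - ?t k z'\<bar>) \<le> (\<Sum>k<N. 2 * 2^m * (2^k / 2^N))"
    by (intro sum_mono) auto
  also have "\<dots> \<le> 2 * 2^m"
    unfolding sum_distrib_left[symmetric] using sum_pow2_div[of N] by (simp add: mult_left_le)
  finally show ?thesis
    unfolding grad_y_def sum_subtractf[symmetric] by (rule order_trans[OF sum_abs])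
qed

lemma haar_sum_upd: "haar_sum q (a(n := c)) n z = haar_sum q a n z"
  by (auto simp: haar_sum_def coef_def intro: sum.cong)

lemma grad_y_upd: "grad_y m (a(n := c)) n z = grad_y m a n z"
  by (auto simp: grad_y_def coef_def intro: sum.cong)

text \<open>
  A coefficient is kept iff its rectangle contains a point where the gradient built so far is at most
  \<open>lam\<close>. On a dropped rectangle the gradient exceeds \<open>lam\<close> everywhere, so all rectangles inside are
  dropped as well and the gradient never changes there again.
\<close>

lemma exists_stopped_coefficients:
  fixes b :: "nat \<Rightarrow> int \<Rightarrow> int \<Rightarrow> real"
  assumes b: "\<And>k i j. \<bar>b k i j\<bar> \<le> 1" and sp: "sparse m b" and lam: "0 \<le> lam"
  shows "\<exists>a. (\<forall>k i j. a k i j = b k i j \<or> a k i j = 0) \<and>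
    (\<forall>z. \<bar>haar_sum (trap m) a N z\<bar> \<le> lam + 2^m + 1 \<and> \<bar>grad_y m a N z\<bar> \<le> lam + 3 * 2^m) \<and>
    (\<forall>k<N. \<forall>z. coef a k z \<noteq> coef b k z \<longrightarrow> lam < \<bar>haar_sum (trap m) a N z\<bar> \<or> lam < \<bar>grad_y m a N z\<bar>)"
proof (induction N)
  case 0
  show ?case
    by (rule exI[of _ b]) (use lam in \<open>auto simp: haar_sum_def grad_y_def\<close>)
next
  case (Suc N)
  let ?H = "\<lambda>a n z. haar_sum (trap m) a n z" and ?G = "\<lambda>a n z. grad_y m a n z"
  from Suc obtain a where ab: "\<And>k i j. a k i j = b k i j \<or> a k i j = 0"
    and bd: "\<And>z. \<bar>?H a N z\<bar> \<le> lam + 2^m + 1 \<and> \<bar>?G a N z\<bar> \<le> lam + 3 * 2^m"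
    and st: "\<And>k z. k < N \<Longrightarrow> coef a k z \<noteq> coef b k z \<Longrightarrow> lam < \<bar>?H a N z\<bar> \<or> lam < \<bar>?G a N z\<bar>"
    by blast
  have a1: "\<bar>a k i j\<bar> \<le> 1" for k i j using ab[of k i j] b[of k i j] by auto
  define act where "act = (\<lambda>i j. \<exists>z. \<lfloor>2^N * fst z\<rfloor> = i \<and> \<lfloor>2^Suc N * snd z\<rfloor> = j \<and> \<bar>?H a N z\<bar> \<le> lam \<and> \<bar>?G a N z\<bar> \<le> lam)"
  define a' where "a' = a(N := (\<lambda>i j. if act i j then b N i j else 0))"
  have ab': "a' k i j = b k i j \<or> a' k i j = 0" for k i j
    using ab by (simp add: a'_def)
  have HS: "?H a' (Suc N) z = ?H a N z + coef a' N z * (rad (2^N * fst z) * trap m (2^Suc N * snd z))" for z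
    unfolding haar_sum_Suc by (simp add: a'_def haar_sum_upd)
  have GS: "?G a' (Suc N) z = ?G a N z + coef a' N z * (2 * tent (2^N * fst z) * dtrap m (2^Suc N * snd z))" for z
    unfolding grad_y_Suc by (simp add: a'_def grad_y_upd)
  have coefN: "coef a' N z = (if act \<lfloor>2^N * fst z\<rfloor> \<lfloor>2^Suc N * snd z\<rfloor> then coef b N z else 0)" for z
    by (simp add: coef_def a'_def)
  have bd': "\<bar>?H a' (Suc N) z\<bar> \<le> lam + 2^m + 1 \<and> \<bar>?G a' (Suc N) z\<bar> \<le> lam + 3 * 2^m" for z
  proof (cases "coef a' N z = 0")
    case True
    then show ?thesis using bd[of z] by (simp add: HS GS)
  next
    case False
    then have "act \<lfloor>2^N * fst z\<rfloor> \<lfloor>2^Suc N * snd z\<rfloor>" and bN: "coef b N z \<noteq> 0"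
      by (auto simp: coefN split: if_splits)
    \<comment> \<open>Passing from \<open>w\<close> to \<open>z\<close> inside the rectangle costs
      \<open>2^m\<close> and \<open>2 * 2^m\<close> by oscillation, and the new term adds at most 1
      and \<open>2^m\<close>. This is where \<open>lam + 2^m + 1\<close> and
      \<open>lam + 3 * 2^m\<close> come from.\<close>
    then obtain w where w: "\<lfloor>2^N * fst z\<rfloor> = \<lfloor>2^N * fst w\<rfloor>" "\<lfloor>2^Suc N * snd z\<rfloor> = \<lfloor>2^Suc N * snd w\<rfloor>"
      and wl: "\<bar>?H a N w\<bar> \<le> lam" "\<bar>?G a N w\<bar> \<le> lam"
      unfolding act_def by metis
    have sp': "k + m \<le> N" if "k < N" "coef a k z \<noteq> 0" for k
    proof -
      have "coef b k z \<noteq> 0" using that ab by (metis coef_def)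
      then show ?thesis using sp that(1) bN unfolding sparse_def coef_def by blast
    qed
    have c1: "\<bar>coef a' N z\<bar> \<le> 1" 
      using b[of N "\<lfloor>2^N * fst z\<rfloor>" "\<lfloor>2^Suc N * snd z\<rfloor>"] ab'[of N "\<lfloor>2^N * fst z\<rfloor>" "\<lfloor>2^Suc N * snd z\<rfloor>"]
      unfolding coef_def by linarith
    have tri: "\<bar>h + t\<bar> \<le> l + p + q" if "\<bar>h - h'\<bar> \<le> p" "\<bar>h'\<bar> \<le> l" "\<bar>t\<bar> \<le> q" for h h' t l p q :: real
      using that by linarith
    have "\<bar>coef a' N z * (rad (2^N * fst z) * trap m (2^Suc N * snd z))\<bar> \<le> 1 * (1 * 1)"
      using c1 trap_bounds by (intro abs_mult_le_mult) auto
    from tri[OF haar_sum_oscillation[of a, OF a1 w] wl(1) this]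
    have "\<bar>?H a' (Suc N) z\<bar> \<le> lam + 2^m + 1" unfolding HS by simp
    moreover have "\<bar>coef a' N z * (2 * tent (2^N * fst z) * dtrap m (2^Suc N * snd z))\<bar> \<le> 1 * (1 * 2^m)"
      using c1 tent_bounds abs_dtrap by (intro abs_mult_le_mult) auto
    from tri[OF grad_y_oscillation[of a, OF a1 sp' w] wl(2) this]
    have "\<bar>?G a' (Suc N) z\<bar> \<le> lam + 3 * 2^m" unfolding GS by simp
    ultimately show ?thesis by blast
  qed
  have st': "lam < \<bar>?H a' (Suc N) z\<bar> \<or> lam < \<bar>?G a' (Suc N) z\<bar>"
    if "k < Suc N" "coef a' k z \<noteq> coef b k z" for k z
  proof -
    have "\<not> act \<lfloor>2^N * fst z\<rfloor> \<lfloor>2^Suc N * snd z\<rfloor>"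
    proof (cases "k = N")
      case True
      then show ?thesis using that by (auto simp: coefN)
    next
      case False
      then have k: "k < N" using that by simp
      then have ne: "coef a k z \<noteq> coef b k z" using that by (simp add: a'_def coef_def)
      show ?thesis
      proof
        \<comment> \<open>A witness \<open>w\<close> of activity would lie in the same rectangle of
          level \<open>k\<close>, where the coefficient was dropped before, so the gradient at
          \<open>w\<close> would exceed \<open>lam\<close>.\<close>
        assume "act \<lfloor>2^N * fst z\<rfloor> \<lfloor>2^Suc N * snd z\<rfloor>"
        then obtain w where w: "\<lfloor>2^N * fst z\<rfloor> = \<lfloor>2^N * fst w\<rfloor>" "\<lfloor>2^Suc N * snd z\<rfloor> = \<lfloor>2^Suc N * snd w\<rfloor>"
          and wl: "\<bar>?H a N w\<bar> \<le> lam" "\<bar>?G a N w\<bar> \<le> lam"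
          unfolding act_def by metis
        have "coef a k w \<noteq> coef b k w"
          using ne coef_cong[OF w, of k] k by simp
        from st[OF k this] wl show False by linarith
      qed
    qed
    moreover from this have "lam < \<bar>?H a N z\<bar> \<or> lam < \<bar>?G a N z\<bar>"
      unfolding act_def not_ex by (drule_tac x=z in spec) auto
    ultimately show ?thesis by (simp add: HS GS coefN)
  qed
  show ?case
    by (rule exI[of _ a']) (use ab' bd' st' in blast)
qed

section \<open>A bounded gradient field correlated with a given function\<close>

text \<open>This confines the Haar coefficients, and with them the potential, to the unit
  square.\<close>

lemma avg_outside:
  assumes "\<not> (0 \<le> i \<and> i < 2^n \<and> 0 \<le> j \<and> j < 2^k)"
  shows "avg n k F i j = 0"
proof -
  have "AE z in unif \<Otimes>\<^sub>M unif. (if \<lfloor>2^n * fst z\<rfloor> = i \<and> \<lfloor>2^k * snd z\<rfloor> = j then F z else 0) = 0"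
    using AE_unif2
  proof eventually_elim
    case (elim z)
    have lt: "int p < 2^l" if "p < 2^l" for p l
      using that of_nat_less_iff[of p "2^l", where 'a=int] by simp
    obtain p where p: "p < 2^n" "\<lfloor>2^n * fst z\<rfloor> = int p" using elim nat_floor_pow2 by blast
    obtain q where q: "q < 2^k" "\<lfloor>2^k * snd z\<rfloor> = int q" using elim nat_floor_pow2 by blast
    have "\<not> (int p = i \<and> int q = j)"
      using assms lt[OF p(1)] lt[OF q(1)] by auto
    then show ?case unfolding p(2) q(2) by auto
  qed
  then show ?thesis
    unfolding avg_def by (simp add: integral_eq_zero_AE)
qed

lemma integral_coef_sq:
  assumes "\<And>k i j. \<bar>a k i j\<bar> \<le> 1"
  shows "(\<integral>z. (coef a k z)\<^sup>2 \<partial>(unif \<Otimes>\<^sub>M unif)) = (\<Sum>i<2^k. \<Sum>j<2^Suc k. (a k (int i) (int j))\<^sup>2) / (2^k * 2^Suc k)"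
  unfolding coef_def
  by (rule integral_step[of "\<lambda>i j. (a k i j)\<^sup>2" 1 k "Suc k"]) (use assms in \<open>simp add: abs_square_le_1\<close>)

text \<open>With \<open>q = 1\<close> the sum is a genuine Haar series. Assumption \<open>cb\<close>
  holds as soon as each coefficient is the Haar coefficient of \<open>f\<close> or zero, so it
  covers the kept and the dropped part alike.\<close>

lemma integral_haar_sum_inner:
  assumes [measurable]: "f \<in> borel_measurable borel" and f: "\<And>z. \<bar>f z\<bar> \<le> 1"
    and c: "\<And>k i j. \<bar>c k i j\<bar> \<le> 1"
    and cb: "\<And>k i j. c k i j * avg k (Suc k) (\<lambda>z. f z * rad (2^k * fst z)) i j = (c k i j)\<^sup>2"
  shows "(\<integral>z. f z * haar_sum (\<lambda>_. 1) c N z \<partial>(unif \<Otimes>\<^sub>M unif)) = (\<Sum>k<N. \<integral>z. (coef c k z)\<^sup>2 \<partial>(unif \<Otimes>\<^sub>M unif))"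
proof -
  let ?M = "unif \<Otimes>\<^sub>M unif"
  let ?F = "\<lambda>k z. f z * rad (2^k * fst z)"
  have F: "\<bar>?F k z\<bar> \<le> 1" for k z using f by (simp add: abs_mult)
  have int: "integrable ?M (\<lambda>z. coef c k z * ?F k z)" for k
    by (rule integrable_unif2[where K="1 * 1"], measurable) (rule abs_mult_le_mult, use c F in \<open>auto simp: coef_def\<close>)
  have "(\<integral>z. coef c k z * ?F k z \<partial>?M) = (\<integral>z. (coef c k z)\<^sup>2 \<partial>?M)" for k
    unfolding integral_coef_sq[OF c] unfolding coef_def
    by (subst integral_cells[OF _ F]) (simp_all add: cb)
  then have "(\<Sum>k<N. \<integral>z. (coef c k z)\<^sup>2 \<partial>?M) = (\<integral>z. (\<Sum>k<N. coef c k z * ?F k z) \<partial>?M)"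
    using int by simp
  also have "\<dots> = (\<integral>z. f z * haar_sum (\<lambda>_. 1) c N z \<partial>?M)"
    by (simp add: haar_sum_def sum_distrib_left ac_simps)
  finally show ?thesis ..
qed

text \<open>Pigeonhole over the \<open>m\<close> residue classes.\<close>

lemma residue_class_energy:
  fixes h :: "nat \<Rightarrow> real"
  assumes "m > 0" "E \<le> (\<Sum>k<N. h k)"
  shows "\<exists>r. E / real m \<le> (\<Sum>k<N. if k mod m = r then h k else 0)"
proof -
  have "(\<Sum>k<N. h k) = (\<Sum>k<N. \<Sum>r<m. if k mod m = r then h k else 0)"
    using assms(1) by (intro sum.cong refl) (simp add: sum.delta)
  also have "\<dots> = (\<Sum>r<m. \<Sum>k<N. if k mod m = r then h k else 0)"
    by (rule sum.swap)
  finally have eq: "E \<le> (\<Sum>r<m. \<Sum>k<N. if k mod m = r then h k else 0)" using assms(2) by simp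
  show ?thesis
  proof (rule ccontr)
    assume "\<not> ?thesis"
    then have "(\<Sum>k<N. if k mod m = r then h k else 0) < E / real m" for r
      by (meson not_less)
    then have "(\<Sum>r<m. \<Sum>k<N. if k mod m = r then h k else 0) < (\<Sum>r<m. E / real m)"
      using assms(1) by (intro sum_strict_mono) auto
    with eq assms(1) show False by simp
  qed
qed

text \<open>Let \<open>Y\<close> be the kept and \<open>X\<close> the dropped energy.
  \<open>Y + X\<close> is at least \<open>E / 27\<close>, and \<open>X\<close> is bounded by the
  area where the gradient is large, at most \<open>E / 54\<close>. So \<open>Y\<close> is at least
  \<open>E / 54\<close>; the strips cost at most \<open>Y / 2\<close>, which leaves
  \<open>E / 108\<close>.\<close>

lemma exists_gain_field:
  assumes [measurable]: "f \<in> borel_measurable borel" and f: "\<And>z. \<bar>f z\<bar> \<le> 1"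
    and E_def: "E = (\<integral>z. (f z)\<^sup>2 \<partial>(unif \<Otimes>\<^sub>M unif))"
    and E: "E / 3 \<le> (\<Sum>k<N. haar_energy k f)"
  shows "\<exists>a. (\<forall>k i j. \<bar>a k i j\<bar> \<le> 1) \<and>
    (\<forall>k i j. a k i j \<noteq> 0 \<longrightarrow> 0 \<le> i \<and> i < 2^k \<and> 0 \<le> j \<and> j < 2^Suc k) \<and>
    (\<forall>z. \<bar>haar_sum (trap 9) a N z\<bar> \<le> 6000 \<and> \<bar>grad_y 9 a N z\<bar> \<le> 6000) \<and>
    E / 108 \<le> (\<integral>z. f z * haar_sum (trap 9) a N z \<partial>(unif \<Otimes>\<^sub>M unif))"
proof -
  let ?M = "unif \<Otimes>\<^sub>M unif"
  define m where "m = (9::nat)"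
  define lam where "lam = (4000::real)" \<comment> \<open>\<open>54 (1 + 4\<^sup>m) \<le> lam\<^sup>2\<close>, so Chebyshev gives area at most \<open>E/54\<close>\<close>
  have m0: "m > 0" by (simp add: m_def)
  let ?b0 = "\<lambda>k i j. avg k (Suc k) (\<lambda>z. f z * rad (2^k * fst z)) i j"
  have b01: "\<bar>?b0 k i j\<bar> \<le> 1" for k i j
    by (rule abs_avg_le_1) (use f in \<open>auto simp: abs_mult\<close>)
  obtain r where r: "E / 3 / real m \<le> (\<Sum>k<N. if k mod m = r then haar_energy k f else 0)"
    using residue_class_energy[OF m0 E] by blast
  define b where "b = (\<lambda>k i j. if k mod m = r then ?b0 k i j else 0)"
  have b1: "\<bar>b k i j\<bar> \<le> 1" for k i j using b01 by (simp add: b_def)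
  have bz: "0 \<le> i \<and> i < 2^k \<and> 0 \<le> j \<and> j < 2^Suc k" if "b k i j \<noteq> 0" for k i j
  proof (rule ccontr)
    assume "\<not> ?thesis"
    from avg_outside[OF this] that show False by (simp add: b_def split: if_splits)
  qed
  have sp: "sparse m b"
    unfolding sparse_def
  proof (intro allI impI)
    fix k l i j i' j' assume "k < l" "b k i j \<noteq> 0" "b l i' j' \<noteq> 0"
    then have "k mod m = l mod m" by (auto simp: b_def split: if_splits)
    then have "m dvd l - k" using \<open>k < l\<close> by (metis mod_eq_dvd_iff_nat less_imp_le)
    then have "m \<le> l - k" using \<open>k < l\<close> by (intro dvd_imp_le) auto
    then show "k + m \<le> l" using \<open>k < l\<close> by simp
  qed
  have "0 \<le> lam" by (simp add: lam_def)
  with sp obtain a where ab: "\<And>k i j. a k i j = b k i j \<or> a k i j = 0"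
    and bd: "\<And>z. \<bar>haar_sum (trap m) a N z\<bar> \<le> lam + 2^m + 1 \<and> \<bar>grad_y m a N z\<bar> \<le> lam + 3 * 2^m"
    and st: "\<And>k z. k < N \<Longrightarrow> coef a k z \<noteq> coef b k z \<Longrightarrow> lam < \<bar>haar_sum (trap m) a N z\<bar> \<or> lam < \<bar>grad_y m a N z\<bar>"
    using exists_stopped_coefficients[of b m lam N] b1 by blast
  have a1: "\<bar>a k i j\<bar> \<le> 1" for k i j using ab[of k i j] b1[of k i j] by auto
  have "sparse m a" using sp ab unfolding sparse_def by metis
  define d where "d = (\<lambda>k i j. b k i j - a k i j)"
  have dd: "d k i j = b k i j \<or> d k i j = 0" for k i j using ab[of k i j] by (auto simp: d_def)
  have d1: "\<bar>d k i j\<bar> \<le> 1" for k i j using dd[of k i j] b1[of k i j] by auto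
  have sub: "c k i j * ?b0 k i j = (c k i j)\<^sup>2" if "\<And>k i j. c k i j = b k i j \<or> c k i j = 0" for c k i j
    using that[of k i j] by (auto simp: b_def power2_eq_square)
  define Y X where "Y = (\<Sum>k<N. \<integral>z. (coef a k z)\<^sup>2 \<partial>?M)" and "X = (\<Sum>k<N. \<integral>z. (coef d k z)\<^sup>2 \<partial>?M)"
  have innerY: "(\<integral>z. f z * haar_sum (\<lambda>_. 1) a N z \<partial>?M) = Y"
    unfolding Y_def using f a1 sub[of a] ab by (intro integral_haar_sum_inner) auto
  have innerX: "(\<integral>z. f z * haar_sum (\<lambda>_. 1) d N z \<partial>?M) = X"
    unfolding X_def using f d1 sub[of d] dd by (intro integral_haar_sum_inner) auto
  have sqY: "(\<integral>z. (haar_sum q a N z)\<^sup>2 \<partial>?M) = Y * (\<integral>s. (q s)\<^sup>2 \<partial>unif)"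
    if "q \<in> borel_measurable borel" "\<And>s. \<bar>q s\<bar> \<le> 1" "\<And>s i. q (s - of_int i) = q s" for q
    unfolding Y_def using that a1 by (intro integral_haar_sum_sq) auto
  have sqX: "(\<integral>z. (haar_sum (\<lambda>_. 1) d N z)\<^sup>2 \<partial>?M) = X"
    unfolding X_def using integral_haar_sum_sq[of d "\<lambda>_. 1" N] d1 unif.prob_space by simp
  have YX: "E / 3 / real m \<le> Y + X"
  proof -
    have "(\<integral>z. (coef a k z)\<^sup>2 \<partial>?M) + (\<integral>z. (coef d k z)\<^sup>2 \<partial>?M) = (if k mod m = r then haar_energy k f else 0)" for k
    proof -
      \<comment> \<open>Each coefficient goes wholly to \<open>a\<close> or wholly to
        \<open>d\<close>, so there is no cross term.\<close>
      have sq: "(b k i j)\<^sup>2 = (a k i j)\<^sup>2 + (d k i j)\<^sup>2" for i j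
        using ab[of k i j] by (auto simp: d_def)
      have "(\<integral>z. (coef a k z)\<^sup>2 \<partial>?M) + (\<integral>z. (coef d k z)\<^sup>2 \<partial>?M)
          = (\<Sum>i<2^k. \<Sum>j<2^Suc k. (b k (int i) (int j))\<^sup>2) / (2^k * 2^Suc k)"
        unfolding integral_coef_sq[OF a1] integral_coef_sq[OF d1]
        unfolding sq sum.distrib add_divide_distrib ..
      then show ?thesis by (simp add: b_def haar_energy_def energy_def)
    qed
    then show ?thesis using r unfolding Y_def X_def by (simp flip: sum.distrib)
  qed
  have int_sq: "integrable ?M (\<lambda>z. (g z)\<^sup>2)" if "g \<in> borel_measurable borel" "\<And>z. \<bar>g z\<bar> \<le> K" for g :: "real \<times> real \<Rightarrow> real" and K
  proof (rule integrable_unif2[where K="K * K"])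
    show "(\<lambda>z. (g z)\<^sup>2) \<in> borel_measurable borel" using that(1) by measurable
    show "\<bar>(g z)\<^sup>2\<bar> \<le> K * K" for z
      unfolding power2_eq_square by (rule abs_mult_le_mult[OF that(2) that(2)])
  qed
  have int_pr: "integrable ?M (\<lambda>z. g z * h z)" if "g \<in> borel_measurable borel" "h \<in> borel_measurable borel" "\<And>z. \<bar>g z\<bar> \<le> K" "\<And>z. \<bar>h z\<bar> \<le> L" for g h :: "real \<times> real \<Rightarrow> real" and K L
  proof (rule integrable_unif2[where K="K * L"])
    show "(\<lambda>z. g z * h z) \<in> borel_measurable borel" using that(1,2) by measurable
    show "\<bar>g z * h z\<bar> \<le> K * L" for z by (rule abs_mult_le_mult[OF that(3,4)])
  qed
  \<comment> \<open>Young's inequality with a free weight \<open>s\<close>, which replaces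
    Cauchy-Schwarz and avoids square roots.\<close>
  have cauchy: "(\<integral>z. g z * h z \<partial>?M) \<le> (s * (\<integral>z. (g z)\<^sup>2 \<partial>?M) + (\<integral>z. (h z)\<^sup>2 \<partial>?M) / s) / 2"
    if m: "g \<in> borel_measurable borel" "h \<in> borel_measurable borel" and K: "\<And>z. \<bar>g z\<bar> \<le> K" "\<And>z. \<bar>h z\<bar> \<le> L" and s: "s > 0" for g h :: "real \<times> real \<Rightarrow> real" and K L s
  proof -
    have p: "p * q \<le> (s * p\<^sup>2 + q\<^sup>2 / s) / 2" for p q :: real
    proof -
      have "0 \<le> (s * p - q)\<^sup>2 / s" using s by simp
      also have "\<dots> = s * p\<^sup>2 + q\<^sup>2 / s - 2 * (p * q)" using s by (simp add: power2_eq_square field_simps)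
      finally show ?thesis by simp
    qed
    have "(\<integral>z. g z * h z \<partial>?M) \<le> (\<integral>z. (s * (g z)\<^sup>2 + (h z)\<^sup>2 / s) / 2 \<partial>?M)"
      using int_sq[OF m(1) K(1)] int_sq[OF m(2) K(2)] p by (intro integral_mono int_pr[OF m K]) auto
    also have "\<dots> = (s * (\<integral>z. (g z)\<^sup>2 \<partial>?M) + (\<integral>z. (h z)\<^sup>2 \<partial>?M) / s) / 2"
      using int_sq[OF m(1) K(1)] int_sq[OF m(2) K(2)] by simp
    finally show ?thesis .
  qed
  have hb: "\<bar>haar_sum q c N z\<bar> \<le> real N" if "\<And>s. \<bar>q s\<bar> \<le> 1" "\<And>k i j. \<bar>c k i j\<bar> \<le> 1" for q c z
    using that by (intro abs_haar_sum_le)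
  have Y0: "0 \<le> Y" unfolding Y_def by (intro sum_nonneg) auto
  \<comment> \<open>Bessel: the pairing of \<open>f\<close> with the kept Haar series is the squared
    norm \<open>Y\<close> of that series, so \<open>Y \<le> (E + Y) / 2\<close>.\<close>
  have YE: "Y \<le> E"
  proof -
    have "Y \<le> (1 * E + Y / 1) / 2"
      using cauchy[of f "haar_sum (\<lambda>_. 1) a N" 1 "real N" 1] hb[of "\<lambda>_. 1" a] a1 f innerY sqY[of "\<lambda>_. 1"]
        unif.prob_space by (simp add: E_def)
    then show ?thesis by simp
  qed
  define B where "B = {z. lam < \<bar>haar_sum (trap m) a N z\<bar> \<or> lam < \<bar>grad_y m a N z\<bar>}"
  have [measurable]: "B \<in> sets borel" unfolding B_def by measurable
  \<comment> \<open>Dropped coefficients occur only over \<open>B\<close>, so \<open>f\<close> may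
    be cut down to \<open>B\<close> before the pairing. The same inequality then bounds
    \<open>X\<close> by the area of \<open>B\<close>, since \<open>f\<close> is at most 1 in
    absolute value.\<close>
  have XB: "X \<le> (\<integral>z. indicator B z \<partial>?M)"
  proof -
    have fz: "f z * haar_sum (\<lambda>_. 1) d N z = indicator B z * f z * haar_sum (\<lambda>_. 1) d N z" for z
    proof (cases "z \<in> B")
      case False
      then have "coef d k z = 0" if "k < N" for k
      proof -
        have "coef a k z = coef b k z" using st[OF that, of z] False by (auto simp: B_def)
        then show ?thesis by (simp add: coef_def d_def)
      qed
      then show ?thesis by (simp add: haar_sum_def)
    qed simp
    have "X = (\<integral>z. (indicator B z * f z) * haar_sum (\<lambda>_. 1) d N z \<partial>?M)"
      unfolding innerX[symmetric] by (rule Bochner_Integration.integral_cong[OF refl fz])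
    also have "\<dots> \<le> (1 * (\<integral>z. (indicator B z * f z)\<^sup>2 \<partial>?M) + (\<integral>z. (haar_sum (\<lambda>_. 1) d N z)\<^sup>2 \<partial>?M) / 1) / 2"
    proof (rule cauchy[where K=1 and L="real N"])
      show "\<bar>indicator B z * f z\<bar> \<le> 1" for z using f[of z] by (simp add: indicator_def)
      show "\<bar>haar_sum (\<lambda>_. 1) d N z\<bar> \<le> real N" for z by (rule hb) (use d1 in simp_all)
    qed measurable
    also have "(\<integral>z. (indicator B z * f z)\<^sup>2 \<partial>?M) \<le> (\<integral>z. indicator B z \<partial>?M)"
    proof (rule integral_mono)
      show "integrable ?M (\<lambda>z. (indicator B z * f z)\<^sup>2)"
        by (rule int_sq[where K=1], measurable) (use f in \<open>simp add: indicator_def\<close>)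
      show "integrable ?M (indicator B :: _ \<Rightarrow> real)"
        by (rule integrable_unif2[where K=1]) simp_all
      show "(indicator B z * f z)\<^sup>2 \<le> indicator B z" for z
        using f[of z] by (auto simp: indicator_def abs_square_le_1)
    qed
    finally show ?thesis unfolding sqX by simp
  qed
  have iH: "integrable ?M (\<lambda>z. (haar_sum (trap m) a N z)\<^sup>2)"
    by (rule int_sq[where K="lam + 2^m + 1"], measurable) (use bd in blast)
  have iG: "integrable ?M (\<lambda>z. (grad_y m a N z)\<^sup>2)"
    by (rule int_sq[where K="lam + 3 * 2^m"], measurable) (use bd in blast)
  have "lam\<^sup>2 * (\<integral>z. indicator B z \<partial>?M) \<le> (\<integral>z. (haar_sum (trap m) a N z)\<^sup>2 + (grad_y m a N z)\<^sup>2 \<partial>?M)"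
  proof -
    have i: "integrable ?M (\<lambda>z. (haar_sum (trap m) a N z)\<^sup>2 + (grad_y m a N z)\<^sup>2)"
      by (intro Bochner_Integration.integrable_add iH iG)
    have "(\<integral>z. lam\<^sup>2 * indicator B z \<partial>?M) \<le> (\<integral>z. (haar_sum (trap m) a N z)\<^sup>2 + (grad_y m a N z)\<^sup>2 \<partial>?M)"
    proof (rule integral_mono[OF _ i])
      show "integrable ?M (\<lambda>z. lam\<^sup>2 * indicator B z)"
        by (rule integrable_unif2[where K="lam\<^sup>2"]) (simp_all add: indicator_def)
      fix z
      have sq: "lam\<^sup>2 \<le> t\<^sup>2" if "lam < \<bar>t\<bar>" for t
        by (rule abs_le_square_iff[THEN iffD1]) (use that \<open>0 \<le> lam\<close> in simp)
      show "lam\<^sup>2 * indicator B z \<le> (haar_sum (trap m) a N z)\<^sup>2 + (grad_y m a N z)\<^sup>2"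
      proof (cases "z \<in> B")
        case True
        then have "lam\<^sup>2 \<le> (haar_sum (trap m) a N z)\<^sup>2 \<or> lam\<^sup>2 \<le> (grad_y m a N z)\<^sup>2"
          using sq unfolding B_def by blast
        then have "lam\<^sup>2 \<le> (haar_sum (trap m) a N z)\<^sup>2 + (grad_y m a N z)\<^sup>2"
          using zero_le_power2[of "haar_sum (trap m) a N z"] zero_le_power2[of "grad_y m a N z"] by linarith
        then show ?thesis using True by simp
      qed simp
    qed
    then show ?thesis by simp
  qed
  also have "\<dots> = (\<integral>z. (haar_sum (trap m) a N z)\<^sup>2 \<partial>?M) + (\<integral>z. (grad_y m a N z)\<^sup>2 \<partial>?M)"
    by (intro Bochner_Integration.integral_add iH iG)
  also have "\<dots> \<le> Y * 1 + Y * 4^m"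
  proof (intro add_mono)
    have t1: "\<bar>trap m s\<bar> \<le> 1" for s using trap_bounds[of m s] by simp
    have "(\<integral>s. (trap m s)\<^sup>2 \<partial>unif) \<le> (\<integral>s. 1 \<partial>unif)"
      using t1 by (intro integral_mono unif.integrable_const_bound[where B=1]) (auto simp: abs_square_le_1)
    then have "(\<integral>s. (trap m s)\<^sup>2 \<partial>unif) \<le> 1" using unif.prob_space by simp
    then show "(\<integral>z. (haar_sum (trap m) a N z)\<^sup>2 \<partial>?M) \<le> Y * 1"
      using mult_left_mono[OF _ Y0] t1 by (subst sqY) (simp_all only: trap_periodic trap_measurable)
    show "(\<integral>z. (grad_y m a N z)\<^sup>2 \<partial>?M) \<le> Y * 4^m"
      unfolding Y_def using a1 m0 \<open>sparse m a\<close> by (rule integral_grad_y_sq)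
  qed
  \<comment> \<open>Here \<open>16000000\<close> is \<open>lam\<^sup>2\<close> and
    \<open>262145\<close> is \<open>1 + 4^9\<close>.\<close>
  finally have "16000000 * (\<integral>z. indicator B z \<partial>?M) \<le> 262145 * E"
    using YE by (simp add: lam_def m_def)
  with XB YX have YE6: "E \<le> 54 * Y" using YE Y0 by (simp add: m_def)
  \<comment> \<open>The weight \<open>1/110\<close> balances \<open>E \<le> 54 Y\<close> against the strip factor \<open>2/2\<^sup>m = 1/256\<close>.\<close>
  let ?q = "\<lambda>s. 1 - trap m s"
  have q1: "\<bar>?q s\<bar> \<le> 1" for s using trap_bounds[of m s] by simp
  have "(\<integral>z. f z * haar_sum ?q a N z \<partial>?M) \<le> (1/110 * E + (\<integral>z. (haar_sum ?q a N z)\<^sup>2 \<partial>?M) / (1/110)) / 2"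
    unfolding E_def
  proof (rule cauchy[where K=1 and L="real N"])
    show "\<bar>haar_sum ?q a N z\<bar> \<le> real N" for z by (rule hb) (use a1 q1 in simp_all)
  qed (use f in \<open>simp_all\<close>)
  also have "(\<integral>z. (haar_sum ?q a N z)\<^sup>2 \<partial>?M) \<le> Y * (2 / 2^m)"
  proof (subst sqY)
    show "Y * (\<integral>s. (1 - trap m s)\<^sup>2 \<partial>unif) \<le> Y * (2 / 2^m)"
      by (rule mult_left_mono[OF integral_trap_defect[OF m0] Y0])
  qed (use q1 in \<open>simp_all add: trap_periodic\<close>)
  finally have defect: "(\<integral>z. f z * haar_sum ?q a N z \<partial>?M) \<le> Y / 2"
    using YE6 Y0 by (simp add: m_def)
  have "f z * haar_sum (trap m) a N z = f z * haar_sum (\<lambda>_. 1) a N z - f z * haar_sum ?q a N z" for z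
    by (simp add: haar_sum_def sum_distrib_left sum_subtractf algebra_simps)
  moreover have "integrable ?M (\<lambda>z. f z * haar_sum (\<lambda>_. 1) a N z)"
    by (rule int_pr[OF _ _ f hb]) (use a1 in simp_all)
  moreover have "integrable ?M (\<lambda>z. f z * haar_sum ?q a N z)"
    by (rule int_pr[OF _ _ f hb]) (use a1 q1 in simp_all)
  ultimately have "(\<integral>z. f z * haar_sum (trap m) a N z \<partial>?M) = Y - (\<integral>z. f z * haar_sum ?q a N z \<partial>?M)"
    using innerY by simp
  then have gain: "E / 108 \<le> (\<integral>z. f z * haar_sum (trap m) a N z \<partial>?M)"
    using defect YE6 by simp
  have bd': "\<bar>haar_sum (trap m) a N z\<bar> \<le> 6000 \<and> \<bar>grad_y m a N z\<bar> \<le> 6000" for z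
    using bd[of z] by (auto simp: lam_def m_def)
  have supp: "0 \<le> i \<and> i < 2^k \<and> 0 \<le> j \<and> j < 2^Suc k" if "a k i j \<noteq> 0" for k i j
    using that ab[of k i j] bz by metis
  show ?thesis
    using a1 supp bd' gain unfolding m_def by blast
qed

section \<open>Dyadic approximation of sets\<close>

text \<open>The energy is the squared norm of the orthogonal projection of \<open>f\<close> onto
  step functions, and no step function is closer to \<open>f\<close> than the projection.\<close>

lemma energy_ge_step:
  fixes G :: "int \<Rightarrow> int \<Rightarrow> real"
  assumes [measurable]: "f \<in> borel_measurable borel" and f: "\<And>z. \<bar>f z\<bar> \<le> B" and G: "\<And>i j. \<bar>G i j\<bar> \<le> K"
  shows "(\<integral>z. (f z)\<^sup>2 \<partial>(unif \<Otimes>\<^sub>M unif)) - (\<integral>z. (f z - G \<lfloor>2^N * fst z\<rfloor> \<lfloor>2^N * snd z\<rfloor>)\<^sup>2 \<partial>(unif \<Otimes>\<^sub>M unif)) \<le> energy N N f"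
proof -
  let ?M = "unif \<Otimes>\<^sub>M unif"
  let ?g = "\<lambda>z::real \<times> real. G \<lfloor>2^N * fst z\<rfloor> \<lfloor>2^N * snd z\<rfloor>"
  have g[measurable]: "?g \<in> borel_measurable borel" by (rule measurable_floor2) simp_all
  have K: "0 \<le> K" using G[of 0 0] by linarith
  have int: "integrable ?M (\<lambda>z. (f z)\<^sup>2)" "integrable ?M (\<lambda>z. f z * - ?g z)" "integrable ?M (\<lambda>z. (- ?g z)\<^sup>2)"
  proof -
    have G': "\<bar>- ?g z\<bar> \<le> K" for z using G by simp
    show "integrable ?M (\<lambda>z. (f z)\<^sup>2)"
      unfolding power2_eq_square by (rule integrable_unif2[OF _ abs_mult_le_mult[OF f f]]) simp
    show "integrable ?M (\<lambda>z. f z * - ?g z)"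
      by (rule integrable_unif2[OF _ abs_mult_le_mult[OF f G']]) (intro borel_measurable_times borel_measurable_uminus g assms(1))
    show "integrable ?M (\<lambda>z. (- ?g z)\<^sup>2)"
      unfolding power2_eq_square
      by (rule integrable_unif2[OF _ abs_mult_le_mult[OF G' G']]) (intro borel_measurable_times borel_measurable_uminus g)
  qed
  have "(\<integral>z. (f z + - ?g z)\<^sup>2 \<partial>?M) = (\<integral>z. (f z)\<^sup>2 \<partial>?M) + 2 * (\<integral>z. f z * - ?g z \<partial>?M) + (\<integral>z. (- ?g z)\<^sup>2 \<partial>?M)"
    by (rule integral_sum_sq[OF int])
  also have "(\<integral>z. f z * - ?g z \<partial>?M) = - (\<integral>z. ?g z * f z \<partial>?M)"
    by (simp add: mult.commute)
  also have "(\<integral>z. ?g z * f z \<partial>?M) = (\<Sum>i<2^N. \<Sum>j<2^N. G (int i) (int j) * avg N N f (int i) (int j)) / (2^N * 2^N)"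
    by (rule integral_cells[OF _ f]) simp
  also have "(\<integral>z. (- ?g z)\<^sup>2 \<partial>?M) = (\<Sum>i<2^N. \<Sum>j<2^N. (G (int i) (int j))\<^sup>2) / (2^N * 2^N)"
  proof -
    have "\<bar>(G i j)\<^sup>2\<bar> \<le> K * K" for i j
      unfolding power2_eq_square by (rule abs_mult_le_mult[OF G G])
    from integral_step[OF this] show ?thesis by simp
  qed
  finally have eq: "(\<integral>z. (f z)\<^sup>2 \<partial>?M) - (\<integral>z. (f z - ?g z)\<^sup>2 \<partial>?M)
      = 2 * ((\<Sum>i<2^N. \<Sum>j<2^N. G (int i) (int j) * avg N N f (int i) (int j)) / (2^N * 2^N))
        - (\<Sum>i<2^N. \<Sum>j<2^N. (G (int i) (int j))\<^sup>2) / (2^N * 2^N)"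
    by simp
  have "0 \<le> (\<Sum>i<2^N. \<Sum>j<2^N. (avg N N f (int i) (int j) - G (int i) (int j))\<^sup>2) / (2^N * 2^N)"
    by (intro divide_nonneg_pos sum_nonneg) auto
  also have "\<dots> = energy N N f - (2 * ((\<Sum>i<2^N. \<Sum>j<2^N. G (int i) (int j) * avg N N f (int i) (int j)) / (2^N * 2^N))
        - (\<Sum>i<2^N. \<Sum>j<2^N. (G (int i) (int j))\<^sup>2) / (2^N * 2^N))"
  proof -
    have p: "(p - q)\<^sup>2 = p\<^sup>2 + q\<^sup>2 - 2 * (q * p)" for p q :: real by (simp add: power2_diff)
    show ?thesis
      unfolding energy_def p sum.distrib sum_subtractf sum_distrib_left[symmetric]
      by (simp add: add_divide_distrib diff_divide_distrib)
  qed
  finally show ?thesis unfolding eq by simp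
qed

lemma dist_prod_le: "dist z w \<le> \<bar>fst z - fst w\<bar> + \<bar>snd z - snd w\<bar>" for z w :: "real \<times> real"
  unfolding dist_prod_def dist_real_def by (rule sqrt_sum_squares_le_sum_abs[THEN order_trans]) simp

lemma emeasure_unif2_le: "X \<in> sets borel \<Longrightarrow> emeasure (unif \<Otimes>\<^sub>M unif) X \<le> emeasure lborel X"
proof -
  assume [measurable]: "X \<in> sets borel"
  have "emeasure (unif \<Otimes>\<^sub>M unif) X = (\<integral>\<^sup>+z. indicator ({0..<1} \<times> {0..<1}) z * indicator X z \<partial>lborel)"
    unfolding unif2_eq by (subst emeasure_density) (auto intro!: borel_measurable_indicator simp: Ico2_borel)
  also have "\<dots> \<le> (\<integral>\<^sup>+z. indicator X z \<partial>lborel)"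
    by (intro nn_integral_mono) (auto simp: indicator_def)
  finally show ?thesis by simp
qed

text \<open>Squeeze \<open>A\<close> between a compact \<open>K\<close> and an open \<open>U\<close>
  of nearly the same measure. In a grid finer than the distance from \<open>K\<close> to the
  complement of \<open>U\<close>, every cell that meets \<open>K\<close> lies inside
  \<open>U\<close>; the union of these cells errs only on \<open>U - K\<close>.\<close>

lemma exists_dyadic_approx:
  fixes A :: "(real \<times> real) set"
  assumes [measurable]: "A \<in> sets borel" and "bounded A" and e: "e > 0"
  shows "\<exists>N. \<exists>G :: int \<Rightarrow> int \<Rightarrow> real. (\<forall>i j. G i j = 0 \<or> G i j = 1) \<and>
    (\<integral>z. (indicator A z - G \<lfloor>2^N * fst z\<rfloor> \<lfloor>2^N * snd z\<rfloor>)\<^sup>2 \<partial>(unif \<Otimes>\<^sub>M unif)) \<le> e"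
proof -
  let ?M = "unif \<Otimes>\<^sub>M unif"
  have AL: "A \<in> sets lebesgue" by simp
  have e2: "0 < e / 2" using e by simp
  obtain U where U: "open U" "A \<subseteq> U" "U - A \<in> lmeasurable" "emeasure lebesgue (U - A) < ennreal (e / 2)"
    by (rule sets_lebesgue_outer_open[OF AL e2])
  obtain K where K: "closed K" "K \<subseteq> A" "A - K \<in> lmeasurable" "emeasure lebesgue (A - K) < ennreal (e / 2)"
    by (rule sets_lebesgue_inner_closed[OF AL e2])
  have [measurable]: "U \<in> sets borel" "K \<in> sets borel" using U(1) K(1) by auto
  have "compact K" using K(1,2) \<open>bounded A\<close> by (meson bounded_subset compact_eq_bounded_closed)
  moreover have "closed (- U)" "K \<inter> - U = {}" using U(1,2) K(2) by auto
  ultimately have "\<exists>d>0. \<forall>x\<in>K. \<forall>y\<in>- U. d \<le> dist x y"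
    by (rule separate_compact_closed)
  then obtain d where d: "d > 0" "\<And>x y. x \<in> K \<Longrightarrow> y \<in> - U \<Longrightarrow> d \<le> dist x y"
    by auto
  \<comment> \<open>Two points of a cell are at most \<open>1 / 2^N + 1 / 2^N\<close> apart, which
    has to be below \<open>d\<close>.\<close>
  obtain N :: nat where N: "2 / d < 2^N" using real_arch_pow[of 2 "2 / d"] by auto
  define G where "G = (\<lambda>i j. if \<exists>w\<in>K. \<lfloor>2^N * fst w\<rfloor> = i \<and> \<lfloor>2^N * snd w\<rfloor> = j then 1 else 0 :: real)"
  let ?g = "\<lambda>z::real \<times> real. G \<lfloor>2^N * fst z\<rfloor> \<lfloor>2^N * snd z\<rfloor>"
  have le: "(indicator A z - ?g z)\<^sup>2 \<le> indicator (U - K) z" for z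
  proof (cases "z \<in> K")
    case True
    then have "?g z = 1" by (auto simp: G_def)
    then show ?thesis using True K(2) by auto
  next
    case False
    show ?thesis
    proof (cases "z \<in> U")
      case True
      then show ?thesis using False by (auto simp: G_def indicator_def)
    next
      case nU: False
      have "?g z = 0"
      proof (rule ccontr)
        assume "?g z \<noteq> 0"
        then obtain w where w: "w \<in> K" "\<lfloor>2^N * fst w\<rfloor> = \<lfloor>2^N * fst z\<rfloor>" "\<lfloor>2^N * snd w\<rfloor> = \<lfloor>2^N * snd z\<rfloor>"
          by (auto simp: G_def split: if_splits)
        have "d \<le> dist w z" using d(2) w(1) nU by simp
        also have "\<dots> \<le> 1 / 2^N + 1 / 2^N"
          using dist_prod_le[of w z] abs_diff_of_floor_eq[OF w(2)] abs_diff_of_floor_eq[OF w(3)] by linarith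
        also have "\<dots> < d" using N d(1) by (simp add: field_simps)
        finally show False by simp
      qed
      then show ?thesis using nU U(2) by (auto simp: indicator_def)
    qed
  qed
  have "(\<integral>z. (indicator A z - ?g z)\<^sup>2 \<partial>?M) \<le> (\<integral>z. indicator (U - K) z \<partial>?M)"
  proof (rule integral_mono[OF _ _ le])
    show "integrable ?M (\<lambda>z. (indicator A z - ?g z)\<^sup>2)"
    proof (rule integrable_unif2[where K=1])
      show "\<bar>(indicator A z - ?g z)\<^sup>2\<bar> \<le> 1" for z using order_trans[OF le[of z], of 1] by simp
    qed measurable
    show "integrable ?M (indicator (U - K) :: _ \<Rightarrow> real)"
      by (rule integrable_unif2[where K=1]) simp_all
  qed
  also have "\<dots> = measure ?M (U - K)" by simp
  also have "\<dots> \<le> e"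
  proof -
    have "emeasure ?M (U - K) \<le> emeasure lborel (U - K)" by (rule emeasure_unif2_le) simp
    also have "\<dots> = emeasure lebesgue (U - K)" by simp
    also have "\<dots> \<le> emeasure lebesgue ((U - A) \<union> (A - K))" by (intro emeasure_mono) auto
    also have "\<dots> \<le> emeasure lebesgue (U - A) + emeasure lebesgue (A - K)"
      by (rule emeasure_subadditive) auto
    also have "\<dots> \<le> ennreal (e / 2) + ennreal (e / 2)" using U(4) K(4) by (intro add_mono) auto
    also have "\<dots> = ennreal e" using e by (simp flip: ennreal_plus)
    finally show ?thesis using e by (simp add: unif2.P.emeasure_eq_measure)
  qed
  finally show ?thesis
    by (intro exI[of _ N] exI[of _ G]) (auto simp: G_def)
qed

text \<open>Centring removes the energy of the coarsest level. With \<open>E = c * (1 - c)\<close>,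
  an approximation with squared error \<open>E / 3\<close> leaves \<open>2 E / 3\<close> for the
  Haar energies of both directions together, so one of them has at least
  \<open>E / 3\<close>.\<close>

lemma exists_haar_energy:
  fixes A :: "(real \<times> real) set"
  assumes [measurable]: "A \<in> sets borel" and "bounded A"
    and c: "c = measure (unif \<Otimes>\<^sub>M unif) A" and f_def: "f = (\<lambda>z. indicator A z - c)"
  shows "(\<integral>z. (f z)\<^sup>2 \<partial>(unif \<Otimes>\<^sub>M unif)) = c * (1 - c)"
    and "\<exists>N. c * (1 - c) / 3 \<le> (\<Sum>k<N. haar_energy k f)
      \<or> c * (1 - c) / 3 \<le> (\<Sum>k<N. haar_energy k (\<lambda>z. f (prod.swap z)))"
proof -
  let ?M = "unif \<Otimes>\<^sub>M unif"
  have c01: "0 \<le> c" "c \<le> 1" unfolding c by simp_all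
  have [measurable]: "f \<in> borel_measurable borel" unfolding f_def by measurable
  have f: "\<bar>f z\<bar> \<le> 1" for z using c01 by (simp add: f_def indicator_def)
  have intA: "integrable ?M (indicator A :: _ \<Rightarrow> real)" by (rule integrable_unif2[where K=1]) simp_all
  have "(f z)\<^sup>2 = (1 - 2 * c) * indicator A z + c\<^sup>2" for z
    by (simp add: f_def indicator_def power2_eq_square algebra_simps)
  then have "(\<integral>z. (f z)\<^sup>2 \<partial>?M) = (1 - 2 * c) * c + c\<^sup>2"
    using intA unif2.P.prob_space by (simp add: c)
  also have "\<dots> = c * (1 - c)" by (simp add: power2_eq_square algebra_simps)
  finally show E: "(\<integral>z. (f z)\<^sup>2 \<partial>?M) = c * (1 - c)" .
  have e0: "energy 0 0 f = 0"
  proof -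
    have "(\<integral>z. 1 * f z \<partial>?M) = 0"
      using intA unif2.P.prob_space by (simp add: f_def c)
    with integral_cells[OF _ f, where c="\<lambda>_ _. 1" and n=0 and k=0] have "avg 0 0 f 0 0 = 0" by simp
    then show ?thesis by (simp add: energy_def)
  qed
  show "\<exists>N. c * (1 - c) / 3 \<le> (\<Sum>k<N. haar_energy k f)
      \<or> c * (1 - c) / 3 \<le> (\<Sum>k<N. haar_energy k (\<lambda>z. f (prod.swap z)))"
  \<comment> \<open>The approximation asks for a positive tolerance, so sets of area 0 or 1 are
    split off.\<close>
  proof (cases "c * (1 - c) = 0")
    case True
    then have "c * (1 - c) / 3 \<le> 0" by linarith
    then show ?thesis by (intro exI[of _ 0]) (simp only: sum.empty lessThan_0 simp_thms)
  next
    case False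
    moreover have "0 \<le> c * (1 - c)" using c01 by simp
    ultimately have pos: "0 < c * (1 - c) / 3" by linarith
    obtain N and G :: "int \<Rightarrow> int \<Rightarrow> real" where G: "\<And>i j. G i j = 0 \<or> G i j = 1"
      and ap: "(\<integral>z. (indicator A z - G \<lfloor>2^N * fst z\<rfloor> \<lfloor>2^N * snd z\<rfloor>)\<^sup>2 \<partial>?M) \<le> c * (1 - c) / 3"
      using exists_dyadic_approx[OF assms(1,2) pos] by blast
    have G2: "\<bar>G i j - c\<bar> \<le> 1" for i j using G[of i j] c01 by auto
    have "(\<integral>z. (f z)\<^sup>2 \<partial>?M) - (\<integral>z. (f z - (G \<lfloor>2^N * fst z\<rfloor> \<lfloor>2^N * snd z\<rfloor> - c))\<^sup>2 \<partial>?M) \<le> energy N N f"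
      by (rule energy_ge_step[OF _ f, where G="\<lambda>i j. G i j - c" and K=1]) (simp_all add: G2)
    moreover have "f z - (G \<lfloor>2^N * fst z\<rfloor> \<lfloor>2^N * snd z\<rfloor> - c) = indicator A z - G \<lfloor>2^N * fst z\<rfloor> \<lfloor>2^N * snd z\<rfloor>" for z
      by (simp add: f_def)
    ultimately have "c * (1 - c) - c * (1 - c) / 3 \<le> energy N N f"
      using ap E by simp
    also have "\<dots> \<le> (\<Sum>k<N. haar_energy k f) + (\<Sum>k<N. haar_energy k (\<lambda>z. f (prod.swap z)))"
      using energy_le_sum_haar_energy[of f 1 N, OF _ f] e0 by simp
    finally show ?thesis by (intro exI[of _ N]) linarith
  qed
qed

section \<open>Piecewise smooth functions\<close>

text \<open>For large enough \<open>n\<close> it contains all break points of the tents and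
  trapezoids in use. Being locally finite, it is harmless for the fundamental theorem of
  calculus.\<close>

definition dyadic :: "nat \<Rightarrow> real set" where
  "dyadic n = {x. 2^n * x \<in> \<int>}"

lemma finite_dyadic_Icc: "finite (dyadic n \<inter> {p..q})"
proof -
  have "dyadic n \<inter> {p..q} \<subseteq> (\<lambda>i. of_int i / 2^n) ` {\<lfloor>2^n * p\<rfloor>..\<lceil>2^n * q\<rceil>}"
  proof
    fix x assume x: "x \<in> dyadic n \<inter> {p..q}"
    then obtain i where i: "2^n * x = of_int i" by (auto simp: dyadic_def elim: Ints_cases)
    have "2^n * p \<le> 2^n * x" "2^n * x \<le> 2^n * q" using x by auto
    then have "i \<in> {\<lfloor>2^n * p\<rfloor>..\<lceil>2^n * q\<rceil>}" unfolding i by (simp add: le_ceiling_iff floor_le_iff)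
    moreover have "x = of_int i / 2^n" using i by (simp add: field_simps)
    ultimately show "x \<in> (\<lambda>i. of_int i / 2^n) ` {\<lfloor>2^n * p\<rfloor>..\<lceil>2^n * q\<rceil>}" by blast
  qed
  then show ?thesis by (rule finite_subset) simp
qed

lemma dyadic_mono: "2^k * x \<in> \<int> \<Longrightarrow> k \<le> n \<Longrightarrow> x \<in> dyadic n"
proof -
  assume *: "2^k * x \<in> \<int>" "k \<le> n"
  obtain d where "n = k + d" using *(2) le_Suc_ex by blast
  then have "2^n * x = of_int (2^d) * (2^k * x)"
    by (simp add: power_add)
  also have "\<dots> \<in> \<int>" by (rule Ints_mult[OF Ints_of_int *(1)])
  finally show ?thesis by (simp add: dyadic_def)
qed

lemma has_integral_piecewise:
  assumes "continuous_on UNIV g" "\<And>x. x \<notin> dyadic n \<Longrightarrow> (g has_real_derivative g' x) (at x)" "p \<le> q"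
  shows "(g' has_integral (g q - g p)) {p..q}"
proof (rule fundamental_theorem_of_calculus_interior_strong[OF finite_dyadic_Icc[of n p q] assms(3)])
  show "(g has_vector_derivative g' x) (at x)" if "x \<in> {p<..<q} - dyadic n \<inter> {p..q}" for x
    using assms(2)[of x] that by (auto simp: has_real_derivative_iff_has_vector_derivative)
  show "continuous_on {p..q} g" using assms(1) continuous_on_subset by blast
qed

lemma Lipschitz_piecewise:
  assumes "continuous_on UNIV g" "\<And>x. x \<notin> dyadic n \<Longrightarrow> (g has_real_derivative g' x) (at x)"
    and K: "\<And>x. \<bar>g' x\<bar> \<le> K"
  shows "\<bar>g x - g y\<bar> \<le> K * \<bar>x - y\<bar>"
proof -
  have *: "\<bar>g q - g p\<bar> \<le> K * (q - p)" if "p \<le> q" for p q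
    using has_integral_bound[of K g' "g q - g p" p q] has_integral_piecewise[OF assms(1,2) that] K that
      order_trans[OF abs_ge_zero K] by (simp add: abs_minus_commute)
  show ?thesis
    using *[of x y] *[of y x] by (cases "x \<le> y") (auto simp: abs_minus_commute)
qed

text \<open>The factor \<open>C\<close> jumps only at integers, where \<open>h\<close> vanishes. If
  \<open>s < t\<close> lie in different unit intervals, the integer
  \<open>\<lfloor>t\<rfloor>\<close> is between them and the two bounds from there add up. This
  makes the potential continuous although its coefficients jump.\<close>

lemma floor_mult_Lipschitz:
  fixes h :: "real \<Rightarrow> real" and C :: "int \<Rightarrow> real"
  assumes h: "\<And>s t. \<bar>h s - h t\<bar> \<le> K * \<bar>s - t\<bar>" and h0: "\<And>i. h (of_int i) = 0" and C: "\<And>i. \<bar>C i\<bar> \<le> 1"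
  shows "\<bar>C \<lfloor>s\<rfloor> * h s - C \<lfloor>t\<rfloor> * h t\<bar> \<le> K * \<bar>s - t\<bar>"
proof -
  have *: "\<bar>C \<lfloor>s\<rfloor> * h s - C \<lfloor>t\<rfloor> * h t\<bar> \<le> K * \<bar>s - t\<bar>" if "s \<le> t" for s t
  proof (cases "\<lfloor>s\<rfloor> = \<lfloor>t\<rfloor>")
    case True
    then have "C \<lfloor>s\<rfloor> * h s - C \<lfloor>t\<rfloor> * h t = C \<lfloor>t\<rfloor> * (h s - h t)" by (simp add: algebra_simps)
    then show ?thesis using abs_mult_le_mult[OF C h, of "\<lfloor>t\<rfloor>" s t] by simp
  next
    case False
    then have lt: "\<lfloor>s\<rfloor> < \<lfloor>t\<rfloor>" using floor_mono[OF that] by simp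
    then have "s < of_int \<lfloor>t\<rfloor>" by (simp add: floor_less_iff)
    moreover have "of_int \<lfloor>t\<rfloor> \<le> t" by simp
    ultimately have sum: "\<bar>s - of_int \<lfloor>t\<rfloor>\<bar> + \<bar>t - of_int \<lfloor>t\<rfloor>\<bar> = \<bar>s - t\<bar>" by linarith
    have "\<bar>h s\<bar> \<le> K * \<bar>s - of_int \<lfloor>t\<rfloor>\<bar>" "\<bar>h t\<bar> \<le> K * \<bar>t - of_int \<lfloor>t\<rfloor>\<bar>"
      using h[of s "of_int \<lfloor>t\<rfloor>"] h[of t "of_int \<lfloor>t\<rfloor>"] h0 by auto
    from abs_mult_le_mult[OF C this(1), of "\<lfloor>s\<rfloor>"] abs_mult_le_mult[OF C this(2), of "\<lfloor>t\<rfloor>"]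
    have "\<bar>C \<lfloor>s\<rfloor> * h s - C \<lfloor>t\<rfloor> * h t\<bar> \<le> K * \<bar>s - of_int \<lfloor>t\<rfloor>\<bar> + K * \<bar>t - of_int \<lfloor>t\<rfloor>\<bar>" by linarith
    also have "\<dots> = K * \<bar>s - t\<bar>" by (simp only: sum flip: distrib_left)
    finally show ?thesis .
  qed
  show ?thesis
    using *[of s t] *[of t s] by (cases "s \<le> t") (auto simp: abs_minus_commute)
qed

lemma continuous_of_Lipschitz:
  fixes g :: "real \<Rightarrow> real"
  assumes "\<And>s t. \<bar>g s - g t\<bar> \<le> K * \<bar>s - t\<bar>"
  shows "continuous_on UNIV g"
proof -
  have "0 \<le> K" using assms[of 0 1] by simp
  then have "K-lipschitz_on UNIV g" using assms by (auto simp: lipschitz_on_def dist_real_def)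
  then show ?thesis by (rule lipschitz_on_continuous_on)
qed

lemma tent_of_int [simp]: "tent (of_int i) = 0"
  by (simp add: tent_def)

lemma trap_of_int [simp]: "trap m (of_int i) = 0"
  by (simp add: trap_def)

lemma continuous_floor_tent:
  fixes C :: "int \<Rightarrow> real"
  assumes "\<And>i. \<bar>C i\<bar> \<le> 1"
  shows "continuous_on UNIV (\<lambda>s. C \<lfloor>s\<rfloor> * tent s)"
  using floor_mult_Lipschitz[of tent 1 C] tent_Lipschitz assms
  by (intro continuous_of_Lipschitz[where K=1]) auto

lemma continuous_floor_trap:
  fixes C :: "int \<Rightarrow> real"
  assumes "\<And>i. \<bar>C i\<bar> \<le> 1"
  shows "continuous_on UNIV (\<lambda>s. C \<lfloor>s\<rfloor> * trap m s)"
  using floor_mult_Lipschitz[of "trap m" "2^m" C] trap_Lipschitz assms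
  by (intro continuous_of_Lipschitz[where K="2^m"]) auto

lemma tent_formula: "tent t = (if rad t = 1 then t - of_int \<lfloor>t\<rfloor> else 1 - (t - of_int \<lfloor>t\<rfloor>))"
proof (cases "rad t = 1")
  case True
  then have "\<lfloor>2 * t\<rfloor> = 2 * \<lfloor>t\<rfloor>" using floor_double_eq(1)[of t "\<lfloor>t\<rfloor>"] by simp
  then have "2 * t < 2 * of_int \<lfloor>t\<rfloor> + 1" by linarith
  then show ?thesis using True by (simp add: tent_def frac_def)
next
  case False
  then have "rad t = - 1" by (auto simp: rad_def split: if_splits)
  then have "\<lfloor>2 * t\<rfloor> = 2 * \<lfloor>t\<rfloor> + 1" using floor_double_eq(2)[of t "\<lfloor>t\<rfloor>"] by simp
  then have "2 * t \<ge> 2 * of_int \<lfloor>t\<rfloor> + 1" by linarith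
  then show ?thesis using False by (simp add: tent_def frac_def)
qed

lemma floor_locally_constant:
  fixes s L :: real
  assumes "L > 0" "L * s \<notin> \<int>"
  obtains S where "open S" "s \<in> S" "\<And>t. t \<in> S \<Longrightarrow> \<lfloor>L * t\<rfloor> = \<lfloor>L * s\<rfloor>"
proof
  let ?S = "{of_int \<lfloor>L * s\<rfloor> / L <..< (of_int \<lfloor>L * s\<rfloor> + 1) / L}"
  show "open ?S" by simp
  have "of_int \<lfloor>L * s\<rfloor> < L * s" using assms(2) by (metis Ints_of_int less_le of_int_floor_le)
  moreover have "L * s < of_int \<lfloor>L * s\<rfloor> + 1" by linarith
  ultimately show "s \<in> ?S" using assms(1) by (simp add: field_simps)
  show "\<lfloor>L * t\<rfloor> = \<lfloor>L * s\<rfloor>" if "t \<in> ?S" for t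
    using that assms(1) by (simp add: floor_eq_iff field_simps)
qed

text \<open>Near \<open>s\<close> neither the floor nor the sign \<open>rad\<close> changes, so the
  function is affine there.\<close>

lemma floor_tent_deriv:
  fixes C :: "int \<Rightarrow> real"
  assumes "2 * s \<notin> \<int>"
  shows "((\<lambda>s. C \<lfloor>s\<rfloor> * tent s) has_real_derivative C \<lfloor>s\<rfloor> * rad s) (at s)"
proof -
  obtain S where S: "open S" "s \<in> S" "\<And>t. t \<in> S \<Longrightarrow> \<lfloor>2 * t\<rfloor> = \<lfloor>2 * s\<rfloor>"
    using floor_locally_constant[of 2 s] assms by auto
  have r: "rad t = rad s" "\<lfloor>t\<rfloor> = \<lfloor>s\<rfloor>" if "t \<in> S" for t
    using S(3)[OF that] floor_pow2_cong[of 1 t s 0] by (simp_all add: rad_def)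
  have r1: "rad s = 1 \<or> rad s = - 1" by (simp add: rad_def)
  have "((\<lambda>t. C \<lfloor>s\<rfloor> * (if rad s = 1 then t - of_int \<lfloor>s\<rfloor> else 1 - (t - of_int \<lfloor>s\<rfloor>))) has_real_derivative C \<lfloor>s\<rfloor> * rad s) (at s)"
    using r1 by (auto intro!: derivative_eq_intros)
  then show ?thesis
    by (rule has_field_derivative_transform_within_open[OF _ S(1,2)]) (simp add: r tent_formula)
qed

lemma trap_formula:
  assumes "m > 0"
  shows "trap m t = (if \<lfloor>2^m * t\<rfloor> mod 2^m = 0 then 2^m * (t - of_int \<lfloor>t\<rfloor>)
     else if \<lfloor>2^m * t\<rfloor> mod 2^m = 2^m - 1 then 2^m * (1 - (t - of_int \<lfloor>t\<rfloor>)) else 1)"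
proof -
  define f where "f = t - of_int \<lfloor>t\<rfloor>"
  have f: "0 \<le> f" "f < 1" unfolding f_def by linarith+
  have s: "2^m * t = 2^m * f + of_int (2^m * \<lfloor>t\<rfloor>)" by (simp add: f_def algebra_simps)
  have fl: "\<lfloor>2^m * t\<rfloor> = \<lfloor>2^m * f\<rfloor> + 2^m * \<lfloor>t\<rfloor>"
    unfolding s by (rule floor_add_int[symmetric])
  have "0 \<le> \<lfloor>2^m * f\<rfloor>" "\<lfloor>2^m * f\<rfloor> < 2^m"
    using f by (auto simp: floor_less_iff)
  then have md: "\<lfloor>2^m * t\<rfloor> mod 2^m = \<lfloor>2^m * f\<rfloor>" unfolding fl by simp
  have two: "(2::real) \<le> 2^m" using assms self_le_power[of "2::real" m] by simp
  have tent: "tent t = min f (1 - f)" by (simp add: tent_def frac_def f_def)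
  consider "\<lfloor>2^m * t\<rfloor> mod 2^m = 0" | "\<lfloor>2^m * t\<rfloor> mod 2^m \<noteq> 0" "\<lfloor>2^m * t\<rfloor> mod 2^m = 2^m - 1"
    | "\<lfloor>2^m * t\<rfloor> mod 2^m \<noteq> 0" "\<lfloor>2^m * t\<rfloor> mod 2^m \<noteq> 2^m - 1" by blast
  then show ?thesis
  proof cases
    case 1
    then have "2^m * f < 1" unfolding md by linarith
    moreover have "2 * f \<le> 2^m * f" using two f by (intro mult_right_mono) auto
    ultimately have "tent t = f" "2^m * f \<le> 1" unfolding tent by auto
    then show ?thesis using 1 by (simp add: trap_def flip: f_def)
  next
    case 2
    have "of_int \<lfloor>2^m * f\<rfloor> \<le> 2^m * f" by simp
    moreover have "of_int \<lfloor>2^m * f\<rfloor> = (2^m - 1 :: real)" using 2(2) unfolding md by simp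
    ultimately have "2^m * (1 - f) \<le> 1" unfolding right_diff_distrib by linarith
    moreover have "2 * (1 - f) \<le> 2^m * (1 - f)" using two f by (intro mult_right_mono) auto
    ultimately have "tent t = 1 - f" "2^m * (1 - f) \<le> 1" unfolding tent by auto
    then show ?thesis using 2 by (simp add: trap_def flip: f_def)
  next
    case 3
    then show ?thesis using trap_eq_1 by simp
  qed
qed

lemma floor_trap_deriv:
  fixes C :: "int \<Rightarrow> real"
  assumes "m > 0" "2^m * s \<notin> \<int>"
  shows "((\<lambda>s. C \<lfloor>s\<rfloor> * trap m s) has_real_derivative C \<lfloor>s\<rfloor> * dtrap m s) (at s)"
proof -
  obtain S where S: "open S" "s \<in> S" "\<And>t. t \<in> S \<Longrightarrow> \<lfloor>2^m * t\<rfloor> = \<lfloor>2^m * s\<rfloor>"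
    using floor_locally_constant[of "2^m" s] assms(2) by auto
  have r: "\<lfloor>t\<rfloor> = \<lfloor>s\<rfloor>" if "t \<in> S" for t
    using S(3)[OF that] floor_pow2_cong[of m t s 0] by simp
  have "((\<lambda>t. C \<lfloor>s\<rfloor> * (if \<lfloor>2^m * s\<rfloor> mod 2^m = 0 then 2^m * (t - of_int \<lfloor>s\<rfloor>)
     else if \<lfloor>2^m * s\<rfloor> mod 2^m = 2^m - 1 then 2^m * (1 - (t - of_int \<lfloor>s\<rfloor>)) else 1)) has_real_derivative C \<lfloor>s\<rfloor> * dtrap m s) (at s)"
    unfolding dtrap_def by (auto intro!: derivative_eq_intros)
  then show ?thesis
    by (rule has_field_derivative_transform_within_open[OF _ S(1,2)]) (simp add: r S(3) trap_formula[OF assms(1)])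
qed

text \<open>Division by \<open>2^k\<close> gives the tents x-slopes 1 and -1. In y the chain rule
  leaves \<open>2^Suc k / 2^k\<close>, the origin of the 2 in \<open>grad_y\<close>.\<close>

definition pot :: "nat \<Rightarrow> (nat \<Rightarrow> int \<Rightarrow> int \<Rightarrow> real) \<Rightarrow> nat \<Rightarrow> real \<times> real \<Rightarrow> real" where
  "pot m a n z = (\<Sum>k<n. coef a k z * (tent (2^k * fst z) / 2^k * trap m (2^Suc k * snd z)))"

lemma pot_x:
  assumes a: "\<And>k i j. \<bar>a k i j\<bar> \<le> 1"
  shows "continuous_on UNIV (\<lambda>x. pot m a n (x, y))"
    and "x \<notin> dyadic n \<Longrightarrow> ((\<lambda>x. pot m a n (x, y)) has_real_derivative haar_sum (trap m) a n (x, y)) (at x)"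
proof -
  let ?C = "\<lambda>k i. a k i \<lfloor>2^Suc k * y\<rfloor>"
  have eq: "pot m a n (x, y) = (\<Sum>k<n. (?C k \<lfloor>2^k * x\<rfloor> * tent (2^k * x)) * (trap m (2^Suc k * y) / 2^k))" for x
    by (simp add: pot_def coef_def mult.assoc)
  have "continuous_on UNIV (\<lambda>x. ?C k \<lfloor>2^k * x\<rfloor> * tent (2^k * x))" for k
    using continuous_on_compose2[OF continuous_floor_tent[of "?C k"], of UNIV "\<lambda>x. 2^k * x"] a
    by (auto intro!: continuous_intros)
  then show "continuous_on UNIV (\<lambda>x. pot m a n (x, y))"
    unfolding eq by (intro continuous_on_sum continuous_on_mult_right)
  assume x: "x \<notin> dyadic n"
  have "((\<lambda>x. (?C k \<lfloor>2^k * x\<rfloor> * tent (2^k * x)) * (trap m (2^Suc k * y) / 2^k)) has_real_derivative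
      coef a k (x, y) * (rad (2^k * x) * trap m (2^Suc k * y))) (at x)" if "k < n" for k
  proof -
    have "2 * (2^k * x) \<notin> \<int>" using dyadic_mono[of "Suc k" x n] x that by (auto simp: mult.assoc)
    then have "((\<lambda>x. ?C k \<lfloor>2^k * x\<rfloor> * tent (2^k * x)) has_real_derivative ?C k \<lfloor>2^k * x\<rfloor> * rad (2^k * x) * 2^k) (at x)"
      by (intro DERIV_chain2[where f="\<lambda>s. ?C k \<lfloor>s\<rfloor> * tent s" and g="\<lambda>x. 2^k * x"] floor_tent_deriv)
        (auto intro!: derivative_eq_intros)
    from DERIV_cmult_right[OF this, of "trap m (2^Suc k * y) / 2^k"]
    show ?thesis by (simp add: coef_def mult.assoc)
  qed
  then show "((\<lambda>x. pot m a n (x, y)) has_real_derivative haar_sum (trap m) a n (x, y)) (at x)"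
    unfolding eq haar_sum_def by (intro DERIV_sum) simp
qed

lemma pot_y:
  assumes a: "\<And>k i j. \<bar>a k i j\<bar> \<le> 1" and m: "m > 0"
  shows "continuous_on UNIV (\<lambda>y. pot m a n (x, y))"
    and "y \<notin> dyadic (n + m) \<Longrightarrow> ((\<lambda>y. pot m a n (x, y)) has_real_derivative grad_y m a n (x, y)) (at y)"
proof -
  let ?C = "\<lambda>k j. a k \<lfloor>2^k * x\<rfloor> j"
  have eq: "pot m a n (x, y) = (\<Sum>k<n. (?C k \<lfloor>2^Suc k * y\<rfloor> * trap m (2^Suc k * y)) * (tent (2^k * x) / 2^k))" for y
    by (simp add: pot_def coef_def ac_simps)
  have "continuous_on UNIV (\<lambda>y. ?C k \<lfloor>2^Suc k * y\<rfloor> * trap m (2^Suc k * y))" for k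
    using continuous_on_compose2[OF continuous_floor_trap[of "?C k" m], of UNIV "\<lambda>y. 2^Suc k * y"] a
    by (auto intro!: continuous_intros)
  then show "continuous_on UNIV (\<lambda>y. pot m a n (x, y))"
    unfolding eq by (intro continuous_on_sum continuous_on_mult_right)
  assume y: "y \<notin> dyadic (n + m)"
  have "((\<lambda>y. (?C k \<lfloor>2^Suc k * y\<rfloor> * trap m (2^Suc k * y)) * (tent (2^k * x) / 2^k)) has_real_derivative
      coef a k (x, y) * (2 * tent (2^k * x) * dtrap m (2^Suc k * y))) (at y)" if "k < n" for k
  proof -
    \<comment> \<open>In y, level \<open>k\<close> breaks only at multiples of
      \<open>2^-(m + Suc k)\<close>, and \<open>k < n\<close> puts these into the grid of level
      \<open>n + m\<close>.\<close>
    have "2^m * (2^Suc k * y) = 2^(m + Suc k) * y" by (simp add: power_add)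
    then have "2^m * (2^Suc k * y) \<notin> \<int>" using dyadic_mono[of "m + Suc k" y "n + m"] y that
      by (metis Suc_leI add.commute add_le_mono1)
    then have "((\<lambda>y. ?C k \<lfloor>2^Suc k * y\<rfloor> * trap m (2^Suc k * y)) has_real_derivative ?C k \<lfloor>2^Suc k * y\<rfloor> * dtrap m (2^Suc k * y) * 2^Suc k) (at y)"
      by (intro DERIV_chain2[where f="\<lambda>s. ?C k \<lfloor>s\<rfloor> * trap m s" and g="\<lambda>y. 2^Suc k * y"] floor_trap_deriv m)
        (auto intro!: derivative_eq_intros)
    from DERIV_cmult_right[OF this, of "tent (2^k * x) / 2^k"]
    show ?thesis by (simp add: coef_def ac_simps)
  qed
  then show "((\<lambda>y. pot m a n (x, y)) has_real_derivative grad_y m a n (x, y)) (at y)"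
    unfolding eq grad_y_def by (intro DERIV_sum) simp
qed

text \<open>A nonzero coefficient places \<open>z\<close> in the half-open square. If
  \<open>z\<close> is not in the open one, a coordinate is 0, where the tent or the trapezoid
  vanishes.\<close>

lemma pot_outside:
  assumes supp: "\<And>k i j. a k i j \<noteq> 0 \<Longrightarrow> 0 \<le> i \<and> i < 2^k \<and> 0 \<le> j \<and> j < 2^Suc k"
    and z: "z \<notin> {0<..<1} \<times> {0<..<1}"
  shows "pot m a n z = 0"
proof -
  have zero: "coef a k z * (tent (2^k * fst z) / 2^k * trap m (2^Suc k * snd z)) = 0" for k
  proof (cases "coef a k z = 0")
    case False
    then have fl: "0 \<le> \<lfloor>2^k * fst z\<rfloor>" "\<lfloor>2^k * fst z\<rfloor> < 2^k" "0 \<le> \<lfloor>2^Suc k * snd z\<rfloor>" "\<lfloor>2^Suc k * snd z\<rfloor> < 2^Suc k"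
      using supp unfolding coef_def by blast+
    have b: "0 \<le> x \<and> x < 1" if "0 \<le> \<lfloor>2^l * x\<rfloor>" "\<lfloor>2^l * x\<rfloor> < 2^l" for x :: real and l
    proof -
      have "0 \<le> 2^l * x" "2^l * x < 2^l" using that by (simp, simp add: floor_less_iff)
      moreover from this have "0 \<le> x" using mult_pos_neg[of "2^l" x] by (cases "x < 0") auto
      ultimately show ?thesis by simp
    qed
    have "fst z = 0 \<or> snd z = 0"
      using b[OF fl(1,2)] b[OF fl(3,4)] z by (cases z) auto
    then show ?thesis using tent_of_int[of 0] trap_of_int[of m 0] by auto
  qed simp
  show ?thesis unfolding pot_def zero by simp
qed

text \<open>The measure with density \<open>g'\<close>, pushed forward by \<open>g\<close>, agrees
  with Lebesgue measure on intervals by the fundamental theorem of calculus, hence on all Borel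
  sets. The inverse of \<open>g\<close> is monotone, so images of Borel sets are Borel.\<close>

lemma emeasure_image_piecewise:
  fixes g g' :: "real \<Rightarrow> real"
  assumes cont: "continuous_on UNIV g" and der: "\<And>x. x \<notin> dyadic n \<Longrightarrow> (g has_real_derivative g' x) (at x)"
    and [measurable]: "g' \<in> borel_measurable borel" and pos: "\<And>x. 0 \<le> g' x"
    and mono: "strict_mono g" and surj: "surj g" and [measurable]: "B \<in> sets borel"
  shows "emeasure lborel (g ` B) = (\<integral>\<^sup>+x. ennreal (g' x) * indicator B x \<partial>lborel)"
proof -
  have inj: "inj g" using mono by (rule strict_mono_imp_inj_on)
  have [measurable]: "g \<in> borel_measurable borel" using cont by (rule borel_measurable_continuous_onI)
  let ?M = "distr (density lborel (\<lambda>x. ennreal (g' x))) borel g"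
  have "lborel = ?M"
  proof (rule lborel_eqI)
    fix l u :: real assume "\<And>b. b \<in> Basis \<Longrightarrow> l \<bullet> b \<le> u \<bullet> b"
    then have lu: "l \<le> u" by simp
    obtain p q where pq: "g p = l" "g q = u" using surj by (metis surjD)
    have pq': "p \<le> q" using lu pq mono by (metis strict_mono_less_eq)
    have "g -` {l<..<u} = {p<..<q}"
      using pq mono by (auto simp: strict_mono_less)
    then have "emeasure ?M (box l u) = (\<integral>\<^sup>+x. ennreal (g' x) * indicator {p<..<q} x \<partial>lborel)"
      by (simp add: emeasure_distr emeasure_density box_real)
    also have "\<dots> = (\<integral>\<^sup>+x. indicator {p..q} x * ennreal (g' x) \<partial>lborel)"
    proof (intro nn_integral_cong_AE)
      have "AE x in lborel. x \<noteq> p \<and> x \<noteq> q" using AE_lborel_singleton[of p] AE_lborel_singleton[of q] by eventually_elim simp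
      then show "AE x in lborel. ennreal (g' x) * indicator {p<..<q} x = indicator {p..q} x * ennreal (g' x)"
        by eventually_elim (auto simp: indicator_def)
    qed
    also have "\<dots> = ennreal (u - l)"
      using nn_integral_has_integral_lebesgue[OF pos has_integral_piecewise[OF cont der pq']] pq
      by (simp add: ennreal_mult' ennreal_indicator nn_integral_completion)
    finally show "emeasure ?M (box l u) = ennreal (\<Prod>b\<in>Basis. (u - l) \<bullet> b)" by simp
  qed simp
  moreover have [measurable]: "g ` B \<in> sets borel"
  proof -
    have "mono (inv g)"
      using mono surj by (intro monoI) (metis strict_mono_less_eq surj_f_inv_f)
    then have "inv g \<in> borel_measurable borel" by (rule borel_measurable_mono)
    then have "inv g -` B \<inter> space borel \<in> sets borel" by (rule measurable_sets) simp
    moreover have "g ` B = inv g -` B" using inj surj by (auto simp: image_iff) (metis surj_f_inv_f)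
    ultimately show ?thesis by simp
  qed
  ultimately have "emeasure lborel (g ` B) = emeasure ?M (g ` B)" by simp
  also have "\<dots> = emeasure (density lborel (\<lambda>x. ennreal (g' x))) (g -` (g ` B))"
    by (simp add: emeasure_distr)
  also have "g -` (g ` B) = B" using inj by (rule inj_vimage_image_eq)
  finally show ?thesis by (simp add: emeasure_density)
qed

section \<open>Bi-Lipschitz shears\<close>

text \<open>Maps of the whole plane compose freely; fixing every point off the open square yields
  both the boundary condition and the invariance of the square.\<close>

definition bilip :: "real \<Rightarrow> (real \<times> real \<Rightarrow> real \<times> real) \<Rightarrow> bool" where
  "bilip C \<phi> \<longleftrightarrow> bij \<phi> \<and> (\<forall>p q. dist p q \<le> C * dist (\<phi> p) (\<phi> q) \<and> dist (\<phi> p) (\<phi> q) \<le> C * dist p q) \<and>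
     (\<forall>p. p \<notin> {0<..<1} \<times> {0<..<1} \<longrightarrow> \<phi> p = p)"

lemma bilipD:
  assumes "bilip C \<phi>"
  shows "bij \<phi>" "dist p q \<le> C * dist (\<phi> p) (\<phi> q)" "dist (\<phi> p) (\<phi> q) \<le> C * dist p q"
    "p \<notin> {0<..<1} \<times> {0<..<1} \<Longrightarrow> \<phi> p = p"
  using assms unfolding bilip_def by blast+

lemma bilip_id: "bilip 1 id"
  by (simp add: bilip_def)

lemma bilip_comp:
  assumes "bilip C \<phi>" "bilip D \<psi>" "0 \<le> C" "0 \<le> D"
  shows "bilip (C * D) (\<psi> \<circ> \<phi>)"
  unfolding bilip_def
proof (intro conjI allI impI)
  show "bij (\<psi> \<circ> \<phi>)" by (rule bij_comp[OF bilipD(1)[OF assms(1)] bilipD(1)[OF assms(2)]])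
  fix p q
  have "dist p q \<le> C * dist (\<phi> p) (\<phi> q)" by (rule bilipD(2)[OF assms(1)])
  also have "\<dots> \<le> C * (D * dist (\<psi> (\<phi> p)) (\<psi> (\<phi> q)))"
    by (rule mult_left_mono[OF bilipD(2)[OF assms(2)] assms(3)])
  finally show "dist p q \<le> C * D * dist ((\<psi> \<circ> \<phi>) p) ((\<psi> \<circ> \<phi>) q)" by (simp add: mult.assoc)
  have "dist (\<psi> (\<phi> p)) (\<psi> (\<phi> q)) \<le> D * dist (\<phi> p) (\<phi> q)" by (rule bilipD(3)[OF assms(2)])
  also have "\<dots> \<le> D * (C * dist p q)"
    by (rule mult_left_mono[OF bilipD(3)[OF assms(1)] assms(4)])
  finally show "dist ((\<psi> \<circ> \<phi>) p) ((\<psi> \<circ> \<phi>) q) \<le> C * D * dist p q" by (simp add: ac_simps)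
next
  fix p :: "real \<times> real" assume "p \<notin> {0<..<1} \<times> {0<..<1}"
  then show "(\<psi> \<circ> \<phi>) p = p" using bilipD(4)[OF assms(1)] bilipD(4)[OF assms(2)] by simp
qed

text \<open>A bijection that fixes the complement of \<open>S\<close> pointwise maps
  \<open>S\<close> onto itself. It is applied to the half-open square, where the measure lives, and
  to the closed one.\<close>

lemma bilip_image_superset:
  assumes "bilip C \<phi>" "{0<..<1} \<times> {0<..<1} \<subseteq> S"
  shows "\<phi> ` S = S"
proof -
  have bij: "bij \<phi>" by (rule bilipD(1)[OF assms(1)])
  have fix': "\<phi> p = p" if "p \<notin> S" for p using bilipD(4)[OF assms(1)] assms(2) that by blast
  have "\<phi> ` (- S) = - S" using fix' by (auto simp: image_iff)
  then have "- (\<phi> ` S) = - S" using bij_image_Compl_eq[OF bij, of S] by simp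
  then show ?thesis by blast
qed

text \<open>The inverse is Lipschitz, and an image is a preimage under the inverse.\<close>

lemma bilip_image_borel:
  assumes "bilip C \<phi>" "A \<in> sets borel"
  shows "\<phi> ` A \<in> sets borel"
proof -
  note bij = bilipD(1)[OF assms(1)] and C = bilipD(2)[OF assms(1)]
  have C0: "0 \<le> C"
  proof -
    have "0 < dist (0 :: real \<times> real) (1, 0)" by (simp add: dist_prod_def)
    then have "0 < C * dist (\<phi> 0) (\<phi> (1, 0))" using C less_le_trans by blast
    then show ?thesis by (meson less_imp_le zero_le_dist not_less mult_nonpos_nonneg order.strict_trans2 order.asym)
  qed
  have "C-lipschitz_on UNIV (inv \<phi>)"
    using C[of "inv \<phi> _" "inv \<phi> _"] bij C0 by (auto simp: lipschitz_on_def bij_is_surj surj_f_inv_f)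
  then have "continuous_on UNIV (inv \<phi>)" by (rule lipschitz_on_continuous_on)
  then have "inv \<phi> \<in> borel_measurable borel" by (rule borel_measurable_continuous_onI)
  then have "inv \<phi> -` A \<inter> space borel \<in> sets borel" using assms(2) by (rule measurable_sets)
  moreover have "\<phi> ` A = inv \<phi> -` A" using bij
    by (auto simp: image_iff bij_is_inj inv_f_f) (metis bij_is_surj surj_f_inv_f)
  ultimately show ?thesis by simp
qed

definition shear :: "real \<Rightarrow> (real \<times> real \<Rightarrow> real) \<Rightarrow> real \<times> real \<Rightarrow> real \<times> real" where
  "shear t u z = (fst z + t * u z, snd z)"

text \<open>A perturbation with Lipschitz constant 1/4 cannot destroy monotonicity. It vanishes off
  the open unit interval, so the endpoints stay fixed and the intermediate value theorem fills the
  inside.\<close>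

lemma shear_fiber:
  fixes u :: "real \<times> real \<Rightarrow> real"
  assumes cont: "continuous_on UNIV (\<lambda>x. u (x, y))"
    and Lip: "\<And>x x'. \<bar>t * u (x, y) - t * u (x', y)\<bar> \<le> \<bar>x - x'\<bar> / 4"
    and out: "\<And>x. x \<notin> {0<..<1} \<Longrightarrow> u (x, y) = 0"
  shows "strict_mono (\<lambda>x. x + t * u (x, y))" "surj (\<lambda>x. x + t * u (x, y))"
proof -
  let ?g = "\<lambda>x::real. x + t * u (x, y)"
  show "strict_mono ?g"
  proof (rule strict_monoI)
    fix x x' :: real assume "x < x'"
    have "x + p < x' + q" if "\<bar>p - q\<bar> \<le> \<bar>x - x'\<bar> / 4" for p q
      using that \<open>x < x'\<close> by (simp add: abs_if split: if_splits)
    from this[OF Lip] show "?g x < ?g x'" .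
  qed
  show "surj ?g"
    unfolding surj_def
  proof
    fix v
    show "\<exists>x. v = ?g x"
    proof (cases "v \<in> {0<..<1}")
      case True
      have "continuous_on {0..1} ?g"
        using continuous_on_subset[OF cont] by (intro continuous_intros) auto
      then show ?thesis
        using IVT'[of ?g 0 v 1] True out[of 0] out[of 1] by force
    next
      case False
      then show ?thesis using out[of v] by (intro exI[of _ v]) simp
    qed
  qed
qed

text \<open>The two bounds 1/4 let displacements differ by at most half the distance, so distances
  change by a factor between 1/2 and 3/2.\<close>

lemma shear_bilip:
  assumes cont: "\<And>y. continuous_on UNIV (\<lambda>x. u (x, y))"
    and Lx: "\<And>x x' y. \<bar>t * u (x, y) - t * u (x', y)\<bar> \<le> \<bar>x - x'\<bar> / 4"
    and Ly: "\<And>x y y'. \<bar>t * u (x, y) - t * u (x, y')\<bar> \<le> \<bar>y - y'\<bar> / 4"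
    and out: "\<And>z. z \<notin> {0<..<1} \<times> {0<..<1} \<Longrightarrow> u z = 0"
  shows "bilip 2 (shear t u)"
  unfolding bilip_def
proof (intro conjI allI impI)
  have fib: "strict_mono (\<lambda>x. x + t * u (x, y))" "surj (\<lambda>x. x + t * u (x, y))" for y
    by (rule shear_fiber; use cont Lx out in auto)+
  show "bij (shear t u)"
  proof (rule bijI)
    show "inj (shear t u)"
    proof (rule injI)
      fix z w assume eq: "shear t u z = shear t u w"
      obtain x y x' y' where zw: "z = (x, y)" "w = (x', y')" by fastforce
      have y: "y = y'" and x: "x + t * u (x, y) = x' + t * u (x', y)" using eq by (auto simp: shear_def zw)
      have "x = x'" by (rule injD[OF strict_mono_imp_inj_on[OF fib(1)] x])
      then show "z = w" using y zw by simp
    qed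
    show "surj (shear t u)"
      unfolding surj_def
    proof
      fix w :: "real \<times> real"
      obtain x where "fst w = x + t * u (x, snd w)" using surjD[OF fib(2)[of "snd w"], of "fst w"] ..
      then have "w = shear t u (x, snd w)" by (simp add: shear_def prod_eq_iff)
      then show "\<exists>z. w = shear t u z" ..
    qed
  qed
  fix p q :: "real \<times> real"
  let ?e = "t * u p - t * u q"
  have "\<bar>?e\<bar> \<le> \<bar>fst p - fst q\<bar> / 4 + \<bar>snd p - snd q\<bar> / 4"
  proof -
    have tri: "\<bar>a - c\<bar> \<le> r + s" if "\<bar>a - b\<bar> \<le> r" "\<bar>b - c\<bar> \<le> s" for a b c r s :: real
      using that by linarith
    from tri[OF Lx[of "fst p" "snd p" "fst q"] Ly[of "fst q" "snd p" "snd q"]] show ?thesis by simp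
  qed
  also have "\<dots> \<le> dist p q / 2"
    using real_sqrt_sum_squares_ge1[of "fst p - fst q" "snd p - snd q"]
      real_sqrt_sum_squares_ge2[of "snd p - snd q" "fst p - fst q"]
      dist_fst_le[of p q] dist_snd_le[of p q] by (simp add: dist_real_def)
  finally have e: "norm (?e, 0::real) \<le> norm (p - q) / 2" by (simp add: norm_Pair dist_norm)
  have "shear t u p - shear t u q = (p - q) + (?e, 0)"
    by (simp add: shear_def prod_eq_iff algebra_simps)
  then have "norm (shear t u p - shear t u q) \<le> norm (p - q) + norm (?e, 0::real)"
    "norm (p - q) - norm (?e, 0::real) \<le> norm (shear t u p - shear t u q)"
    using norm_triangle_ineq[of "p - q" "(?e, 0)"] norm_diff_ineq[of "p - q" "(?e, 0)"] by simp_all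
  then show "dist p q \<le> 2 * dist (shear t u p) (shear t u q)" "dist (shear t u p) (shear t u q) \<le> 2 * dist p q"
    using e norm_ge_zero[of "p - q"] unfolding dist_norm by linarith+
next
  fix p :: "real \<times> real" assume "p \<notin> {0<..<1} \<times> {0<..<1}"
  then show "shear t u p = p" using out by (simp add: shear_def)
qed

text \<open>Cavalieri: on each horizontal line the shear is a one-dimensional map with derivative
  \<open>1 + t * v\<close>, and the lengths of the slices are integrated over y.\<close>

lemma measure_shear_image:
  fixes u v :: "real \<times> real \<Rightarrow> real"
  assumes bl: "bilip 2 (shear t u)"
    and cont: "\<And>y. continuous_on UNIV (\<lambda>x. u (x, y))"
    and der: "\<And>x y. x \<notin> dyadic n \<Longrightarrow> ((\<lambda>x. u (x, y)) has_real_derivative v (x, y)) (at x)"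
    and Lx: "\<And>x x' y. \<bar>t * u (x, y) - t * u (x', y)\<bar> \<le> \<bar>x - x'\<bar> / 4"
    and out: "\<And>z. z \<notin> {0<..<1} \<times> {0<..<1} \<Longrightarrow> u z = 0"
    and v[measurable]: "v \<in> borel_measurable borel" and tv: "\<And>z. \<bar>t * v z\<bar> \<le> 1"
    and A[measurable]: "A \<in> sets borel" and sub: "A \<subseteq> {0..<1} \<times> {0..<1}"
  shows "measure lborel (shear t u ` A) = measure (unif \<Otimes>\<^sub>M unif) A + t * (\<integral>z. indicator A z * v z \<partial>(unif \<Otimes>\<^sub>M unif))"
proof -
  let ?M = "unif \<Otimes>\<^sub>M unif"
  let ?w = "\<lambda>z. 1 + t * v z"
  have w0: "0 \<le> ?w z" for z using tv[of z] by linarith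
  have "shear t u ` A \<in> sets (lborel \<Otimes>\<^sub>M lborel)"
    using bilip_image_borel[OF bl A] by (simp only: lborel_prod sets_lborel)
  then have "emeasure (lborel \<Otimes>\<^sub>M lborel) (shear t u ` A) = (\<integral>\<^sup>+y. emeasure lborel ((\<lambda>x. (x, y)) -` (shear t u ` A)) \<partial>lborel)"
    by (rule lborel_pair.emeasure_pair_measure_alt2)
  also have "\<dots> = (\<integral>\<^sup>+y. \<integral>\<^sup>+x. ennreal (?w (x, y)) * indicator A (x, y) \<partial>lborel \<partial>lborel)"
  proof (intro nn_integral_cong)
    fix y :: real
    have Pair_y: "(\<lambda>x::real. (x, y)) \<in> borel_measurable borel"
      by (intro borel_measurable_continuous_onI continuous_intros)
    have "(\<lambda>x. (x, y)) -` A \<inter> space borel \<in> sets borel" by (rule measurable_sets[OF Pair_y A])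
    then have Ay: "(\<lambda>x. (x, y)) -` A \<in> sets borel" by simp
    have "(\<lambda>x. (x, y)) -` (shear t u ` A) = (\<lambda>x. x + t * u (x, y)) ` ((\<lambda>x. (x, y)) -` A)"
      by (force simp: shear_def image_iff)
    also have "emeasure lborel \<dots> = (\<integral>\<^sup>+x. ennreal (?w (x, y)) * indicator ((\<lambda>x. (x, y)) -` A) x \<partial>lborel)"
    proof (rule emeasure_image_piecewise)
      show "((\<lambda>x. x + t * u (x, y)) has_real_derivative ?w (x, y)) (at x)" if "x \<notin> dyadic n" for x
        using der[OF that, of y] by (auto intro!: derivative_eq_intros)
      show "strict_mono (\<lambda>x. x + t * u (x, y))" "surj (\<lambda>x. x + t * u (x, y))"
        by (rule shear_fiber; use cont Lx out in auto)+
    qed (use cont w0 Ay in \<open>auto intro!: continuous_intros\<close>)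
    finally show "emeasure lborel ((\<lambda>x. (x, y)) -` (shear t u ` A)) = (\<integral>\<^sup>+x. ennreal (?w (x, y)) * indicator A (x, y) \<partial>lborel)"
      by (simp add: indicator_vimage[symmetric] indicator_def)
  qed
  also have "\<dots> = (\<integral>\<^sup>+z. ennreal (?w z) * indicator A z \<partial>lborel)"
    unfolding lborel_prod[symmetric]
    by (subst lborel_pair.nn_integral_snd[symmetric]) (simp_all add: lborel_prod)
  also have "\<dots> = (\<integral>\<^sup>+z. indicator ({0..<1} \<times> {0..<1}) z * (ennreal (?w z) * indicator A z) \<partial>lborel)"
    using sub by (intro nn_integral_cong) (auto simp: indicator_def)
  also have "\<dots> = (\<integral>\<^sup>+z. ennreal (?w z) * indicator A z \<partial>?M)"
    unfolding unif2_eq by (subst nn_integral_density) simp_all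
  also have "\<dots> = (\<integral>\<^sup>+z. ennreal (?w z * indicator A z) \<partial>?M)"
    by (intro nn_integral_cong) (auto simp: indicator_def)
  also have "\<dots> = ennreal (\<integral>z. ?w z * indicator A z \<partial>?M)"
  proof (rule nn_integral_eq_integral)
    have b: "\<bar>?w z\<bar> \<le> 2" for z using tv[of z] by linarith
    show "integrable ?M (\<lambda>z. ?w z * indicator A z)"
    proof (rule integrable_unif2[where K=2])
      show "\<bar>?w z * indicator A z\<bar> \<le> 2" for z using b[of z] by (simp add: indicator_def)
    qed measurable
  qed (use w0 in auto)
  finally have "measure lborel (shear t u ` A) = (\<integral>z. ?w z * indicator A z \<partial>?M)"
    using w0 by (simp add: measure_def lborel_prod)
  also have "\<dots> = (\<integral>z. indicator A z + t * v z * indicator A z \<partial>?M)"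
    by (simp add: distrib_right)
  also have "\<dots> = measure ?M A + (\<integral>z. t * v z * indicator A z \<partial>?M)"
  proof (subst Bochner_Integration.integral_add)
    show "integrable ?M (indicator A :: _ \<Rightarrow> real)" by (rule integrable_unif2[where K=1]) simp_all
    show "integrable ?M (\<lambda>z. t * v z * indicator A z)"
    proof (rule integrable_unif2[where K=1])
      show "\<bar>t * v z * indicator A z\<bar> \<le> 1" for z using tv[of z] by (simp add: indicator_def)
    qed measurable
  qed simp
  also have "(\<integral>z. t * v z * indicator A z \<partial>?M) = t * (\<integral>z. indicator A z * v z \<partial>?M)"
    by (simp add: ac_simps)
  finally show ?thesis .
qed

section \<open>Gaining area\<close>

lemma measure_unif2:
  assumes [measurable]: "A \<in> sets borel" and sub: "A \<subseteq> {0..<1} \<times> {0..<1}"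
  shows "measure (unif \<Otimes>\<^sub>M unif) A = measure lborel A"
proof -
  have "emeasure (unif \<Otimes>\<^sub>M unif) A = (\<integral>\<^sup>+z. indicator ({0..<1} \<times> {0..<1}) z * indicator A z \<partial>lborel)"
    unfolding unif2_eq by (subst emeasure_density) simp_all
  also have "\<dots> = (\<integral>\<^sup>+z. indicator A z \<partial>lborel)"
    using sub by (intro nn_integral_cong) (auto simp: indicator_def)
  also have "\<dots> = emeasure lborel A" by simp
  finally show ?thesis by (simp add: measure_def)
qed

lemma gain_x:
  assumes A[measurable]: "A \<in> sets borel" and sub: "A \<subseteq> {0..<1} \<times> {0..<1}" and c: "c = measure lborel A"
    and en: "c * (1 - c) / 3 \<le> (\<Sum>k<N. haar_energy k (\<lambda>z. indicator A z - c))"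
  shows "\<exists>\<phi>. bilip 2 \<phi> \<and> c + c * (1 - c) / 2592000 \<le> measure lborel (\<phi> ` A)"
proof -
  let ?M = "unif \<Otimes>\<^sub>M unif"
  define f where "f = (\<lambda>z. indicator A z - c)"
  have cM: "c = measure ?M A" using measure_unif2[OF A sub] c by simp
  have c01: "0 \<le> c" "c \<le> 1" unfolding cM by simp_all
  have [measurable]: "f \<in> borel_measurable borel" unfolding f_def by measurable
  have f1: "\<bar>f z\<bar> \<le> 1" for z using c01 by (simp add: f_def indicator_def)
  have "bounded A" using sub by (rule bounded_subset[rotated]) (intro bounded_Times bounded_subset[OF bounded_closed_interval[of 0 1]]; auto)
  from exists_haar_energy(1)[OF A this cM f_def]
  have E: "c * (1 - c) = (\<integral>z. (f z)\<^sup>2 \<partial>?M)" by simp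
  obtain a where a1: "\<And>k i j. \<bar>a k i j\<bar> \<le> 1"
    and supp: "\<And>k i j. a k i j \<noteq> 0 \<Longrightarrow> 0 \<le> i \<and> i < 2^k \<and> 0 \<le> j \<and> j < 2^Suc k"
    and bd: "\<And>z. \<bar>haar_sum (trap 9) a N z\<bar> \<le> 6000 \<and> \<bar>grad_y 9 a N z\<bar> \<le> 6000"
    and gain: "c * (1 - c) / 108 \<le> (\<integral>z. f z * haar_sum (trap 9) a N z \<partial>?M)"
    using exists_gain_field[OF _ f1 E, of N] en unfolding f_def[symmetric] by auto
  \<comment> \<open>The gradient bound 6000 becomes the slope 1/4 that \<open>shear_bilip\<close>
    requires, and \<open>108 * 24000 = 2592000\<close>.\<close>
  define t :: real where "t = 1 / 24000"
  define u v where "u = pot 9 a N" and "v = haar_sum (trap 9) a N"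
  have cont: "continuous_on UNIV (\<lambda>x. u (x, y))" for y
    unfolding u_def by (rule pot_x(1)) (rule a1)
  have der: "((\<lambda>x. u (x, y)) has_real_derivative v (x, y)) (at x)" if "x \<notin> dyadic N" for x y
    unfolding u_def v_def using a1 that by (rule pot_x(2))
  have v6: "\<bar>v z\<bar> \<le> 6000" for z using bd by (simp add: v_def)
  have Lx: "\<bar>t * u (x, y) - t * u (x', y)\<bar> \<le> \<bar>x - x'\<bar> / 4" for x x' y
  proof -
    have "\<bar>u (x, y) - u (x', y)\<bar> \<le> 6000 * \<bar>x - x'\<bar>"
      by (rule Lipschitz_piecewise[OF cont der v6])
    then show ?thesis by (simp add: t_def flip: diff_divide_distrib)
  qed
  have Ly: "\<bar>t * u (x, y) - t * u (x, y')\<bar> \<le> \<bar>y - y'\<bar> / 4" for x y y'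
  proof -
    have "\<bar>u (x, y) - u (x, y')\<bar> \<le> 6000 * \<bar>y - y'\<bar>"
      unfolding u_def
    proof (rule Lipschitz_piecewise)
      show "continuous_on UNIV (\<lambda>y. pot 9 a N (x, y))" by (rule pot_y(1)) (simp_all add: a1)
      show "((\<lambda>y. pot 9 a N (x, y)) has_real_derivative grad_y 9 a N (x, y)) (at y)" if "y \<notin> dyadic (N + 9)" for y
        by (rule pot_y(2)) (simp_all add: a1 that)
      show "\<bar>grad_y 9 a N (x, y)\<bar> \<le> 6000" for y using bd by simp
    qed
    then show ?thesis by (simp add: t_def flip: diff_divide_distrib)
  qed
  have out: "u z = 0" if "z \<notin> {0<..<1} \<times> {0<..<1}" for z
    unfolding u_def using supp that by (rule pot_outside)
  have bl: "bilip 2 (shear t u)"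
    by (rule shear_bilip) (use cont Lx Ly out in blast)+
  have [measurable]: "v \<in> borel_measurable borel" unfolding v_def by measurable
  have tv: "\<bar>t * v z\<bar> \<le> 1" for z using v6[of z] by (simp add: t_def)
  have img: "measure lborel (shear t u ` S) = measure ?M S + t * (\<integral>z. indicator S z * v z \<partial>?M)"
    if "S \<in> sets borel" "S \<subseteq> {0..<1} \<times> {0..<1}" for S
    using bl cont der Lx out _ tv that by (rule measure_shear_image) measurable
  have iv: "integrable ?M v" using v6 by (intro integrable_unif2) auto
  \<comment> \<open>The shear maps the half-open square onto itself, so it cannot change its area.\<close>
  have v0: "(\<integral>z. v z \<partial>?M) = 0"
  proof -
    let ?Q = "{0..<1::real} \<times> {0..<1::real}"
    have "shear t u ` ?Q = ?Q" by (rule bilip_image_superset[OF bl]) auto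
    with img[OF Ico2_borel] have "t * (\<integral>z. indicator ?Q z * v z \<partial>?M) = 0"
      using measure_unif2[OF Ico2_borel] by simp
    moreover have "(\<integral>z. indicator ?Q z * v z \<partial>?M) = (\<integral>z. v z \<partial>?M)"
    proof (rule integral_cong_AE)
      show "AE z in ?M. indicator ?Q z * v z = v z"
        using AE_unif2 by eventually_elim (auto simp: indicator_def mem_Times_iff)
    qed measurable
    ultimately show ?thesis by (simp add: t_def)
  qed
  have iA: "integrable ?M (\<lambda>z. indicator A z * v z)"
  proof (rule integrable_unif2[where K=6000])
    show "\<bar>indicator A z * v z\<bar> \<le> 6000" for z using v6[of z] by (simp add: indicator_def)
  qed measurable
  \<comment> \<open>As \<open>v\<close> integrates to zero, the constant \<open>c\<close> in
    \<open>f\<close> contributes nothing.\<close>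
  have "(\<integral>z. f z * v z \<partial>?M) = (\<integral>z. indicator A z * v z - c * v z \<partial>?M)"
    by (simp add: f_def left_diff_distrib)
  also have "\<dots> = (\<integral>z. indicator A z * v z \<partial>?M)"
    using iA iv v0 by simp
  finally have "c * (1 - c) / 108 \<le> (\<integral>z. indicator A z * v z \<partial>?M)"
    using gain by (simp add: v_def)
  then have "c + c * (1 - c) / 2592000 \<le> measure lborel (shear t u ` A)"
    unfolding img[OF A sub] cM[symmetric] by (simp add: t_def)
  with bl show ?thesis by blast
qed

section \<open>Exchange of coordinates, and iteration of the gain\<close>

lemma vimage_swap: "prod.swap -` X = prod.swap ` X"
  by (rule set_eqI) (metis imageE imageI swap_swap vimageD vimageI2)

lemma measure_swap:
  fixes X :: "(real \<times> real) set"
  assumes [measurable]: "X \<in> sets borel"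
  shows "measure lborel (prod.swap ` X) = measure lborel X"
proof -
  have eq: "lborel = distr lborel lborel (prod.swap :: real \<times> real \<Rightarrow> _)"
  proof -
    have sw: "prod.swap = (\<lambda>(x, y). (y, x) :: real \<times> real)" by (simp add: fun_eq_iff)
    show ?thesis unfolding sw
      using lborel_pair.distr_pair_swap[where 'a=real and 'b=real] unfolding lborel_prod .
  qed
  have "emeasure lborel X = emeasure (distr lborel lborel prod.swap) X" using eq by metis
  also have "\<dots> = emeasure lborel (prod.swap -` X)" by (simp add: emeasure_distr)
  also have "prod.swap -` X = prod.swap ` X" by (rule vimage_swap)
  finally show ?thesis by (simp add: measure_def)
qed

lemma bilip_swap:
  assumes "bilip C \<phi>"
  shows "bilip C (prod.swap \<circ> \<phi> \<circ> prod.swap)"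
  unfolding bilip_def
proof (intro conjI allI impI)
  have ds: "dist (prod.swap p) (prod.swap q) = dist p q" for p q :: "real \<times> real"
    by (simp add: dist_prod_def add.commute)
  show "bij (prod.swap \<circ> \<phi> \<circ> prod.swap)"
    by (intro bij_comp bij_swap bilipD(1)[OF assms])
  show "dist p q \<le> C * dist ((prod.swap \<circ> \<phi> \<circ> prod.swap) p) ((prod.swap \<circ> \<phi> \<circ> prod.swap) q)"
    "dist ((prod.swap \<circ> \<phi> \<circ> prod.swap) p) ((prod.swap \<circ> \<phi> \<circ> prod.swap) q) \<le> C * dist p q" for p q
    using bilipD(2,3)[OF assms, of "prod.swap p" "prod.swap q"] by (simp_all add: ds)
next
  fix p :: "real \<times> real" assume "p \<notin> {0<..<1} \<times> {0<..<1}"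
  then have "prod.swap p \<notin> {0<..<1} \<times> {0<..<1}" by (cases p) auto
  from bilipD(4)[OF assms this] show "(prod.swap \<circ> \<phi> \<circ> prod.swap) p = p" by simp
qed

text \<open>One direction carries enough energy. If it is y, the set is mirrored, sheared in x and
  mirrored back.\<close>

lemma gain_step:
  assumes A[measurable]: "A \<in> sets borel" and sub: "A \<subseteq> {0..<1} \<times> {0..<1}" and c: "c = measure lborel A"
  shows "\<exists>\<phi>. bilip 2 \<phi> \<and> c + c * (1 - c) / 2592000 \<le> measure lborel (\<phi> ` A)"
proof -
  let ?As = "prod.swap ` A"
  have cM: "c = measure (unif \<Otimes>\<^sub>M unif) A" using measure_unif2[OF A sub] c by simp
  have "bounded A" using sub by (rule bounded_subset[rotated]) (intro bounded_Times bounded_subset[OF bounded_closed_interval[of 0 1]]; auto)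
  from exists_haar_energy(2)[OF A this cM refl]
  obtain N where "c * (1 - c) / 3 \<le> (\<Sum>k<N. haar_energy k (\<lambda>z. indicator A z - c))
      \<or> c * (1 - c) / 3 \<le> (\<Sum>k<N. haar_energy k (\<lambda>z. indicator A (prod.swap z) - c))" by blast
  then show ?thesis
  proof
    assume "c * (1 - c) / 3 \<le> (\<Sum>k<N. haar_energy k (\<lambda>z. indicator A z - c))"
    then show ?thesis by (rule gain_x[OF A sub c])
  next
    assume en: "c * (1 - c) / 3 \<le> (\<Sum>k<N. haar_energy k (\<lambda>z. indicator A (prod.swap z) - c))"
    have vi: "prod.swap -` A = ?As" by (rule vimage_swap)
    have "prod.swap -` A \<inter> space borel \<in> sets borel" by (rule measurable_sets[OF measurable_swap_real A])
    then have As: "?As \<in> sets borel" by (simp add: vi)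
    have ind: "(indicator A (prod.swap z) :: real) = indicator ?As z" for z
      unfolding vi[symmetric] by (simp add: indicator_def)
    have "?As \<subseteq> {0..<1} \<times> {0..<1}" using sub by auto
    moreover have "c = measure lborel ?As" using c measure_swap[OF A] by simp
    ultimately obtain \<phi> where \<phi>: "bilip 2 \<phi>" "c + c * (1 - c) / 2592000 \<le> measure lborel (\<phi> ` ?As)"
      using gain_x[OF As] en unfolding ind by blast
    have "(prod.swap \<circ> \<phi> \<circ> prod.swap) ` A = prod.swap ` (\<phi> ` ?As)" by (simp add: image_comp)
    then have "measure lborel ((prod.swap \<circ> \<phi> \<circ> prod.swap) ` A) = measure lborel (\<phi> ` ?As)"
      using measure_swap[OF bilip_image_borel[OF \<phi>(1) As]] by simp
    then show ?thesis using \<phi> bilip_swap[OF \<phi>(1)] by (intro exI[of _ "prod.swap \<circ> \<phi> \<circ> prod.swap"]) simp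
  qed
qed

lemma bilip_weaken:
  assumes "bilip C \<phi>" "C \<le> D"
  shows "bilip D \<phi>"
proof -
  have "C * dist p q \<le> D * dist p q" for p q :: "real \<times> real"
    using assms(2) by (intro mult_right_mono) auto
  then show ?thesis using assms(1) unfolding bilip_def by (meson order_trans)
qed

text \<open>While the area is at least \<open>c\<close> and below \<open>1 - d\<close>, each step
  gains at least \<open>c * d / 2592000\<close> whatever the set; afterwards the map is kept. The
  minimum covers both situations, and the bi-Lipschitz constant depends on \<open>n\<close>
  alone.\<close>

lemma gain_iterate:
  assumes A: "A \<in> sets borel" and sub: "A \<subseteq> {0..<1} \<times> {0..<1}" and c: "c \<le> measure lborel A"
    and pos: "0 < c" "0 < d"
  shows "\<exists>\<phi>. bilip (2^n) \<phi> \<and> min (1 - d) (c + real n * (c * d / 2592000)) \<le> measure lborel (\<phi> ` A)"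
proof (induction n)
  case 0
  have "bilip (2^0) id" using bilip_id by (simp only: power_0)
  moreover have "min (1 - d) (c + real 0 * (c * d / 2592000)) \<le> measure lborel (id ` A)"
    using c by (simp add: min_le_iff_disj)
  ultimately show ?case by blast
next
  case (Suc n)
  let ?k = "c * d / 2592000"
  from Suc obtain \<phi> where \<phi>: "bilip (2^n) \<phi>" "min (1 - d) (c + real n * ?k) \<le> measure lborel (\<phi> ` A)" by blast
  define B where "B = \<phi> ` A"
  show ?case
  proof (cases "1 - d \<le> measure lborel B")
    case True
    have "bilip (2^Suc n) \<phi>" by (rule bilip_weaken[OF \<phi>(1)]) simp
    then show ?thesis using True by (intro exI[of _ \<phi>]) (simp add: B_def min_le_iff_disj)
  next
    case False
    have B: "B \<in> sets borel" unfolding B_def by (rule bilip_image_borel[OF \<phi>(1) A])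
    have "\<phi> ` ({0..<1} \<times> {0..<1}) = {0..<1} \<times> {0..<1}" by (rule bilip_image_superset[OF \<phi>(1)]) auto
    then have Bsub: "B \<subseteq> {0..<1} \<times> {0..<1}" unfolding B_def using sub by (metis image_mono)
    define \<mu> where "\<mu> = measure lborel B"
    have \<mu>: "c + real n * ?k \<le> \<mu>" "\<mu> < 1 - d" using \<phi>(2) False unfolding \<mu>_def B_def by auto
    have "0 \<le> real n * ?k" using pos by simp
    then have "c \<le> \<mu>" using \<mu>(1) by linarith
    then have "c * d \<le> \<mu> * (1 - \<mu>)" using \<mu>(2) pos by (intro mult_mono) auto
    then have k: "?k \<le> \<mu> * (1 - \<mu>) / 2592000" by (intro divide_right_mono) auto
    obtain \<psi> where \<psi>: "bilip 2 \<psi>" "\<mu> + \<mu> * (1 - \<mu>) / 2592000 \<le> measure lborel (\<psi> ` B)"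
      using gain_step[OF B Bsub \<mu>_def] by blast
    have "real (Suc n) * ?k = real n * ?k + ?k" unfolding of_nat_Suc by (simp only: distrib_right mult_1 add.commute)
    then have "c + real (Suc n) * ?k \<le> measure lborel (\<psi> ` B)"
      using \<mu>(1) \<psi>(2) k by linarith
    moreover have "(\<psi> \<circ> \<phi>) ` A = \<psi> ` B" by (simp add: B_def image_comp)
    ultimately have "min (1 - d) (c + real (Suc n) * ?k) \<le> measure lborel ((\<psi> \<circ> \<phi>) ` A)"
      by (simp only: min.coboundedI2)
    moreover have "bilip (2^Suc n) (\<psi> \<circ> \<phi>)"
      using bilip_comp[OF \<phi>(1) \<psi>(1)] by (simp add: mult.commute)
    ultimately show ?thesis by blast
  qed
qed

section \<open>Isometric transfer from pairs to vectors, and the conclusion\<close>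

definition vec2 :: "real \<times> real \<Rightarrow> real^2" where
  "vec2 z = (\<chi> i. if i = 1 then fst z else snd z)"

definition pair2 :: "real^2 \<Rightarrow> real \<times> real" where
  "pair2 v = (v $ 1, v $ 2)"

lemma vec2_nth [simp]: "vec2 z $ 1 = fst z" "vec2 z $ 2 = snd z"
  by (simp_all add: vec2_def)

lemma pair2_vec2 [simp]: "pair2 (vec2 z) = z"
  by (simp add: pair2_def)

lemma vec2_pair2 [simp]: "vec2 (pair2 v) = v"
  by (simp add: vec_eq_iff forall_2 pair2_def)

lemma dist_pair2: "dist (pair2 v) (pair2 w) = dist v w"
  by (simp add: dist_prod_def dist_vec_def L2_set_def sum_2 pair2_def)

lemma dist_vec2: "dist (vec2 p) (vec2 q) = dist p q"
  using dist_pair2[of "vec2 p" "vec2 q"] by simp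

lemma continuous_vec2: "continuous_on S vec2" and continuous_pair2: "continuous_on T pair2"
  unfolding continuous_on_iff by (auto simp: dist_vec2 dist_pair2)

lemma distr_vec2: "lborel = distr lborel borel vec2"
proof (rule lborel_eqI)
  fix l u :: "real^2"
  assume lu: "\<And>b. b \<in> Basis \<Longrightarrow> l \<bullet> b \<le> u \<bullet> b"
  have nth: "l $ i \<le> u $ i" for i
  proof -
    have "axis i (1::real) \<in> Basis" by (auto simp: Basis_vec_def)
    from lu[OF this] show ?thesis by (simp add: inner_axis)
  qed
  have [measurable]: "vec2 \<in> borel_measurable borel" by (intro borel_measurable_continuous_onI continuous_vec2)
  have B: "(Basis :: (real^2) set) = (\<lambda>i. axis i 1) ` UNIV" by (auto simp: Basis_vec_def)
  have "(\<Prod>b\<in>Basis. (u - l) \<bullet> b) = (u $ 1 - l $ 1) * (u $ 2 - l $ 2)"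
    unfolding B by (subst prod.reindex) (auto simp: inj_on_def axis_eq_axis UNIV_2 inner_axis)
  moreover have "vec2 -` box l u = {l $ 1<..<u $ 1} \<times> {l $ 2<..<u $ 2}"
    by (auto simp: mem_box_cart forall_2)
  moreover have "emeasure (lborel \<Otimes>\<^sub>M lborel) ({l $ 1<..<u $ 1} \<times> {l $ 2<..<u $ 2}) = ennreal ((u $ 1 - l $ 1) * (u $ 2 - l $ 2))"
    using nth by (subst lborel.emeasure_pair_measure_Times) (auto simp: ennreal_mult)
  ultimately show "emeasure (distr lborel borel vec2) (box l u) = ennreal (\<Prod>b\<in>Basis. (u - l) \<bullet> b)"
    by (simp add: emeasure_distr lborel_prod)
qed simp

lemma measure_vec2_image:
  assumes X: "X \<in> sets borel"
  shows "measure lebesgue (vec2 ` X) = measure lborel X"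
proof -
  have vi: "pair2 -` X = vec2 ` X"
    by (rule set_eqI) (metis imageE imageI pair2_vec2 vec2_pair2 vimageD vimageI2)
  have "pair2 \<in> borel_measurable borel" by (intro borel_measurable_continuous_onI continuous_pair2)
  from measurable_sets[OF this X] have V: "vec2 ` X \<in> sets borel" by (simp add: vi)
  have "emeasure lborel (vec2 ` X) = emeasure (distr lborel borel vec2) (vec2 ` X)" using distr_vec2 by metis
  also have "\<dots> = emeasure lborel (vec2 -` (vec2 ` X))"
    using V by (simp add: emeasure_distr borel_measurable_continuous_onI continuous_vec2)
  also have "vec2 -` (vec2 ` X) = X"
    by (metis inj_vimage_image_eq inj_on_inverseI pair2_vec2)
  finally show ?thesis using V by (simp add: measure_def)
qed

lemma mem_unit_square: "v \<in> unit_square \<longleftrightarrow> pair2 v \<in> {0..1} \<times> {0..1}"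
  by (auto simp: unit_square_def mem_box_cart forall_2 pair2_def)

theorem theorem1:
  fixes \<gamma> \<gamma>' :: real
  assumes "0 < \<gamma>" "\<gamma> < 1" "0 < \<gamma>'" "\<gamma>' < 1" "\<gamma> + \<gamma>' < 1"
  shows "\<exists>C0 > 0. \<forall>A. A \<in> sets borel \<and> A \<subseteq> unit_square \<and> measure lebesgue A = \<gamma> \<longrightarrow>
           (\<exists>\<phi>0 :: real^2 \<Rightarrow> real^2.
              bij_betw \<phi>0 unit_square unit_square \<and>
              (\<forall>x\<in>unit_square. \<forall>y\<in>unit_square.
                  dist x y / C0 \<le> dist (\<phi>0 x) (\<phi>0 y) \<and> dist (\<phi>0 x) (\<phi>0 y) \<le> C0 * dist x y) \<and>
              (\<forall>x\<in>frontier unit_square. \<phi>0 x = x) \<and>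
              measure lebesgue (\<phi>0 ` A) \<ge> 1 - \<gamma>')"
proof -
  let ?k = "\<gamma> * \<gamma>' / 2592000"
  have k: "0 < ?k" using assms by simp
  \<comment> \<open>With this \<open>n\<close> the linear term in \<open>gain_iterate\<close>
    exceeds 1, so the minimum there is \<open>1 - \<gamma>'\<close>. The choice precedes
    \<open>A\<close>, which makes the constant uniform.\<close>
  obtain n :: nat where n: "1 < real n * ?k" using reals_Archimedean3[OF k] by blast
  show ?thesis
  proof (intro exI[of _ "2^n"] conjI allI impI)
    fix A :: "(real^2) set"
    assume A: "A \<in> sets borel \<and> A \<subseteq> unit_square \<and> measure lebesgue A = \<gamma>"
    let ?Q = "{0..<1::real} \<times> {0..<1::real}"
    define A0 where "A0 = vec2 -` A"
    have "A0 \<inter> space borel \<in> sets borel" unfolding A0_def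
      by (rule measurable_sets[OF borel_measurable_continuous_onI[OF continuous_vec2]]) (use A in simp)
    then have A0: "A0 \<in> sets borel" by simp
    have imA0: "vec2 ` A0 = A" unfolding A0_def by (metis surj_image_vimage_eq surjI vec2_pair2)
    have A0sub: "A0 \<subseteq> {0..1} \<times> {0..1}"
    proof
      fix z assume "z \<in> A0"
      then have "vec2 z \<in> unit_square" using A by (auto simp: A0_def)
      then show "z \<in> {0..1} \<times> {0..1}" by (simp add: mem_unit_square)
    qed
    have mA0: "measure lborel A0 = \<gamma>" using measure_vec2_image[OF A0] A imA0 by simp
    \<comment> \<open>The gain is proved on the half-open square. The edges cut off here are null,
      and putting them back later can only enlarge the image.\<close>
    define A1 where "A1 = A0 \<inter> ?Q"
    have A1: "A1 \<in> sets borel" unfolding A1_def using A0 by simp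
    have AE1: "AE z in lborel. z \<in> A0 \<longleftrightarrow> z \<in> A1"
    proof -
      have "emeasure (lborel \<Otimes>\<^sub>M lborel) ({1::real} \<times> (UNIV::real set)) = 0"
        by (subst lborel.emeasure_pair_measure_Times) auto
      moreover have "emeasure (lborel \<Otimes>\<^sub>M lborel) ((UNIV::real set) \<times> {1::real}) = 0"
        by (subst lborel.emeasure_pair_measure_Times) auto
      ultimately have "{1::real} \<times> (UNIV::real set) \<union> UNIV \<times> {1} \<in> null_sets (lborel \<Otimes>\<^sub>M lborel)"
        by (intro null_sets.Un null_setsI) auto
      then have "AE z in lborel. z \<notin> {1::real} \<times> (UNIV::real set) \<union> UNIV \<times> {1}"
        unfolding lborel_prod by (rule AE_not_in)
      then show ?thesis
      proof eventually_elim
        case (elim z)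
        then have "z \<in> ?Q" if "z \<in> A0" using A0sub that by (cases z) (auto simp: less_le)
        then show ?case by (auto simp: A1_def)
      qed
    qed
    then have "measure lborel A1 = \<gamma>"
      using mA0 A0 A1 by (metis measure_eq_AE sets_lborel)
    then obtain \<phi> where \<phi>: "bilip (2^n) \<phi>" "min (1 - \<gamma>') (\<gamma> + real n * ?k) \<le> measure lborel (\<phi> ` A1)"
      using gain_iterate[OF A1 _ _ assms(1,3), of n] by (auto simp: A1_def)
    define \<phi>0 where "\<phi>0 = vec2 \<circ> \<phi> \<circ> pair2"
    have sq: "\<phi> ` ({0..1} \<times> {0..1}) = {0..1} \<times> {0..1}" by (rule bilip_image_superset[OF \<phi>(1)]) auto
    have us: "unit_square = vec2 ` ({0..1} \<times> {0..1})"
      by (auto simp: mem_unit_square image_iff) (metis vec2_pair2 mem_Times_iff atLeastAtMost_iff)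
    have "1 - \<gamma>' \<le> measure lborel (\<phi> ` A1)" using \<phi>(2) n assms by (simp add: min_def split: if_splits)
    also have "\<dots> \<le> measure lborel (\<phi> ` A0)"
    proof (rule measure_mono_fmeasurable)
      show "\<phi> ` A1 \<subseteq> \<phi> ` A0" by (auto simp: A1_def)
      show "\<phi> ` A1 \<in> sets lborel" using bilip_image_borel[OF \<phi>(1) A1] by simp
      have "bounded (\<phi> ` A0)" using A0sub sq
        by (metis bounded_Times bounded_closed_interval bounded_subset image_mono)
      from emeasure_bounded_finite[OF this] show "\<phi> ` A0 \<in> fmeasurable lborel"
        using bilip_image_borel[OF \<phi>(1) A0] by (intro fmeasurableI) auto
    qed
    also have "\<dots> = measure lebesgue (vec2 ` (\<phi> ` A0))"
      by (rule measure_vec2_image[OF bilip_image_borel[OF \<phi>(1) A0], symmetric])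
    also have "vec2 ` (\<phi> ` A0) = \<phi>0 ` A" unfolding imA0[symmetric] \<phi>0_def by (simp add: image_image)
    finally have meas: "1 - \<gamma>' \<le> measure lebesgue (\<phi>0 ` A)" .
    have "inj vec2" "inj pair2" by (metis inj_on_inverseI pair2_vec2, metis inj_on_inverseI vec2_pair2)
    then have "inj \<phi>0" unfolding \<phi>0_def using bij_is_inj[OF bilipD(1)[OF \<phi>(1)]] by (intro inj_compose) auto
    moreover have "\<phi>0 ` unit_square = unit_square"
      unfolding us \<phi>0_def using sq by (simp add: image_image flip: image_comp) (metis image_image)
    ultimately have bij: "bij_betw \<phi>0 unit_square unit_square"
      unfolding bij_betw_def using inj_on_subset by blast
    have lip: "dist x y / 2^n \<le> dist (\<phi>0 x) (\<phi>0 y) \<and> dist (\<phi>0 x) (\<phi>0 y) \<le> 2^n * dist x y" for x y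
      using bilipD(2,3)[OF \<phi>(1), of "pair2 x" "pair2 y"]
      by (simp add: \<phi>0_def dist_vec2 dist_pair2 field_simps)
    have fr: "\<phi>0 x = x" if "x \<in> frontier unit_square" for x
    proof -
      \<comment> \<open>The frontier misses the open square, off which \<open>\<phi>\<close> is the
        identity.\<close>
      have "x \<notin> box 0 1" using that by (simp add: unit_square_def frontier_cbox)
      then have "pair2 x \<notin> {0<..<1} \<times> {0<..<1}" by (auto simp: mem_box_cart forall_2 pair2_def)
      from bilipD(4)[OF \<phi>(1) this] show ?thesis by (simp add: \<phi>0_def)
    qed
    show "\<exists>\<phi>0 :: real^2 \<Rightarrow> real^2.
              bij_betw \<phi>0 unit_square unit_square \<and>
              (\<forall>x\<in>unit_square. \<forall>y\<in>unit_square.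
                  dist x y / 2^n \<le> dist (\<phi>0 x) (\<phi>0 y) \<and> dist (\<phi>0 x) (\<phi>0 y) \<le> 2^n * dist x y) \<and>
              (\<forall>x\<in>frontier unit_square. \<phi>0 x = x) \<and>
              measure lebesgue (\<phi>0 ` A) \<ge> 1 - \<gamma>'"
      using bij lip fr meas by blast
  qed simp
qed

end
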